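(* Let $m\ge1$ and let $K$ be a simplicial complex with vertex set $[m]$. Then for any field $\mathbb{F}$, $$\widetilde D(K;\mathbb{F})\le g\left(m,\left[\tfrac{m-1}{3}\right]\right)+1,$$ and equality holds if and only if $K=\Delta^{[m]}_{\left(\left[\frac{m-1}{3}\right]-1\right)}$.
   Context: $[m]=\{1,\dots,m\}$, and $[x]$ for a real number $x$ denotes its integer part. A simplicial complex with vertex set $[m]$ contains every singleton $\{i\}$, $i\in[m]$. For $0\le d<m$, $g(m,d)=\sum_{j=d+1}^{m}\binom mj\binom{j-1}{d}$. For $J\subseteq[m]$, $K|_J$ is the full subcomplex of $K$ on $J$. The reduced total Betti number is $\widetilde{tb}(X;\mathbb{F})=\sum_i\dim_{\mathbb{F}}\widetilde H_i(X;\mathbb{F})$, with $\widetilde H_{-1}(\varnothing;\mathbb{F})=\mathbb{F}$, so $\widetilde{tb}(\varnothing)=1$. The total bigraded Betti number of $K$ is $\widetilde D(K;\mathbb{F})=\dim_{\mathbb{F}}\mathrm{Tor}_{\mathbb{F}[v_1,\dots,v_m]}(\mathbb{F}[K],\mathbb{F})$, where $\mathbb{F}[K]$ is the Stanley-Reisner ring of $K$; by Hochster's formula, $\widetilde D(K;\mathbb{F})=\sum_{J\subseteq[m]}\widetilde{tb}(K|_J;\mathbb{F})$. $\Delta^{[m]}_{(k)}$ is the $k$-skeleton of the full simplex on $[m]$, i.e. all subsets of $[m]$ of size at most $k+1$; for $k=-1$ it is $\{\varnothing\}$ (which has no vertices, hence is never equal to a simplicial complex $K$ with vertex set $[m]$,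 $m\ge1$, since such a $K$ contains every singleton $\{i\}$, $i\in[m]$). *)

theory Defs
  imports
    "HOL-Library.Poly_Mapping"
    "HOL-Library.FuncSet"
    "HOL-Library.Extended_Nat"
    "HOL-Algebra.Algebra"
    "HOL-Algebra.Algebraic_Closure_Type"
begin

section \<open>Modules and Tor\<close>

text \<open>
  The record type \<open>('r, 'a) module\<close> of HOL-Algebra extends the one of rings; a module that is not
  an algebra leaves the multiplicative fields \<open>undefined\<close> (the locale \<open>module\<close> ignores them).
\<close>

definition regular_module :: "'r ring \<Rightarrow> ('r, 'r) module" where
  "regular_module R = ring.extend R (module.fields (\<otimes>\<^bsub>R\<^esub>))"

definition power_module :: "('r, 'a) module \<Rightarrow> nat \<Rightarrow> ('r, nat \<Rightarrow> 'a) module" where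
  "power_module M k =
     \<lparr>carrier = {..<k} \<rightarrow>\<^sub>E carrier M,
      monoid.mult = undefined,
      monoid.one = undefined,
      ring.zero = (\<lambda>i\<in>{..<k}. \<zero>\<^bsub>M\<^esub>),
      ring.add = (\<lambda>x y. \<lambda>i\<in>{..<k}. x i \<oplus>\<^bsub>M\<^esub> y i),
      module.smult = (\<lambda>r x. \<lambda>i\<in>{..<k}. r \<odot>\<^bsub>M\<^esub> x i)\<rparr>"

definition quotient_module :: "('r, 'a) module \<Rightarrow> 'a set \<Rightarrow> ('r, 'a set) module" where
  "quotient_module M W =
     \<lparr>carrier = a_rcosets\<^bsub>M\<^esub> W,
      monoid.mult = undefined,
      monoid.one = undefined,
      ring.zero = W,
      ring.add = set_add M,
      module.smult = (\<lambda>r C. \<Union>x\<in>C. W +>\<^bsub>M\<^esub> (r \<odot>\<^bsub>M\<^esub> x))\<rparr>"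

text \<open>The map from the \<open>k\<close>-th to the \<open>l\<close>-th power of \<open>M\<close> given by an \<open>l \<times> k\<close> matrix over the ring.\<close>

definition matrix_map ::
  "('r, 'a) module \<Rightarrow> nat \<Rightarrow> nat \<Rightarrow> (nat \<Rightarrow> nat \<Rightarrow> 'r) \<Rightarrow> (nat \<Rightarrow> 'a) \<Rightarrow> nat \<Rightarrow> 'a" where
  "matrix_map M k l A x = (\<lambda>i\<in>{..<l}. \<Oplus>\<^bsub>M\<^esub>j\<in>{..<k}. A i j \<odot>\<^bsub>M\<^esub> x j)"

text \<open>
  A resolution of \<open>N\<close> by free modules of finite rank,
    \<open>\<dots> \<rightarrow> R\<^bsup>b 2\<^esup> \<rightarrow> R\<^bsup>b 1\<^esup> \<rightarrow> R\<^bsup>b 0\<^esup> \<rightarrow> N \<rightarrow> 0\<close>.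
  The \<open>b n \<times> b (n + 1)\<close> matrix \<open>A n\<close> gives the differential from degree \<open>n + 1\<close> to degree \<open>n\<close>,
  and \<open>e j\<close> is the image in \<open>N\<close> of the \<open>j\<close>-th basis vector in degree \<open>0\<close>.
\<close>

definition free_resolution ::
  "'r ring \<Rightarrow> ('r, 'n) module \<Rightarrow> (nat \<Rightarrow> nat) \<Rightarrow> (nat \<Rightarrow> nat \<Rightarrow> nat \<Rightarrow> 'r) \<Rightarrow> (nat \<Rightarrow> 'n) \<Rightarrow> bool" where
  "free_resolution R N b A e \<longleftrightarrow>
     (let P = (\<lambda>n. power_module (regular_module R) (b n));
          d = (\<lambda>n. matrix_map (regular_module R) (b (Suc n)) (b n) (A n));
          \<epsilon> = (\<lambda>x. \<Oplus>\<^bsub>N\<^esub>j\<in>{..<b 0}. x j \<odot>\<^bsub>N\<^esub> e j)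
      in (\<forall>n. \<forall>i<b n. \<forall>j<b (Suc n). A n i j \<in> carrier R) \<and>
         (\<forall>j<b 0. e j \<in> carrier N) \<and>
         \<epsilon> ` carrier (P 0) = carrier N \<and>
         a_kernel (P 0) N \<epsilon> = d 0 ` carrier (P 1) \<and>
         (\<forall>n. a_kernel (P (Suc n)) (P n) (d n) = d (Suc n) ` carrier (P (Suc (Suc n)))))"

text \<open>
  The homology in degree \<open>n\<close> of the complex obtained by tensoring \<open>M\<close> with the free modules of a
  resolution, where \<open>M \<otimes> R\<^bsup>b n\<^esup>\<close> is \<open>M\<^bsup>b n\<^esup>\<close> and the differentials are given by the same matrices.
\<close>

definition tensor_cycles ::
  "('r, 'a) module \<Rightarrow> (nat \<Rightarrow> nat) \<Rightarrow> (nat \<Rightarrow> nat \<Rightarrow> nat \<Rightarrow> 'r) \<Rightarrow> nat \<Rightarrow> (nat \<Rightarrow> 'a) set" where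
  "tensor_cycles M b A n =
     (case n of
        0 \<Rightarrow> carrier (power_module M (b 0))
      | Suc k \<Rightarrow> a_kernel (power_module M (b (Suc k))) (power_module M (b k))
                   (matrix_map M (b (Suc k)) (b k) (A k)))"

definition tensor_boundaries ::
  "('r, 'a) module \<Rightarrow> (nat \<Rightarrow> nat) \<Rightarrow> (nat \<Rightarrow> nat \<Rightarrow> nat \<Rightarrow> 'r) \<Rightarrow> nat \<Rightarrow> (nat \<Rightarrow> 'a) set" where
  "tensor_boundaries M b A n =
     matrix_map M (b (Suc n)) (b n) (A n) ` carrier (power_module M (b (Suc n)))"

definition tensor_homology ::
  "('r, 'a) module \<Rightarrow> (nat \<Rightarrow> nat) \<Rightarrow> (nat \<Rightarrow> nat \<Rightarrow> nat \<Rightarrow> 'r) \<Rightarrow> nat \<Rightarrow> ('r, (nat \<Rightarrow> 'a) set) module" where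
  "tensor_homology M b A n =
     quotient_module ((power_module M (b n))\<lparr>carrier := tensor_cycles M b A n\<rparr>)
       (tensor_boundaries M b A n)"

text \<open>
  The module \<open>Tor\<^sub>n(M, N)\<close> over \<open>R\<close>, computed from some resolution of \<open>N\<close>; up to isomorphism it does
  not depend on the choice.  It is meant for modules \<open>N\<close> that have a resolution by free modules of
  finite rank, as all finitely generated modules over a Noetherian ring do.
\<close>

definition Tor ::
  "'r ring \<Rightarrow> ('r, 'a) module \<Rightarrow> ('r, 'n) module \<Rightarrow> nat \<Rightarrow> ('r, (nat \<Rightarrow> 'a) set) module" where
  "Tor R M N n =
     (let (b, A, e) = (SOME (b, A, e). free_resolution R N b A e) in tensor_homology M b A n)"

text \<open>
  The dimension over the field \<open>'f\<close> of a module over a ring containing (via \<open>\<iota>\<close>) this field.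
  It is the supremum of the sizes of finite linearly independent sets, hence \<open>\<infinity>\<close> for infinite
  dimension.
\<close>

definition lin_indep_over :: "('f::field \<Rightarrow> 'r) \<Rightarrow> ('r, 'a) module \<Rightarrow> 'a set \<Rightarrow> bool" where
  "lin_indep_over \<iota> V B \<longleftrightarrow>
     (\<forall>c. (\<Oplus>\<^bsub>V\<^esub>x\<in>B. \<iota> (c x) \<odot>\<^bsub>V\<^esub> x) = \<zero>\<^bsub>V\<^esub> \<longrightarrow> (\<forall>x\<in>B. c x = 0))"

definition dim_over :: "('f::field \<Rightarrow> 'r) \<Rightarrow> ('r, 'a) module \<Rightarrow> enat" where
  "dim_over \<iota> V =
     (SUP B \<in> {B. finite B \<and> B \<subseteq> carrier V \<and> lin_indep_over \<iota> V B}. enat (card B))"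

section \<open>Simplicial complexes\<close>

definition simplicial_complex_on :: "nat \<Rightarrow> nat set set \<Rightarrow> bool" where
  "simplicial_complex_on m K \<longleftrightarrow>
     K \<subseteq> Pow {1..m} \<and> {} \<in> K \<and> (\<forall>\<sigma>\<in>K. \<forall>\<tau>\<subseteq>\<sigma>. \<tau> \<in> K) \<and> (\<forall>i\<in>{1..m}. {i} \<in> K)"

definition simplex_skeleton :: "nat \<Rightarrow> int \<Rightarrow> nat set set" where
  "simplex_skeleton m k = {\<sigma>. \<sigma> \<subseteq> {1..m} \<and> int (card \<sigma>) \<le> k + 1}"

section \<open>Stanley-Reisner rings and total bigraded Betti numbers\<close>

text \<open>Polynomials in variables indexed by the natural numbers; an exponent vector is a \<open>nat \<Rightarrow>\<^sub>0 nat\<close>.\<close>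

type_synonym 'f mpoly = "(nat \<Rightarrow>\<^sub>0 nat) \<Rightarrow>\<^sub>0 'f"

definition mvar :: "nat \<Rightarrow> 'f::field mpoly" where
  "mvar i = Poly_Mapping.single (Poly_Mapping.single i 1) 1"

definition mconst :: "'f \<Rightarrow> 'f::field mpoly" where
  "mconst c = Poly_Mapping.single 0 c"

text \<open>The polynomial ring in the variables with indices \<open>1, \<dots>, m\<close>.\<close>

definition poly_ring_on :: "nat \<Rightarrow> 'f::field mpoly ring" where
  "poly_ring_on m =
     ring_of_type_algebra\<lparr>carrier := {p. \<forall>t\<in>Poly_Mapping.keys p. Poly_Mapping.keys t \<subseteq> {1..m}}\<rparr>"

definition stanley_reisner_ideal :: "nat \<Rightarrow> nat set set \<Rightarrow> 'f::field mpoly set" where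
  "stanley_reisner_ideal m K =
     genideal (poly_ring_on m) {(\<Prod>i\<in>J. mvar i) | J. J \<subseteq> {1..m} \<and> J \<notin> K}"

definition stanley_reisner_ring :: "nat \<Rightarrow> nat set set \<Rightarrow> 'f::field mpoly set ring" where
  "stanley_reisner_ring m K = poly_ring_on m Quot stanley_reisner_ideal m K"

definition stanley_reisner_module ::
  "nat \<Rightarrow> nat set set \<Rightarrow> ('f::field mpoly, 'f mpoly set) module" where
  "stanley_reisner_module m K =
     ring.extend (stanley_reisner_ring m K)
       (module.fields (\<lambda>p C. (stanley_reisner_ideal m K +>\<^bsub>poly_ring_on m\<^esub> p)
                               \<otimes>\<^bsub>stanley_reisner_ring m K\<^esub> C))"

text \<open>The field as a module over the polynomial ring: every variable acts as zero.\<close>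

definition residue_field_module :: "('f::field mpoly, 'f) module" where
  "residue_field_module =
     ring.extend ring_of_type_algebra (module.fields (\<lambda>p c. Poly_Mapping.lookup p 0 * c))"

text \<open>
  The total dimension of \<open>Tor\<close>, summed over all homological degrees (the internal multidegrees need
  not be separated for this); the field is passed as a type.
\<close>

definition total_bigraded_betti :: "'f::field itself \<Rightarrow> nat \<Rightarrow> nat set set \<Rightarrow> enat" where
  "total_bigraded_betti _ m K =
     (SUP N. \<Sum>n<N. dim_over (mconst :: 'f \<Rightarrow> 'f mpoly)
        (Tor (poly_ring_on m) (stanley_reisner_module m K) residue_field_module n))"

definition g_bound :: "nat \<Rightarrow> nat \<Rightarrow> nat" where
  "g_bound m d = (\<Sum>j = d + 1..m. (m choose j) * ((j - 1) choose d))"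

end

theory Submission
  imports
    Defs
    "HOL-Library.Function_Algebras"
begin

text \<open>
  Tensoring the Koszul resolution of the residue field with the Stanley-Reisner ring gives a complex
  spanned by the pairs of a monomial \<open>t\<close> with support in \<open>K\<close> and a subset \<open>J\<close> of the vertices, and it
  is graded by the exponent vector \<open>a\<close> of \<open>t \<cdot> \<Prod>i\<in>J. x\<^sub>i\<close>.  In every degree \<open>a \<noteq> 0\<close> choose a
  vertex \<open>v\<close> of the support of \<open>a\<close>.  Moving \<open>v\<close> between \<open>t\<close> and \<open>J\<close> is a contracting homotopy up to the
  pairs with \<open>v \<in> J\<close> for which \<open>t x\<^sub>v\<close> vanishes.  If \<open>a\<^sub>v \<ge> 2\<close> there are none; if \<open>a\<close> is the indicator
  of \<open>U\<close>, they correspond to the faces \<open>\<sigma> \<subseteq> U - {v}\<close> with \<open>\<sigma> \<union> {v} \<notin> K\<close>.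

  So the total Betti number is at most 1 plus the sum over \<open>U\<close> of the number of these faces, for the
  best choice of \<open>v \<in> U\<close>, hence at most the average over \<open>v \<in> U\<close>.  Double counting turns the averaged
  sum into \<open>\<Sum>i. (p\<^sub>i - p\<^sub>i\<^sub>+\<^sub>1) g(m, i)\<close>, where \<open>p\<^sub>i\<close> is the fraction of the \<open>i\<close>-subsets of the vertex
  set that are faces.  As \<open>p\<close> decreases from 1 to at least 0, this is at most \<open>max\<^sub>i g(m, i)\<close>.  The
  maximum is attained at \<open>i = (m - 1) div 3\<close> only, so equality forces \<open>p\<close> to drop from 1 to 0 there, and
  \<open>K\<close> is a skeleton.  For a skeleton the critical faces all have the maximal dimension, so they are
  cocycles, and they are independent modulo coboundaries.
\<close>

section \<open>Unimodality of the bound\<close>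

text \<open>\<open>Tor\<close> uses a resolution picked by \<open>SOME\<close>, so nothing may
  depend on which one it is. Two resolutions are compared by chain maps; only injectivity on
  homology is proved, because exchanging the two gives the other inequality. Quotients are avoided
  by working with representatives in free modules over the polynomial ring and with
  \<open>rel_dim\<close>, the dimension of cycles modulo boundaries. The contraction lives over the
  polynomial ring itself, so one identity shows both that the Koszul complex is exact and which
  cells survive modulo the nonfaces. The 3 in (m - 1) div 3 comes from g(m, d) + g(m, d+1) = C(m,
  d+1) 2^(m-d-1): the values still grow at d when g(m, d+1) is more than half of this. With n = m -
  (d+1) its share lies between n/(n + 2(d+1) + 1) and n/(n + 2(d+1)), which passes 1/2 near n =
  2(d+1), that is m = 3(d+1). Averaging gives v the weight 1/card U. Summed over all U containing a
  fixed \<sigma> and v, these weights equal g(m, i) divided by (m-i) C(m, i), the number of all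
  pairs of an i-set and a point outside it; so only densities of faces remain.\<close>

lemma sum_choose_mult_choose:
  "(\<Sum>j\<le>m. (m choose j) * (j choose d)) = (m choose d) * 2 ^ (m - d)"
proof (cases "d \<le> m")
  case True
  have "(\<Sum>j\<le>m. (m choose j) * (j choose d)) = (\<Sum>j\<in>{d..m}. (m choose j) * (j choose d))"
    by (rule sum.mono_neutral_right) auto
  \<comment> \<open>Trinomial revision: choose the d-set first, then the rest of the j-set.\<close>
  also have "\<dots> = (\<Sum>j\<in>{d..m}. (m choose d) * ((m - d) choose (j - d)))"
    by (intro sum.cong refl choose_mult) auto
  also have "\<dots> = (m choose d) * (\<Sum>j\<in>{d..m}. (m - d) choose (j - d))"
    by (simp add: sum_distrib_left)
  also have "(\<Sum>j\<in>{d..m}. (m - d) choose (j - d)) = (\<Sum>j\<le>m - d. (m - d) choose j)"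
    using True by (intro sum.reindex_bij_witness[where i = "\<lambda>j. j + d" and j = "\<lambda>j. j - d"]) auto
  also have "\<dots> = 2 ^ (m - d)" by (rule choose_row_sum)
  finally show ?thesis .
next
  case False
  then show ?thesis by (simp add: binomial_eq_0)
qed

lemma g_bound_atMost: "g_bound m d = (\<Sum>j\<in>{1..m}. (m choose j) * ((j - 1) choose d))"
  unfolding g_bound_def by (rule sum.mono_neutral_left) auto

lemma g_bound_0 [simp]: "g_bound 0 d = 0"
  by (simp add: g_bound_def)

lemma g_bound_eq_0 [simp]: "m \<le> d \<Longrightarrow> g_bound m d = 0"
  by (simp add: g_bound_def)

text \<open>Pascal's rule splits \<open>Suc m choose Suc j\<close>: one half is the same sum for m,
  the other is evaluated by \<open>sum_choose_mult_choose\<close>. With d fixed this is a recursion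
  in m, whose increment is the T of the estimates below.\<close>

lemma g_bound_Suc: "g_bound (Suc m) d = g_bound m d + (m choose d) * 2 ^ (m - d)"
proof -
  have "g_bound (Suc m) d = (\<Sum>j\<le>m. (Suc m choose Suc j) * (j choose d))"
    unfolding g_bound_atMost
    by (rule sum.reindex_bij_witness[where i = Suc and j = "\<lambda>j. j - 1"]) auto
  also have "\<dots> = (\<Sum>j\<le>m. (m choose Suc j) * (j choose d)) + (\<Sum>j\<le>m. (m choose j) * (j choose d))"
    by (simp add: sum.distrib algebra_simps)
  also have "(\<Sum>j\<le>m. (m choose Suc j) * (j choose d)) = (\<Sum>j<m. (m choose Suc j) * (j choose d))"
    by (rule sum.mono_neutral_right) auto
  also have "\<dots> = g_bound m d"
    unfolding g_bound_atMost
    by (rule sum.reindex_bij_witness[where i = "\<lambda>j. j - 1" and j = Suc]) auto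
  finally show ?thesis by (simp add: sum_choose_mult_choose)
qed

text \<open>Ties neighbouring values together: which one is larger depends only on whether one of
  them exceeds half of the right-hand side.\<close>

lemma g_bound_add_g_bound_Suc:
  "g_bound m d + g_bound m (Suc d) = (m choose Suc d) * 2 ^ (m - Suc d)"
proof (induction m)
  case (Suc m)
  show ?case
  proof (cases "Suc d \<le> m")
    case True
    then have "m - d = Suc (m - Suc d)" by simp
    then show ?thesis using Suc by (simp add: g_bound_Suc algebra_simps)
  next
    case False
    then show ?thesis using Suc by (cases "d = m") (auto simp: g_bound_Suc binomial_eq_0)
  qed
qed auto

text \<open>The ratio of successive increments in \<open>g_bound_Suc\<close> with m = d + n, cleared
  of denominators so that it can serve as a rewrite rule.\<close>

lemma choose_power_Suc:
  "real (Suc n) * (real (d + Suc n choose d) * 2 ^ Suc n) =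
     2 * real (d + n + 1) * (real (d + n choose d) * 2 ^ n)"
proof -
  have "Suc n * (d + Suc n choose d) = (d + n + 1) * (d + n choose d)"
    using binomial_absorb_comp[of "d + Suc n" d] by simp
  then have "real (Suc n) * real (d + Suc n choose d) = real (d + n + 1) * real (d + n choose d)"
    by (metis of_nat_mult)
  then have "real (Suc n) * real (d + Suc n choose d) * (2 * 2 ^ n) =
      real (d + n + 1) * real (d + n choose d) * (2 * 2 ^ n)" by (simp only:)
  then show ?thesis by (simp only: power_Suc mult_ac)
qed

text \<open>The defect E(n) = (n + 2d + 1) g - n T, with T = C(d + n, d) 2^n, satisfies E(0) = 0 and
  (n + 2d + 1) E(n + 1) = (n + 2d + 2) E(n) + n T. Hence E(1) = 0 as well, and E is positive from n
  = 2 on.\<close>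

lemma g_bound_lower_strict:
  assumes "n \<ge> 2"
  shows "real n * (real (d + n choose d) * 2 ^ n) < real (n + 2 * d + 1) * real (g_bound (d + n) d)"
proof -
  define T where "T n = real (d + n choose d) * 2 ^ n" for n
  define g where "g n = real (g_bound (d + n) d)" for n
  have Tpos: "T n > 0" for n by (simp add: T_def)
  have gS: "g (Suc n) = g n + T n" for n by (simp add: g_def T_def g_bound_Suc)
  have TS: "real (Suc n) * T (Suc n) = 2 * real (d + n + 1) * T n" for n
    unfolding T_def by (rule choose_power_Suc)
  have key: "real (n + 2 * d + 1) *
        (real (Suc n + 2 * d + 1) * g (Suc n) - real (Suc n) * T (Suc n)) =
      real (n + 2 * d + 2) * (real (n + 2 * d + 1) * g n - real n * T n) + real n * T n" for n
    unfolding gS TS by (simp add: algebra_simps)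
  have le: "real n * T n \<le> real (n + 2 * d + 1) * g n" for n
  proof (induction n)
    case (Suc n)
    then have "0 \<le> real (n + 2 * d + 1) *
        (real (Suc n + 2 * d + 1) * g (Suc n) - real (Suc n) * T (Suc n))"
      unfolding key using Tpos[of n] by (intro add_nonneg_nonneg mult_nonneg_nonneg) auto
    then show ?case unfolding zero_le_mult_iff by auto
  qed (simp add: g_def)
  from assms obtain k where k: "n = Suc k" "k \<ge> 1" by (cases n) auto
  have "0 < real (k + 2 * d + 1) *
      (real (Suc k + 2 * d + 1) * g (Suc k) - real (Suc k) * T (Suc k))"
    unfolding key using Tpos[of k] le[of k] k(2)
    by (intro add_nonneg_pos mult_nonneg_nonneg mult_pos_pos) auto
  then have "0 < real (Suc k + 2 * d + 1) * g (Suc k) - real (Suc k) * T (Suc k)"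
    unfolding zero_less_mult_iff by auto
  then show ?thesis by (simp add: T_def g_def k(1) del: of_nat_Suc power_Suc)
qed

text \<open>The same argument from the other side: E(n) = n T - (n + 2d) g satisfies (n + 2d) E(n +
  1) = (n + 2d + 1) E(n) + 2d T, and the last term is positive for d >= 1.\<close>

lemma g_bound_upper_strict:
  assumes "d \<ge> 1" "n \<ge> 1"
  shows "real (n + 2 * d) * real (g_bound (d + n) d) < real n * (real (d + n choose d) * 2 ^ n)"
proof -
  define T where "T n = real (d + n choose d) * 2 ^ n" for n
  define g where "g n = real (g_bound (d + n) d)" for n
  have Tpos: "T n > 0" for n by (simp add: T_def)
  have gS: "g (Suc n) = g n + T n" for n by (simp add: g_def T_def g_bound_Suc)
  have TS: "real (Suc n) * T (Suc n) = 2 * real (d + n + 1) * T n" for n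
    unfolding T_def by (rule choose_power_Suc)
  have key: "real (n + 2 * d) * (real (Suc n) * T (Suc n) - real (Suc n + 2 * d) * g (Suc n)) =
      real (n + 2 * d + 1) * (real n * T n - real (n + 2 * d) * g n) + 2 * d * T n" for n
    unfolding gS TS by (simp add: algebra_simps)
  have step: "real (Suc n + 2 * d) * g (Suc n) < real (Suc n) * T (Suc n)"
    if "real (n + 2 * d) * g n \<le> real n * T n" for n
  proof -
    have "0 < real (n + 2 * d) * (real (Suc n) * T (Suc n) - real (Suc n + 2 * d) * g (Suc n))"
      unfolding key using Tpos[of n] that assms(1)
      by (intro add_nonneg_pos mult_nonneg_nonneg mult_pos_pos) auto
    then show ?thesis unfolding zero_less_mult_iff by auto
  qed
  have le: "real (n + 2 * d) * g n \<le> real n * T n" for n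
  proof (induction n)
    case (Suc n)
    then show ?case using step[of n] by simp
  qed (simp add: g_def)
  show ?thesis using step[OF le[of "n - 1"]] assms(2) by (simp add: g_def T_def)
qed

text \<open>With n = m - (d + 1) the hypothesis reads n >= 2(d + 1) + 1, so the lower estimate gives
  \<open>g_bound m (Suc d)\<close> more than half of the sum of the two values.\<close>

lemma g_bound_less_Suc:
  assumes "3 * Suc d + 1 \<le> m"
  shows "g_bound m d < g_bound m (Suc d)"
proof -
  define n where "n = m - Suc d"
  have m: "m = Suc d + n" and n: "n \<ge> 2 * Suc d + 1" using assms by (auto simp: n_def)
  let ?T = "real (Suc d + n choose Suc d) * 2 ^ n"
  have T: "real (g_bound m d) + real (g_bound m (Suc d)) = ?T"
    using g_bound_add_g_bound_Suc[of m d] unfolding m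
    by (simp del: binomial_Suc_Suc flip: of_nat_add)
  have "(real n + 2 * Suc d + 1) * ?T \<le> 2 * real n * ?T"
    using n by (intro mult_right_mono) auto
  also have "\<dots> < 2 * (real (n + 2 * Suc d + 1) * real (g_bound m (Suc d)))"
    using g_bound_lower_strict[of n "Suc d"] n unfolding m by simp
  finally have "(real n + 2 * Suc d + 1) * ?T < (real n + 2 * Suc d + 1) * (2 * g_bound m (Suc d))"
    by (simp add: algebra_simps)
  then have "?T < 2 * g_bound m (Suc d)"
    by (subst (asm) mult_less_cancel_left_pos) auto
  then show ?thesis using T by linarith
qed

lemma g_bound_Suc_less:
  assumes "d < m" "m \<le> 3 * Suc d"
  shows "g_bound m (Suc d) < g_bound m d"
proof -
  define n where "n = m - Suc d"
  have m: "m = Suc d + n" and n: "n \<le> 2 * Suc d" using assms by (auto simp: n_def)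
  let ?T = "real (Suc d + n choose Suc d) * 2 ^ n"
  have T: "real (g_bound m d) + real (g_bound m (Suc d)) = ?T"
    using g_bound_add_g_bound_Suc[of m d] unfolding m
    by (simp del: binomial_Suc_Suc flip: of_nat_add)
  show ?thesis
  proof (cases "n = 0")
    case True
    then show ?thesis using T m by simp
  next
    case False
    then have "2 * (real (n + 2 * Suc d) * real (g_bound m (Suc d))) < 2 * real n * ?T"
      using g_bound_upper_strict[of "Suc d" n] unfolding m by simp
    also have "\<dots> \<le> (real n + 2 * Suc d) * ?T"
      using n by (intro mult_right_mono) auto
    finally have "(real n + 2 * Suc d) * (2 * g_bound m (Suc d)) < (real n + 2 * Suc d) * ?T"
      by (simp add: algebra_simps)
    then have "2 * g_bound m (Suc d) < ?T"
      by (subst (asm) mult_less_cancel_left_pos) auto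
    then show ?thesis using T by linarith
  qed
qed

text \<open>The ranges of the two comparisons meet at e = (m - 1) div 3: the step from d to d + 1
  increases as long as d + 1 <= e and decreases from d = e on.\<close>

proposition g_bound_less_max:
  assumes "d < m" "d \<noteq> (m - 1) div 3"
  shows "g_bound m d < g_bound m ((m - 1) div 3)"
proof (cases "d < (m - 1) div 3")
  case True
  have "g_bound m d < g_bound m e" if "d < e" "e \<le> (m - 1) div 3" for e
    using that
  proof (induction e)
    case (Suc e)
    then have "3 * Suc e + 1 \<le> m" by presburger
    then have "g_bound m e < g_bound m (Suc e)" by (rule g_bound_less_Suc)
    then show ?case using Suc by (cases "d = e") auto
  qed simp
  then show ?thesis using True by blast
next
  case False
  have "g_bound m e < g_bound m ((m - 1) div 3)" if "(m - 1) div 3 < e" "e < m" for e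
    using that
  proof (induction e)
    case (Suc e)
    then have "e < m" "m \<le> 3 * Suc e" by presburger+
    then have "g_bound m (Suc e) < g_bound m e" by (rule g_bound_Suc_less)
    then show ?case using Suc by (cases "e = (m - 1) div 3") auto
  qed simp
  then show ?thesis using False assms by simp
qed

section \<open>Critical faces of a simplicial complex\<close>

text \<open>In K restricted to U, the faces of the deletion of v outside the link of v. They are
  what the matching of \<sigma> with \<open>insert v \<sigma>\<close> leaves over.\<close>

definition critical_faces :: "'a set set \<Rightarrow> 'a set \<Rightarrow> 'a \<Rightarrow> 'a set set" where
  "critical_faces K U v = {\<sigma>. \<sigma> \<subseteq> U - {v} \<and> \<sigma> \<in> K \<and> insert v \<sigma> \<notin> K}"

lemma finite_critical_faces [simp]: "finite U \<Longrightarrow> finite (critical_faces K U v)"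
  by (rule finite_subset[of _ "Pow U"]) (auto simp: critical_faces_def)

lemma sum_Pow_card:
  fixes F :: "nat \<Rightarrow> 'b::{comm_semiring_1}"
  assumes "finite A"
  shows "(\<Sum>T\<in>Pow A. F (card T)) = (\<Sum>k\<le>card A. of_nat (card A choose k) * F k)"
proof -
  have "(\<Sum>T\<in>Pow A. F (card T)) = (\<Sum>k\<le>card A. \<Sum>T\<in>{T \<in> Pow A. card T = k}. F (card T))"
    using assms by (intro sum.group[symmetric]) (auto intro: card_mono)
  also have "\<dots> = (\<Sum>k\<le>card A. of_nat (card {T. T \<subseteq> A \<and> card T = k}) * F k)"
    by (intro sum.cong) auto
  finally show ?thesis using assms by (simp add: n_subsets)
qed

text \<open>The total weight in the average of one critical pair (\<sigma>, v) with card \<sigma> =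
  i, where S = \<open>insert v \<sigma>\<close>: it is counted once for each U containing S, with
  weight 1/card U.\<close>

lemma sum_supersets_inverse_card:
  assumes "finite A" "S \<subseteq> A" "card S = Suc i"
  shows "(\<Sum>U | S \<subseteq> U \<and> U \<subseteq> A. 1 / real (card U)) =
    real (g_bound (card A) i) / (real (card A - i) * real (card A choose i))"
proof -
  define m where "m = card A"
  have fS: "finite S" using assms finite_subset by blast
  have m: "Suc i \<le> m" using assms card_mono[of A S] by (simp add: m_def)
  have "(\<Sum>U | S \<subseteq> U \<and> U \<subseteq> A. 1 / real (card U)) = (\<Sum>T\<in>Pow (A - S). 1 / real (Suc i + card T))"
  proof (rule sum.reindex_bij_witness[where i = "\<lambda>T. S \<union> T" and j = "\<lambda>U. U - S"])
    fix U assume "U \<in> {U. S \<subseteq> U \<and> U \<subseteq> A}"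
    then show "1 / real (Suc i + card (U - S)) = 1 / real (card U)"
      using assms finite_subset[of U A] card_mono[of U S] by (auto simp: card_Diff_subset fS)
  qed (use assms in auto)
  also have "\<dots> = (\<Sum>k\<le>card (A - S). real (card (A - S) choose k) * (1 / real (Suc i + k)))"
    using assms by (intro sum_Pow_card[where F = "\<lambda>k. 1 / real (Suc i + k)"]) auto
  also have "card (A - S) = m - Suc i" using assms fS by (simp add: card_Diff_subset m_def)
  also have "(\<Sum>k\<le>m - Suc i. real (m - Suc i choose k) * (1 / real (Suc i + k))) =
      (\<Sum>k\<le>m - Suc i. real (m choose (Suc i + k)) * real (i + k choose i)) / (real (m - i) * real (m choose i))"
    unfolding sum_divide_distrib
  proof (rule sum.cong)
    fix k assume "k \<in> {..m - Suc i}"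
    then have k: "Suc i + k \<le> m" using m by simp
    \<comment> \<open>Both sides count the choices of an i-set, a further point v and k further
      elements: on the left U is chosen first, then v, then the i-set; on the right the i-set, then
      v, then the rest.\<close>
    have "(Suc i + k) * ((m choose (Suc i + k)) * (i + k choose i)) =
        (m - i) * (m choose i) * (m - Suc i choose k)"
    proof -
      have S: "(Suc i + k) * (i + k choose i) = Suc i * (Suc i + k choose Suc i)"
        using Suc_times_binomial_eq[of "i + k" i] by (simp add: mult.commute)
      have "(Suc i + k) * ((m choose (Suc i + k)) * (i + k choose i)) =
          (m choose (Suc i + k)) * ((Suc i + k) * (i + k choose i))"
        by (rule mult.left_commute)
      also have "\<dots> = Suc i * ((m choose (Suc i + k)) * (Suc i + k choose Suc i))"
        unfolding S by (rule mult.left_commute)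
      also have "Suc i * ((m choose (Suc i + k)) * (Suc i + k choose Suc i)) = Suc i * (m choose Suc i) * (m - Suc i choose k)"
        using choose_mult[of "Suc i" "Suc i + k" m] k
        by (simp only: mult.assoc le_add1 diff_add_inverse)
      also have "Suc i * (m choose Suc i) = (m - i) * (m choose i)"
        using binomial_absorption[of i m] binomial_absorb_comp[of m i] by simp
      finally show ?thesis .
    qed
    then have "real (Suc i + k) * (real (m choose (Suc i + k)) * real (i + k choose i)) =
        real (m - i) * real (m choose i) * real (m - Suc i choose k)"
      unfolding of_nat_mult[symmetric] by (rule arg_cong)
    moreover have "real (m - i) * real (m choose i) > 0" using m by simp
    moreover have "real (Suc i + k) > 0" by simp
    moreover have "b * (1 / s) = c / a" if "s * c = a * b" "a > 0" "s > 0" for a b c s :: real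
      using that by (simp add: field_simps)
    ultimately show "real (m - Suc i choose k) * (1 / real (Suc i + k)) =
        real (m choose (Suc i + k)) * real (i + k choose i) / (real (m - i) * real (m choose i))"
      by blast
  qed simp
  also have "(\<Sum>k\<le>m - Suc i. real (m choose (Suc i + k)) * real (i + k choose i)) = real (g_bound m i)"
    unfolding g_bound_def of_nat_sum of_nat_mult
    using m by (intro sum.reindex_bij_witness[where i = "\<lambda>j. j - Suc i" and j = "\<lambda>k. Suc i + k"]) auto
  finally show ?thesis by (simp add: m_def)
qed

section \<open>Face densities and the averaged count\<close>

definition face_density :: "nat \<Rightarrow> nat set set \<Rightarrow> nat \<Rightarrow> real" where
  "face_density m K i = real (card {\<sigma> \<in> K. card \<sigma> = i}) / real (m choose i)"

context
  fixes m :: nat and K :: "nat set set"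
  assumes K: "simplicial_complex_on m K"
begin

lemma face_subset: "\<sigma> \<in> K \<Longrightarrow> \<sigma> \<subseteq> {1..m}"
  and subface: "\<sigma> \<in> K \<Longrightarrow> \<tau> \<subseteq> \<sigma> \<Longrightarrow> \<tau> \<in> K"
  and empty_face: "{} \<in> K"
  and vertex_face: "i \<in> {1..m} \<Longrightarrow> {i} \<in> K"
  using K by (auto simp: simplicial_complex_on_def)

lemma finite_complex: "finite K"
  using face_subset by (intro finite_subset[of K "Pow {1..m}"]) auto

lemma finite_face: "\<sigma> \<in> K \<Longrightarrow> finite \<sigma>"
  using face_subset finite_subset by blast

lemma card_face_le: "\<sigma> \<in> K \<Longrightarrow> card \<sigma> \<le> m"
  using face_subset card_mono[of "{1..m}" \<sigma>] by simp

text \<open>Of the (m - i) f_i pairs of an i-face and an outside vertex, those that extend to a face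
  correspond to a face of size i + 1 with a marked vertex, so there are (i + 1) f_(i+1) of them. The
  absorption identity gives both numbers the common factor (m - i) C(m, i).\<close>

lemma card_nonextendable:
  assumes "i < m"
  shows "real (card {(\<sigma>, v). \<sigma> \<in> K \<and> card \<sigma> = i \<and> v \<in> {1..m} - \<sigma> \<and> insert v \<sigma> \<notin> K}) =
    real (m - i) * real (m choose i) * (face_density m K i - face_density m K (Suc i))"
proof -
  let ?f = "\<lambda>i. card {\<sigma> \<in> K. card \<sigma> = i}"
  let ?N = "{(\<sigma>, v). \<sigma> \<in> K \<and> card \<sigma> = i \<and> v \<in> {1..m} - \<sigma> \<and> insert v \<sigma> \<notin> K}"
  let ?E = "{(\<sigma>, v). \<sigma> \<in> K \<and> card \<sigma> = i \<and> v \<in> {1..m} - \<sigma> \<and> insert v \<sigma> \<in> K}"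
  have fin: "finite {\<sigma> \<in> K. card \<sigma> = j}" for j using finite_complex by simp
  have mem: "v \<in> {1..m}" if "\<tau> \<in> K" "v \<in> \<tau>" for \<tau> v using face_subset that by blast
  have all: "?N \<union> ?E = Sigma {\<sigma> \<in> K. card \<sigma> = i} (\<lambda>\<sigma>. {1..m} - \<sigma>)" by auto
  have finU: "finite (?N \<union> ?E)" unfolding all using fin by auto
  have "card ?N + card ?E = card (?N \<union> ?E)"
    using finU by (intro card_Un_disjoint[symmetric]) auto
  also have "\<dots> = (\<Sum>\<sigma>\<in>{\<sigma> \<in> K. card \<sigma> = i}. card ({1..m} - \<sigma>))"
    unfolding all using fin by (intro card_SigmaI) auto
  also have "\<dots> = (\<Sum>\<sigma>\<in>{\<sigma> \<in> K. card \<sigma> = i}. m - i)"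
    using face_subset finite_face by (intro sum.cong) (auto simp: card_Diff_subset)
  finally have 1: "card ?N + card ?E = (m - i) * ?f i" by simp
  have "card ?E = card (Sigma {\<tau> \<in> K. card \<tau> = Suc i} (\<lambda>\<tau>. \<tau>))"
  proof (rule bij_betw_same_card[of "\<lambda>(\<sigma>, v). (insert v \<sigma>, v)"])
    show "bij_betw (\<lambda>(\<sigma>, v). (insert v \<sigma>, v)) ?E (Sigma {\<tau> \<in> K. card \<tau> = Suc i} (\<lambda>\<tau>. \<tau>))"
    proof (rule bij_betw_byWitness[where f' = "\<lambda>(\<tau>, v). (\<tau> - {v}, v)"])
      show "(\<lambda>(\<tau>, v). (\<tau> - {v}, v)) ` Sigma {\<tau> \<in> K. card \<tau> = Suc i} (\<lambda>\<tau>. \<tau>) \<subseteq> ?E"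
      proof (rule image_subsetI)
        fix y assume "y \<in> Sigma {\<tau> \<in> K. card \<tau> = Suc i} (\<lambda>\<tau>. \<tau>)"
        then obtain \<tau> v where y: "y = (\<tau>, v)" "\<tau> \<in> K" "card \<tau> = Suc i" "v \<in> \<tau>" by blast
        then have "\<tau> - {v} \<in> K" "v \<in> {1..m}" "insert v (\<tau> - {v}) = \<tau>"
          using subface[of \<tau> "\<tau> - {v}"] mem by auto
        then show "(case y of (\<tau>, v) \<Rightarrow> (\<tau> - {v}, v)) \<in> ?E"
          using y by simp
      qed
    qed (use finite_face in auto)
  qed
  also have "\<dots> = (\<Sum>\<tau>\<in>{\<tau> \<in> K. card \<tau> = Suc i}. Suc i)"
    using fin finite_face by (subst card_SigmaI) auto
  finally have 2: "card ?E = Suc i * ?f (Suc i)" by simp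
  have abs: "Suc i * (m choose Suc i) = (m - i) * (m choose i)"
    using binomial_absorption[of i m] binomial_absorb_comp[of m i] by simp
  have "real (m - i) * real (m choose i) * face_density m K (Suc i) =
      real (Suc i * (m choose Suc i)) * face_density m K (Suc i)"
    unfolding abs by simp
  also have "\<dots> = real (Suc i) * real (?f (Suc i))"
    using assms by (simp add: face_density_def del: of_nat_Suc mult_Suc)
  finally have 3: "real (m - i) * real (m choose i) * face_density m K (Suc i) = real (card ?E)"
    unfolding 2 by (simp only: of_nat_mult)
  have 4: "real (m - i) * real (m choose i) * face_density m K i = real (card ?N) + real (card ?E)"
    using assms 1 by (simp add: face_density_def flip: of_nat_add)
  show ?thesis unfolding right_diff_distrib 3 4 by simp
qed

text \<open>The local LYM inequality; here it is read off from the fact that the drop is a count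
  divided by a positive number.\<close>

lemma face_density_antimono:
  assumes "i < m"
  shows "face_density m K (Suc i) \<le> face_density m K i"
proof -
  have "0 \<le> real (m - i) * real (m choose i) * (face_density m K i - face_density m K (Suc i))"
    unfolding card_nonextendable[OF assms, symmetric] by simp
  moreover have "real (m - i) * real (m choose i) > 0" using assms by simp
  ultimately show ?thesis
    using zero_le_mult_iff[of "real (m - i) * real (m choose i)"
        "face_density m K i - face_density m K (Suc i)"] by linarith
qed

text \<open>Exchange of summation: a pair (\<sigma>, v) with \<open>insert v \<sigma>\<close> not in
  K is critical for exactly those U that contain \<open>insert v \<sigma>\<close>. The factor (m -
  i) C(m, i) of \<open>card_nonextendable\<close> cancels the denominator of
  \<open>sum_supersets_inverse_card\<close>.\<close>

lemma sum_average_critical_faces: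
  "(\<Sum>U\<in>Pow {1..m} - {{}}. (\<Sum>v\<in>U. real (card (critical_faces K U v))) / real (card U)) =
    (\<Sum>i<m. (face_density m K i - face_density m K (Suc i)) * real (g_bound m i))"
proof -
  let ?P = "Pow {1..m} - {{}}"
  let ?N = "{(\<sigma>, v). \<sigma> \<in> K \<and> v \<in> {1..m} - \<sigma> \<and> insert v \<sigma> \<notin> K}"
  have finN: "finite ?N"
    using finite_complex by (intro finite_subset[of ?N "K \<times> {1..m}"]) auto
  have "(\<Sum>U\<in>?P. (\<Sum>v\<in>U. real (card (critical_faces K U v))) / real (card U)) =
      (\<Sum>U\<in>?P. \<Sum>(\<sigma>, v)\<in>{x \<in> ?N. insert (snd x) (fst x) \<subseteq> U}. 1 / real (card U))"
  proof (rule sum.cong)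
    fix U assume U: "U \<in> ?P"
    then have fU: "finite U" using finite_subset by auto
    have eq: "{x \<in> ?N. insert (snd x) (fst x) \<subseteq> U} =
        (\<lambda>(v, \<sigma>). (\<sigma>, v)) ` Sigma U (critical_faces K U)"
      using U by (force simp: critical_faces_def image_iff)
    have "card {x \<in> ?N. insert (snd x) (fst x) \<subseteq> U} = card (Sigma U (critical_faces K U))"
      unfolding eq by (rule card_image) (auto simp: inj_on_def)
    also have "\<dots> = (\<Sum>v\<in>U. card (critical_faces K U v))"
      using fU by (intro card_SigmaI) auto
    finally show "(\<Sum>v\<in>U. real (card (critical_faces K U v))) / real (card U) =
        (\<Sum>(\<sigma>, v)\<in>{x \<in> ?N. insert (snd x) (fst x) \<subseteq> U}. 1 / real (card U))"
      by (simp add: case_prod_unfold)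
  qed simp
  also have "\<dots> = (\<Sum>x\<in>?N. \<Sum>U\<in>{U \<in> ?P. insert (snd x) (fst x) \<subseteq> U}. 1 / real (card U))"
    unfolding case_prod_unfold using finN[unfolded case_prod_unfold]
    by (intro sum.swap_restrict) auto
  also have "\<dots> = (\<Sum>x\<in>?N. real (g_bound m (card (fst x))) /
      (real (m - card (fst x)) * real (m choose card (fst x))))"
  proof (rule sum.cong)
    fix x assume x: "x \<in> ?N"
    have "{U \<in> ?P. insert (snd x) (fst x) \<subseteq> U} = {U. insert (snd x) (fst x) \<subseteq> U \<and> U \<subseteq> {1..m}}"
      by auto
    moreover have "fst x \<subseteq> {1..m}"
      using x by (intro face_subset) auto
    then have "insert (snd x) (fst x) \<subseteq> {1..m}" using x by auto
    moreover have "card (insert (snd x) (fst x)) = Suc (card (fst x))"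
      using x finite_face[of "fst x"] by auto
    ultimately show "(\<Sum>U\<in>{U \<in> ?P. insert (snd x) (fst x) \<subseteq> U}. 1 / real (card U)) =
        real (g_bound m (card (fst x))) / (real (m - card (fst x)) * real (m choose card (fst x)))"
      using sum_supersets_inverse_card[of "{1..m}" "insert (snd x) (fst x)"] by simp
  qed simp
  also have "\<dots> = (\<Sum>i<m. \<Sum>x\<in>{x \<in> ?N. card (fst x) = i}. real (g_bound m (card (fst x))) /
      (real (m - card (fst x)) * real (m choose card (fst x))))"
  proof (rule sum.group[symmetric])
    show "(\<lambda>x. card (fst x)) ` ?N \<subseteq> {..<m}"
    proof (rule image_subsetI)
      fix x assume x: "x \<in> ?N"
      then have "fst x \<in> K" "snd x \<in> {1..m}" "snd x \<notin> fst x" by auto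
      then have "fst x \<subset> {1..m}" using face_subset[of "fst x"] by blast
      then show "card (fst x) \<in> {..<m}"
        using psubset_card_mono[of "{1..m}" "fst x"] by simp
    qed
  qed (use finN in auto)
  also have "\<dots> = (\<Sum>i<m. (face_density m K i - face_density m K (Suc i)) * real (g_bound m i))"
  proof (rule sum.cong)
    fix i assume i: "i \<in> {..<m}"
    have eq: "{x \<in> ?N. card (fst x) = i} =
        {(\<sigma>, v). \<sigma> \<in> K \<and> card \<sigma> = i \<and> v \<in> {1..m} - \<sigma> \<and> insert v \<sigma> \<notin> K}" by auto
    have "(\<Sum>x\<in>{x \<in> ?N. card (fst x) = i}. real (g_bound m (card (fst x))) /
        (real (m - card (fst x)) * real (m choose card (fst x)))) =
        real (card {x \<in> ?N. card (fst x) = i}) * (real (g_bound m i) / (real (m - i) * real (m choose i)))"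
      by simp
    also have "\<dots> = (face_density m K i - face_density m K (Suc i)) * real (g_bound m i)"
      unfolding eq using i card_nonextendable[of i] by simp
    finally show "(\<Sum>x\<in>{x \<in> ?N. card (fst x) = i}. real (g_bound m (card (fst x))) /
        (real (m - card (fst x)) * real (m choose card (fst x)))) =
        (face_density m K i - face_density m K (Suc i)) * real (g_bound m i)" .
  qed simp
  finally show ?thesis .
qed

lemma face_density_eq_1:
  assumes "face_density m K i = 1" "\<sigma> \<subseteq> {1..m}" "card \<sigma> = i"
  shows "\<sigma> \<in> K"
proof -
  let ?A = "{\<sigma>. \<sigma> \<subseteq> {1..m} \<and> card \<sigma> = i}"
  have "{\<sigma> \<in> K. card \<sigma> = i} \<subseteq> ?A" using face_subset by auto
  moreover have "card {\<sigma> \<in> K. card \<sigma> = i} = card ?A"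
    using assms n_subsets[of "{1..m}" i] by (simp add: face_density_def)
  ultimately have "{\<sigma> \<in> K. card \<sigma> = i} = ?A" by (intro card_subset_eq) auto
  then show ?thesis using assms by blast
qed

lemma face_density_eq_0:
  assumes "face_density m K i = 0" "\<sigma> \<in> K" "card \<sigma> = i"
  shows False
proof -
  have "i \<le> m" using assms card_face_le by auto
  then have "card {\<sigma> \<in> K. card \<sigma> = i} = 0" using assms by (simp add: face_density_def)
  then show False using assms finite_complex by auto
qed

lemma face_density_0 [simp]: "face_density m K 0 = 1"
proof -
  have "{\<sigma> \<in> K. card \<sigma> = 0} = {{}}" using finite_face empty_face by auto
  then show ?thesis by (simp add: face_density_def)
qed

lemma face_density_1 [simp]: "m \<ge> 1 \<Longrightarrow> face_density m K (Suc 0) = 1"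
proof -
  assume "m \<ge> 1"
  have "{\<sigma> \<in> K. card \<sigma> = Suc 0} = (\<lambda>i. {i}) ` {1..m}"
    using vertex_face face_subset by (auto simp: card_Suc_eq)
  then show ?thesis using \<open>m \<ge> 1\<close> by (simp add: face_density_def card_image)
qed

theorem sum_critical_faces_le:
  assumes "m \<ge> 1"
    and v: "\<And>U w. U \<subseteq> {1..m} \<Longrightarrow> w \<in> U \<Longrightarrow>
        card (critical_faces K U (v U)) \<le> card (critical_faces K U w)"
  shows "(\<Sum>U\<in>Pow {1..m} - {{}}. card (critical_faces K U (v U))) \<le> g_bound m ((m - 1) div 3)"
      (is "?S \<le> ?G")
    and "(\<Sum>U\<in>Pow {1..m} - {{}}. card (critical_faces K U (v U))) = g_bound m ((m - 1) div 3) \<Longrightarrow>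
      K = simplex_skeleton m (int ((m - 1) div 3) - 1)"
proof -
  define e where "e = (m - 1) div 3"
  define q where "q i = face_density m K i - face_density m K (Suc i)" for i
  have em: "e < m" using assms(1) by (simp add: e_def)
  have q0: "q 0 = 0" using assms(1) by (simp add: q_def)
  have qnn: "q i \<ge> 0" if "i < m" for i using face_density_antimono[OF that] by (simp add: q_def)
  have sumq: "(\<Sum>i<k. q i) = 1 - face_density m K k" for k
    unfolding q_def using sum_lessThan_telescope'[of "face_density m K" k] by simp
  have dnn: "face_density m K k \<ge> 0" for k by (simp add: face_density_def)
  have "real ?S \<le> (\<Sum>U\<in>Pow {1..m} - {{}}. (\<Sum>w\<in>U. real (card (critical_faces K U w))) / real (card U))"
    unfolding of_nat_sum
  proof (rule sum_mono)
    fix U assume U: "U \<in> Pow {1..m} - {{}}"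
    then have "card U > 0" using finite_subset[of U "{1..m}"] by (auto simp: card_gt_0_iff)
    have "real (card U) * real (card (critical_faces K U (v U))) \<le> (\<Sum>w\<in>U. real (card (critical_faces K U w)))"
      using U v[of U] by (intro sum_bounded_below) auto
    then show "real (card (critical_faces K U (v U))) \<le> (\<Sum>w\<in>U. real (card (critical_faces K U w))) / real (card U)"
      using \<open>card U > 0\<close> by (simp add: field_simps)
  qed
  also have "\<dots> = (\<Sum>i<m. q i * real (g_bound m i))"
    unfolding q_def by (rule sum_average_critical_faces)
  finally have S: "real ?S \<le> (\<Sum>i<m. q i * real (g_bound m i))" .
  \<comment> \<open>The drops q sum to 1 minus the top density. Both parts of this slack are
    nonnegative, so equality forces the top density to be 0 and leaves no drop except at the maximum
    of \<open>g_bound\<close>.\<close>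
  have G: "real ?G - (\<Sum>i<m. q i * real (g_bound m i)) =
      face_density m K m * real ?G + (\<Sum>i<m. q i * (real ?G - real (g_bound m i)))"
    using sumq[of m] by (simp add: right_diff_distrib sum_subtractf flip: sum_distrib_right)
       (simp add: algebra_simps)
  have gle: "q i * (real ?G - real (g_bound m i)) \<ge> 0" if "i < m" for i
    using qnn[OF that] g_bound_less_max[OF that] by (cases "i = e") (auto simp: e_def)
  have nn: "face_density m K m * real ?G \<ge> 0" "(\<Sum>i<m. q i * (real ?G - real (g_bound m i))) \<ge> 0"
    using dnn gle by (auto intro!: sum_nonneg)
  show "?S \<le> ?G" using S G nn by linarith
  assume eq: "?S = ?G"
  have Z: "face_density m K m * real ?G = 0" "(\<Sum>i<m. q i * (real ?G - real (g_bound m i))) = 0"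
    using S G nn unfolding eq by linarith+
  have "g_bound m e > 0" unfolding e_def[symmetric] g_bound_def using em
    by (intro sum_pos2[of _ m]) auto
  then have top: "face_density m K m = 0" using Z(1) by (simp add: e_def)
  have qz: "q i = 0" if "i < m" "i \<noteq> e" for i
  proof -
    have "\<forall>i\<in>{..<m}. q i * (real ?G - real (g_bound m i)) = 0"
      using Z(2) gle by (subst (asm) sum_nonneg_eq_0_iff) auto
    then have "q i * (real ?G - real (g_bound m i)) = 0" using that by auto
    then show ?thesis using g_bound_less_max[of i m] that by (auto simp: e_def)
  qed
  \<comment> \<open>Only the drop at e survives, so the density is constant on both sides of
    it.\<close>
  have low: "face_density m K k = 1" if "k \<le> e" for k
    using sumq[of k] qz that em by (simp add: sum.neutral)
  have high: "face_density m K k = 0" if "e < k" "k \<le> m" for k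
  proof -
    have "(\<Sum>i<m. q i) = (\<Sum>i<k. q i)"
      using that qz by (intro sum.mono_neutral_right) auto
    then show ?thesis using sumq[of k] sumq[of m] top by simp
  qed
  have "\<sigma> \<in> K \<longleftrightarrow> \<sigma> \<subseteq> {1..m} \<and> card \<sigma> \<le> e" for \<sigma>
    using face_density_eq_1[OF low, of "card \<sigma>" \<sigma>] face_density_eq_0[OF high, of "card \<sigma>" \<sigma>]
      face_subset[of \<sigma>] card_face_le[of \<sigma>] not_le by blast
  then show "K = simplex_skeleton m (int ((m - 1) div 3) - 1)"
    by (auto simp: simplex_skeleton_def e_def)
qed

end

section \<open>Complexes of free modules\<close>

lemma sum_fun_apply: "(\<Sum>i\<in>A. f i) x = (\<Sum>i\<in>A. f i x)"
  by (induction A rule: infinite_finite_induct) auto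

definition smul :: "'r::comm_ring_1 \<Rightarrow> ('i \<Rightarrow> 'r) \<Rightarrow> 'i \<Rightarrow> 'r" where
  "smul r x = (\<lambda>i. r * x i)"

text \<open>\<open>act\<close> is the scalar action on the target: \<open>smul\<close> between free
  modules, multiplication by the constant term for the residue field. Linearity is asked over the
  whole ring type rather than a subring, which maps given by matrices satisfy.\<close>

definition linear_over :: "('r::comm_ring_1 \<Rightarrow> 'a \<Rightarrow> 'a) \<Rightarrow> (('i \<Rightarrow> 'r) \<Rightarrow> 'a::ab_group_add) \<Rightarrow> bool" where
  "linear_over act f \<longleftrightarrow> (\<forall>x y. f (x + y) = f x + f y) \<and> (\<forall>r x. f (smul r x) = act r (f x))"

definition basis_vec :: "'i \<Rightarrow> 'i \<Rightarrow> 'r::comm_ring_1" where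
  "basis_vec j = (\<lambda>i. if i = j then 1 else 0)"

text \<open>The free module with basis S sits in a full function space as the vectors vanishing
  outside S, so that sums and differences are those of the type.\<close>

definition free_on :: "'r::comm_ring_1 set \<Rightarrow> 'i set \<Rightarrow> ('i \<Rightarrow> 'r) set" where
  "free_on P S = {x. (\<forall>i. x i \<in> P) \<and> (\<forall>i. i \<notin> S \<longrightarrow> x i = 0)}"

lemma image_subsetD: "f ` A \<subseteq> B \<Longrightarrow> x \<in> A \<Longrightarrow> f x \<in> B"
  by (simp add: image_subset_iff)

lemma linear_over_add: "linear_over act f \<Longrightarrow> f (x + y) = f x + f y"
  and linear_over_smul: "linear_over act f \<Longrightarrow> f (smul r x) = act r (f x)"
  by (auto simp: linear_over_def)

lemma linear_over_0: "linear_over act f \<Longrightarrow> f 0 = 0"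
  using linear_over_add[of act f 0 0] by simp

lemma linear_over_diff: "linear_over act f \<Longrightarrow> f (x - y) = f x - f y"
  using linear_over_add[of act f "x - y" y] by (simp add: eq_diff_eq)

lemma linear_over_sum: "linear_over act f \<Longrightarrow> f (\<Sum>i\<in>A. g i) = (\<Sum>i\<in>A. f (g i))"
  by (induction A rule: infinite_finite_induct) (auto simp: linear_over_0 linear_over_add)

lemma smul_simps: "smul r (x + y) = smul r x + smul r y" "smul r (x - y) = smul r x - smul r y"
  "smul r (smul s x) = smul (r * s) x" "smul (r + s) x = smul r x + smul s x" "smul 1 x = x"
  by (auto simp: smul_def fun_eq_iff algebra_simps)

lemma linear_over_id: "linear_over smul (\<lambda>x. x)"
  by (simp add: linear_over_def)

lemma linear_over_comp:
  "linear_over smul f \<Longrightarrow> linear_over act g \<Longrightarrow> linear_over act (\<lambda>x. g (f x))"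
  by (simp add: linear_over_def)

lemma linear_over_minus:
  "linear_over smul f \<Longrightarrow> linear_over smul g \<Longrightarrow> linear_over smul (\<lambda>x. f x - g x)"
  by (simp add: linear_over_def smul_simps)

lemma free_on_expand:
  assumes "finite S" "x \<in> free_on P S"
  shows "x = (\<Sum>j\<in>S. smul (x j) (basis_vec j))"
proof
  fix i
  have "(\<Sum>j\<in>S. x j * (if i = j then 1 else 0)) = (if i \<in> S then x i else 0)"
    using assms(1) by (simp add: if_distrib[of "(*) _"] cong: if_cong)
  then show "x i = (\<Sum>j\<in>S. smul (x j) (basis_vec j)) i"
    using assms(2) by (simp add: sum_fun_apply smul_def basis_vec_def free_on_def)
qed

lemma linear_over_expand:
  assumes "linear_over act f" "finite S" "x \<in> free_on P S"
  shows "f x = (\<Sum>j\<in>S. act (x j) (f (basis_vec j)))"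
  by (subst free_on_expand[OF assms(2,3)])
    (simp add: linear_over_sum[OF assms(1)] linear_over_smul[OF assms(1)])

text \<open>The dimension of \<open>Z / B\<close> over the field embedded by \<open>\<kappa>\<close>, without forming the quotient.\<close>

definition rel_dim :: "('k::field \<Rightarrow> 'r::comm_ring_1) \<Rightarrow> ('i \<Rightarrow> 'r) set \<Rightarrow> ('i \<Rightarrow> 'r) set \<Rightarrow> enat" where
  "rel_dim \<kappa> Z B = (SUP n \<in> {n. \<exists>x. (\<forall>i<n. x i \<in> Z) \<and>
     (\<forall>c. (\<Sum>i<n. smul (\<kappa> (c i)) (x i)) \<in> B \<longrightarrow> (\<forall>i<n. c i = 0))}. enat n)"

text \<open>
  Here \<open>P\<close> is a ring over a field embedded by \<open>\<kappa>\<close>.  Tensoring a complex of free \<open>P\<close>-modules with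
  \<open>P / I\<close> is expressed on representatives in the free modules, modulo \<open>I\<close>.
\<close>

locale coefficient_ring =
  fixes P :: "'r::comm_ring_1 set" and \<kappa> :: "'k::field \<Rightarrow> 'r" and I :: "'r set"
  assumes P_0: "0 \<in> P" and P_1: "1 \<in> P"
    and P_add: "\<And>x y. x \<in> P \<Longrightarrow> y \<in> P \<Longrightarrow> x + y \<in> P"
    and P_uminus: "\<And>x. x \<in> P \<Longrightarrow> - x \<in> P"
    and P_mult: "\<And>x y. x \<in> P \<Longrightarrow> y \<in> P \<Longrightarrow> x * y \<in> P"
    and P_scalar: "\<And>c. \<kappa> c \<in> P"
    and I_0: "0 \<in> I"
    and I_add: "\<And>x y. x \<in> I \<Longrightarrow> y \<in> I \<Longrightarrow> x + y \<in> I"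
    and I_mult: "\<And>x y. x \<in> P \<Longrightarrow> y \<in> I \<Longrightarrow> x * y \<in> I"
    and I_subset: "I \<subseteq> P"
begin

lemma P_diff: "x \<in> P \<Longrightarrow> y \<in> P \<Longrightarrow> x - y \<in> P"
  using P_add[of x "- y"] P_uminus[of y] by simp

lemma I_uminus: "x \<in> I \<Longrightarrow> - x \<in> I"
  using I_mult[of "-1" x] P_uminus[OF P_1] by simp

lemma I_diff: "x \<in> I \<Longrightarrow> y \<in> I \<Longrightarrow> x - y \<in> I"
  using I_add[of x "- y"] I_uminus[of y] by simp

lemma P_sum: "(\<And>i. i \<in> A \<Longrightarrow> f i \<in> P) \<Longrightarrow> sum f A \<in> P"
  by (induction A rule: infinite_finite_induct) (auto simp: P_0 P_add)

lemma I_sum: "(\<And>i. i \<in> A \<Longrightarrow> f i \<in> I) \<Longrightarrow> sum f A \<in> I"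
  by (induction A rule: infinite_finite_induct) (auto simp: I_0 I_add)

lemma free_on_0: "0 \<in> free_on P S"
  and free_on_add: "x \<in> free_on P S \<Longrightarrow> y \<in> free_on P S \<Longrightarrow> x + y \<in> free_on P S"
  and free_on_diff: "x \<in> free_on P S \<Longrightarrow> y \<in> free_on P S \<Longrightarrow> x - y \<in> free_on P S"
  and free_on_smul: "r \<in> P \<Longrightarrow> x \<in> free_on P S \<Longrightarrow> smul r x \<in> free_on P S"
  by (auto simp: free_on_def P_0 P_add P_diff P_mult smul_def)

lemma free_on_sum: "(\<And>i. i \<in> A \<Longrightarrow> f i \<in> free_on P S) \<Longrightarrow> sum f A \<in> free_on P S"
  by (induction A rule: infinite_finite_induct) (auto simp: free_on_0 free_on_add)

lemma free_on_basis: "j \<in> S \<Longrightarrow> basis_vec j \<in> free_on P S"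
  by (auto simp: free_on_def basis_vec_def P_0 P_1)

text \<open>The entries of the matrix of f lie in P and I absorbs them; this is why maps of free
  P-modules act modulo I.\<close>

lemma linear_over_ideal:
  assumes "linear_over smul f" "finite S" "f ` free_on P S \<subseteq> free_on P Y"
    and "x \<in> free_on P S" "\<And>i. x i \<in> I"
  shows "f x i \<in> I"
proof -
  have "f x i = (\<Sum>j\<in>S. x j * f (basis_vec j) i)"
    using linear_over_expand[OF assms(1,2,4)] by (simp add: sum_fun_apply smul_def)
  also have "\<dots> \<in> I"
  proof (rule I_sum)
    fix j assume "j \<in> S"
    then have "f (basis_vec j) \<in> free_on P Y" using assms(3) free_on_basis[of j S] by (simp add: image_subset_iff)
    then have "f (basis_vec j) i * x j \<in> I" using assms(5) by (intro I_mult) (auto simp: free_on_def)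
    then show "x j * f (basis_vec j) i \<in> I" by (simp add: mult.commute)
  qed
  finally show ?thesis .
qed

text \<open>Free modules are projective: choose preimages of the images of the basis vectors and
  extend linearly.\<close>

lemma lift_linear:
  assumes fin: "finite S" and D: "linear_over act D" and F: "linear_over act F"
    and ex: "\<And>j. j \<in> S \<Longrightarrow> F (basis_vec j) \<in> D ` free_on P Y"
  obtains \<phi> where "linear_over smul \<phi>" "\<phi> ` free_on P S \<subseteq> free_on P Y"
    "\<And>x. x \<in> free_on P S \<Longrightarrow> D (\<phi> x) = F x"
proof -
  have "\<exists>w. \<forall>j\<in>S. w j \<in> free_on P Y \<and> D (w j) = F (basis_vec j)"
    using ex by (intro bchoice) (metis imageE)
  then obtain w where w: "\<And>j. j \<in> S \<Longrightarrow> w j \<in> free_on P Y" "\<And>j. j \<in> S \<Longrightarrow> D (w j) = F (basis_vec j)"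
    by blast
  define \<phi> where "\<phi> x = (\<Sum>j\<in>S. smul (x j) (w j))" for x
  show thesis
  proof
    show "linear_over smul \<phi>"
      unfolding linear_over_def \<phi>_def fun_eq_iff sum_fun_apply
      by (auto simp: sum_fun_apply smul_def algebra_simps sum.distrib sum_distrib_left)
    show "\<phi> ` free_on P S \<subseteq> free_on P Y"
      unfolding \<phi>_def using w(1) by (auto simp: free_on_def[of P S] intro!: free_on_sum free_on_smul)
    show "D (\<phi> x) = F x" if "x \<in> free_on P S" for x
      unfolding linear_over_expand[OF F fin that] \<phi>_def linear_over_sum[OF D] linear_over_smul[OF D]
      using w(2) by simp
  qed
qed

section \<open>Comparison of free resolutions\<close>

text \<open>Index sets replace ranks, so that the Koszul complex, indexed by subsets, and the
  resolutions of \<open>free_resolution\<close>, indexed by initial segments, are instances of one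
  notion and can be compared directly. The resolved module is a whole type.\<close>

definition resolution ::
  "('r \<Rightarrow> 'n \<Rightarrow> 'n::ab_group_add) \<Rightarrow> (nat \<Rightarrow> 'i set) \<Rightarrow> (nat \<Rightarrow> ('i \<Rightarrow> 'r) \<Rightarrow> 'i \<Rightarrow> 'r) \<Rightarrow> (('i \<Rightarrow> 'r) \<Rightarrow> 'n) \<Rightarrow> bool"
  where
  "resolution act S d \<epsilon> \<longleftrightarrow>
     (\<forall>n. finite (S n)) \<and> (\<forall>n. linear_over smul (d n)) \<and> linear_over act \<epsilon> \<and>
     (\<forall>n. d n ` free_on P (S (Suc n)) \<subseteq> free_on P (S n)) \<and>
     \<epsilon> ` free_on P (S 0) = UNIV \<and>
     (\<forall>x\<in>free_on P (S 0). \<epsilon> x = 0 \<longleftrightarrow> x \<in> d 0 ` free_on P (S 1)) \<and>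
     (\<forall>n. \<forall>x\<in>free_on P (S (Suc n)). d n x = 0 \<longleftrightarrow> x \<in> d (Suc n) ` free_on P (S (Suc (Suc n))))"

lemma resolutionD:
  assumes "resolution act S d \<epsilon>"
  shows "finite (S n)" "linear_over smul (d n)" "linear_over act \<epsilon>"
    "x \<in> free_on P (S (Suc n)) \<Longrightarrow> d n x \<in> free_on P (S n)"
    "\<epsilon> ` free_on P (S 0) = UNIV"
    "x \<in> free_on P (S 0) \<Longrightarrow> \<epsilon> x = 0 \<longleftrightarrow> x \<in> d 0 ` free_on P (S 1)"
    "x \<in> free_on P (S (Suc n)) \<Longrightarrow> d n x = 0 \<longleftrightarrow> x \<in> d (Suc n) ` free_on P (S (Suc (Suc n)))"
  using assms by (simp_all add: resolution_def image_subset_iff)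

lemma resolution_dd:
  assumes "resolution act S d \<epsilon>" "x \<in> free_on P (S (Suc (Suc n)))"
  shows "d n (d (Suc n) x) = 0"
  using resolutionD(7)[OF assms(1) resolutionD(4)[OF assms]] assms(2) by blast

lemma resolution_\<epsilon>d:
  assumes "resolution act S d \<epsilon>" "x \<in> free_on P (S (Suc 0))"
  shows "\<epsilon> (d 0 x) = 0"
  using resolutionD(6)[OF assms(1) resolutionD(4)[OF assms]] assms(2) by simp

text \<open>With \<epsilon> = 0 this describes a chain map covering the zero map, the form in which
  \<open>null_homotopy_exists\<close> needs it.\<close>

definition chain_map where
  "chain_map S d \<epsilon> S' d' \<epsilon>' \<phi> \<longleftrightarrow>
     (\<forall>n. linear_over smul (\<phi> n)) \<and> (\<forall>n. \<phi> n ` free_on P (S n) \<subseteq> free_on P (S' n)) \<and>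
     (\<forall>x\<in>free_on P (S 0). \<epsilon>' (\<phi> 0 x) = \<epsilon> x) \<and>
     (\<forall>n. \<forall>x\<in>free_on P (S (Suc n)). d' n (\<phi> (Suc n) x) = \<phi> n (d n x))"

text \<open>The comparison theorem: the components are lifted degree by degree with
  \<open>lift_linear\<close>, by dependent choice.\<close>

lemma chain_map_exists:
  assumes res: "resolution act S d \<epsilon>" and res': "resolution act S' d' \<epsilon>'"
  obtains \<phi> where "chain_map S d \<epsilon> S' d' \<epsilon>' \<phi>"
proof -
  \<comment> \<open>The last conjunct keeps the induction going: the next component is a lift of
    \<psi> composed with d, so this composite must land in the image of the next
    differential.\<close>
  define A where "A n \<psi> \<longleftrightarrow> linear_over smul \<psi> \<and> \<psi> ` free_on P (S n) \<subseteq> free_on P (S' n) \<and>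
      (n = 0 \<longrightarrow> (\<forall>x\<in>free_on P (S 0). \<epsilon>' (\<psi> x) = \<epsilon> x)) \<and>
      (\<forall>x\<in>free_on P (S (Suc n)). \<psi> (d n x) \<in> d' n ` free_on P (S' (Suc n)))" for n \<psi>
  have "\<exists>\<phi>. \<forall>n. A n (\<phi> n) \<and> (\<forall>x\<in>free_on P (S (Suc n)). d' n (\<phi> (Suc n) x) = \<phi> n (d n x))"
  proof (rule dependent_nat_choice)
    obtain \<psi> where \<psi>: "linear_over smul \<psi>" "\<psi> ` free_on P (S 0) \<subseteq> free_on P (S' 0)"
      "\<And>x. x \<in> free_on P (S 0) \<Longrightarrow> \<epsilon>' (\<psi> x) = \<epsilon> x"
      using lift_linear[OF resolutionD(1)[OF res, of 0] resolutionD(3)[OF res'] resolutionD(3)[OF res]]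
        resolutionD(5)[OF res'] by (metis UNIV_I)
    have "\<psi> (d 0 x) \<in> d' 0 ` free_on P (S' (Suc 0))" if "x \<in> free_on P (S (Suc 0))" for x
    proof -
      have "d 0 x \<in> free_on P (S 0)" using resolutionD(4)[OF res that] .
      then have "\<psi> (d 0 x) \<in> free_on P (S' 0)" "\<epsilon>' (\<psi> (d 0 x)) = 0"
        using image_subsetD[OF \<psi>(2)] \<psi>(3) resolution_\<epsilon>d[OF res that] by simp_all
      then show ?thesis using resolutionD(6)[OF res'] by (metis One_nat_def)
    qed
    then have "A 0 \<psi>" using \<psi> unfolding A_def by simp
    then show "\<exists>\<psi>. A 0 \<psi>" by blast
  next
    fix \<psi> n assume A: "A n \<psi>"
    obtain \<psi>' where \<psi>': "linear_over smul \<psi>'" "\<psi>' ` free_on P (S (Suc n)) \<subseteq> free_on P (S' (Suc n))"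
      "\<And>x. x \<in> free_on P (S (Suc n)) \<Longrightarrow> d' n (\<psi>' x) = \<psi> (d n x)"
    proof (rule lift_linear)
      show "finite (S (Suc n))" using resolutionD(1)[OF res] .
      show "linear_over smul (d' n)" using resolutionD(2)[OF res'] .
      show "linear_over smul (\<lambda>x. \<psi> (d n x))"
        using A unfolding A_def by (intro linear_over_comp[OF resolutionD(2)[OF res]]) simp
      show "\<psi> (d n (basis_vec j)) \<in> d' n ` free_on P (S' (Suc n))" if "j \<in> S (Suc n)" for j
        using A free_on_basis[OF that] unfolding A_def by simp
    qed (rule that)
    have "\<psi>' (d (Suc n) x) \<in> d' (Suc n) ` free_on P (S' (Suc (Suc n)))"
      if "x \<in> free_on P (S (Suc (Suc n)))" for x
    proof -
      have dx: "d (Suc n) x \<in> free_on P (S (Suc n))" using resolutionD(4)[OF res that] .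
      have "d' n (\<psi>' (d (Suc n) x)) = \<psi> 0" using \<psi>'(3)[OF dx] resolution_dd[OF res that] by simp
      also have "\<dots> = 0" using A unfolding A_def by (intro linear_over_0[of smul]) simp
      finally have "d' n (\<psi>' (d (Suc n) x)) = 0" .
      moreover have "\<psi>' (d (Suc n) x) \<in> free_on P (S' (Suc n))" using image_subsetD[OF \<psi>'(2) dx] .
      ultimately show ?thesis using resolutionD(7)[OF res'] by simp
    qed
    then have "A (Suc n) \<psi>'" using \<psi>'(1,2) unfolding A_def by simp
    then show "\<exists>\<psi>'. A (Suc n) \<psi>' \<and> (\<forall>x\<in>free_on P (S (Suc n)). d' n (\<psi>' x) = \<psi> (d n x))"
      using \<psi>'(3) by (intro exI[of _ \<psi>'] conjI ballI)
  qed
  then obtain \<phi> where \<phi>: "\<And>n. A n (\<phi> n)"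
    "\<And>n x. x \<in> free_on P (S (Suc n)) \<Longrightarrow> d' n (\<phi> (Suc n) x) = \<phi> n (d n x)"
    by blast
  have "linear_over smul (\<phi> n)" "\<phi> n ` free_on P (S n) \<subseteq> free_on P (S' n)" for n
    using \<phi>(1)[of n] unfolding A_def by simp_all
  moreover have "\<epsilon>' (\<phi> 0 x) = \<epsilon> x" if "x \<in> free_on P (S 0)" for x
    using \<phi>(1)[of 0] that unfolding A_def by simp
  ultimately have "chain_map S d \<epsilon> S' d' \<epsilon>' \<phi>"
    using \<phi>(2) unfolding chain_map_def by (intro conjI allI ballI)
  then show thesis by (rule that)
qed

text \<open>A chain map covering zero is null-homotopic. The component h (n + 1) lifts \<theta> (n +
  1) minus h n composed with d, which takes values in cycles and hence, by exactness, in
  boundaries.\<close>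

lemma null_homotopy_exists:
  assumes res: "resolution act S d \<epsilon>"
    and \<theta>: "chain_map S d (\<lambda>_. 0) S d \<epsilon> \<theta>"
  obtains h where "\<And>n. linear_over smul (h n)" "\<And>n. h n ` free_on P (S n) \<subseteq> free_on P (S (Suc n))"
    "\<And>x. x \<in> free_on P (S 0) \<Longrightarrow> \<theta> 0 x = d 0 (h 0 x)"
    "\<And>n x. x \<in> free_on P (S (Suc n)) \<Longrightarrow> \<theta> (Suc n) x = d (Suc n) (h (Suc n) x) + h n (d n x)"
proof -
  have \<theta>_lin: "linear_over smul (\<theta> n)" and \<theta>_in: "x \<in> free_on P (S n) \<Longrightarrow> \<theta> n x \<in> free_on P (S n)"
    and \<theta>_\<epsilon>: "x \<in> free_on P (S 0) \<Longrightarrow> \<epsilon> (\<theta> 0 x) = 0"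
    and \<theta>_d: "x \<in> free_on P (S (Suc n)) \<Longrightarrow> d n (\<theta> (Suc n) x) = \<theta> n (d n x)" for n x
    using \<theta> by (simp_all add: chain_map_def image_subset_iff)
  \<comment> \<open>The last conjunct says that the map to be lifted next takes values in
    cycles.\<close>
  define A where "A n \<psi> \<longleftrightarrow> linear_over smul \<psi> \<and> \<psi> ` free_on P (S n) \<subseteq> free_on P (S (Suc n)) \<and>
      (n = 0 \<longrightarrow> (\<forall>x\<in>free_on P (S 0). \<theta> 0 x = d 0 (\<psi> x))) \<and>
      (\<forall>x\<in>free_on P (S (Suc n)). d n (\<psi> (d n x)) = \<theta> n (d n x))" for n \<psi>
  have lift: "\<exists>\<psi>'. linear_over smul \<psi>' \<and> \<psi>' ` free_on P (S (Suc n)) \<subseteq> free_on P (S (Suc (Suc n))) \<and>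
      (\<forall>x\<in>free_on P (S (Suc n)). d (Suc n) (\<psi>' x) = \<theta> (Suc n) x - \<psi> (d n x))"
    if A: "A n \<psi>" for n \<psi>
  proof -
    obtain \<psi>' where "linear_over smul \<psi>'" "\<psi>' ` free_on P (S (Suc n)) \<subseteq> free_on P (S (Suc (Suc n)))"
      "\<And>x. x \<in> free_on P (S (Suc n)) \<Longrightarrow> d (Suc n) (\<psi>' x) = \<theta> (Suc n) x - \<psi> (d n x)"
    proof (rule lift_linear)
      show "finite (S (Suc n))" using resolutionD(1)[OF res] .
      show "linear_over smul (d (Suc n))" using resolutionD(2)[OF res] .
      show "linear_over smul (\<lambda>x. \<theta> (Suc n) x - \<psi> (d n x))"
        using A unfolding A_def
        by (intro linear_over_minus \<theta>_lin linear_over_comp[OF resolutionD(2)[OF res]]) simp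
      show "\<theta> (Suc n) (basis_vec j) - \<psi> (d n (basis_vec j)) \<in> d (Suc n) ` free_on P (S (Suc (Suc n)))"
        if "j \<in> S (Suc n)" for j
      proof -
        have b: "basis_vec j \<in> free_on P (S (Suc n))" using free_on_basis[OF that] .
        have in': "\<psi> (d n (basis_vec j)) \<in> free_on P (S (Suc n))"
          using A resolutionD(4)[OF res b] unfolding A_def by (simp add: image_subset_iff)
        have "d n (\<theta> (Suc n) (basis_vec j) - \<psi> (d n (basis_vec j))) = 0"
          using A b \<theta>_d unfolding A_def linear_over_diff[OF resolutionD(2)[OF res]] by simp
        then show ?thesis by (rule iffD1[OF resolutionD(7)[OF res free_on_diff[OF \<theta>_in[OF b] in']]])
      qed
    qed (rule that)
    then show ?thesis by blast
  qed
  have "\<exists>h. \<forall>n. A n (h n) \<and> (\<forall>x\<in>free_on P (S (Suc n)). d (Suc n) (h (Suc n) x) = \<theta> (Suc n) x - h n (d n x))"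
  proof (rule dependent_nat_choice)
    obtain \<psi> where \<psi>: "linear_over smul \<psi>" "\<psi> ` free_on P (S 0) \<subseteq> free_on P (S (Suc 0))"
      "\<And>x. x \<in> free_on P (S 0) \<Longrightarrow> d 0 (\<psi> x) = \<theta> 0 x"
    proof (rule lift_linear)
      show "finite (S 0)" using resolutionD(1)[OF res] .
      show "linear_over smul (d 0)" using resolutionD(2)[OF res] .
      show "linear_over smul (\<theta> 0)" by (rule \<theta>_lin)
      show "\<theta> 0 (basis_vec j) \<in> d 0 ` free_on P (S (Suc 0))" if "j \<in> S 0" for j
        using resolutionD(6)[OF res \<theta>_in[OF free_on_basis[OF that]]] \<theta>_\<epsilon>[OF free_on_basis[OF that]] by simp
    qed (rule that)
    then have "A 0 \<psi>" unfolding A_def using resolutionD(4)[OF res] by simp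
    then show "\<exists>\<psi>. A 0 \<psi>" by blast
  next
    fix \<psi> n assume A: "A n \<psi>"
    from lift[OF this] obtain \<psi>' where \<psi>': "linear_over smul \<psi>'"
      "\<psi>' ` free_on P (S (Suc n)) \<subseteq> free_on P (S (Suc (Suc n)))"
      "\<And>x. x \<in> free_on P (S (Suc n)) \<Longrightarrow> d (Suc n) (\<psi>' x) = \<theta> (Suc n) x - \<psi> (d n x)"
      by blast
    have "d (Suc n) (\<psi>' (d (Suc n) x)) = \<theta> (Suc n) (d (Suc n) x)"
      if "x \<in> free_on P (S (Suc (Suc n)))" for x
    proof -
      have "d (Suc n) (\<psi>' (d (Suc n) x)) = \<theta> (Suc n) (d (Suc n) x) - \<psi> 0"
        using \<psi>'(3)[OF resolutionD(4)[OF res that]] resolution_dd[OF res that] by simp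
      moreover have "\<psi> 0 = 0" using A unfolding A_def by (intro linear_over_0[of smul]) simp
      ultimately show ?thesis by simp
    qed
    then have "A (Suc n) \<psi>'" using \<psi>'(1,2) unfolding A_def by simp
    then show "\<exists>\<psi>'. A (Suc n) \<psi>' \<and> (\<forall>x\<in>free_on P (S (Suc n)). d (Suc n) (\<psi>' x) = \<theta> (Suc n) x - \<psi> (d n x))"
      using \<psi>'(3) by (intro exI[of _ \<psi>'] conjI ballI)
  qed
  then obtain h where h: "\<And>n. A n (h n)"
    "\<And>n x. x \<in> free_on P (S (Suc n)) \<Longrightarrow> d (Suc n) (h (Suc n) x) = \<theta> (Suc n) x - h n (d n x)"
    by blast
  show thesis
  proof (rule that[of h])
    show "\<theta> (Suc n) x = d (Suc n) (h (Suc n) x) + h n (d n x)" if "x \<in> free_on P (S (Suc n))" for n x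
      using h(2)[OF that] by simp
  qed (use h(1) in \<open>simp_all add: A_def\<close>)
qed

section \<open>Homology modulo an ideal and its independence of the resolution\<close>

text \<open>Representatives of the cycles after tensoring with P / I. In degree 0 the condition is
  vacuous.\<close>

definition cycles_mod where
  "cycles_mod S d n = {x \<in> free_on P (S n). \<forall>k. n = Suc k \<longrightarrow> (\<forall>i. d k x i \<in> I)}"

text \<open>This contains every vector with entries in I (take y = 0), as such vectors represent
  zero.\<close>

definition boundaries_mod where
  "boundaries_mod S d n = {x \<in> free_on P (S n). \<exists>y\<in>free_on P (S (Suc n)). \<forall>i. x i - d n y i \<in> I}"

text \<open>The last hypothesis is injectivity on the quotients, stated on representatives; it
  carries families independent modulo B to families independent modulo B'.\<close>

lemma rel_dim_le:
  fixes Z :: "('i \<Rightarrow> 'r) set"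
  assumes lin: "linear_over smul \<phi>" and maps: "\<phi> ` Z \<subseteq> Z'"
    and closed: "\<And>x y. x \<in> Z \<Longrightarrow> y \<in> Z \<Longrightarrow> x + y \<in> Z" "\<And>c x. x \<in> Z \<Longrightarrow> smul (\<kappa> c) x \<in> Z" "0 \<in> Z"
    and inj: "\<And>z. z \<in> Z \<Longrightarrow> \<phi> z \<in> B' \<Longrightarrow> z \<in> B"
  shows "rel_dim \<kappa> Z B \<le> rel_dim \<kappa> Z' B'"
  unfolding rel_dim_def
proof (rule SUP_subset_mono)
  show "{n::nat. \<exists>x. (\<forall>i<n. x i \<in> Z) \<and> (\<forall>c. (\<Sum>i<n. smul (\<kappa> (c i)) (x i)) \<in> B \<longrightarrow> (\<forall>i<n. c i = 0))}
    \<subseteq> {n::nat. \<exists>x. (\<forall>i<n. x i \<in> Z') \<and> (\<forall>c. (\<Sum>i<n. smul (\<kappa> (c i)) (x i)) \<in> B' \<longrightarrow> (\<forall>i<n. c i = 0))}"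
  proof safe
    fix n :: nat and x :: "nat \<Rightarrow> 'i \<Rightarrow> 'r" assume x: "\<forall>i<n. x i \<in> Z"
      "\<forall>c. (\<Sum>i<n. smul (\<kappa> (c i)) (x i)) \<in> B \<longrightarrow> (\<forall>i<n. c i = 0)"
    have sumZ: "(\<Sum>i\<in>A. f i) \<in> Z" if "\<And>i. i \<in> A \<Longrightarrow> f i \<in> Z" for A :: "nat set" and f :: "nat \<Rightarrow> 'i \<Rightarrow> 'r"
      using that by (induction A rule: infinite_finite_induct) (auto simp: closed)
    show "\<exists>y. (\<forall>i<n. y i \<in> Z') \<and> (\<forall>c. (\<Sum>i<n. smul (\<kappa> (c i)) (y i)) \<in> B' \<longrightarrow> (\<forall>i<n. c i = 0))"
    proof (intro exI[of _ "\<lambda>i. \<phi> (x i)"] conjI allI impI)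
      fix i assume "i < n" then show "\<phi> (x i) \<in> Z'" using x maps by auto
    next
      fix c i assume "(\<Sum>i<n. smul (\<kappa> (c i)) (\<phi> (x i))) \<in> B'" "i < n"
      moreover have "(\<Sum>i<n. smul (\<kappa> (c i)) (\<phi> (x i))) = \<phi> (\<Sum>i<n. smul (\<kappa> (c i)) (x i))"
        by (simp add: linear_over_sum[OF lin] linear_over_smul[OF lin])
      moreover have "(\<Sum>i<n. smul (\<kappa> (c i)) (x i)) \<in> Z" using x(1) by (auto intro!: sumZ closed(2))
      ultimately show "c i = 0" using inj x(2) by auto
    qed
  qed
qed simp

text \<open>The comparison map \<phi> has a left inverse \<psi> up to homotopy, so it is injective
  on homology modulo I. Equality follows by exchanging the two resolutions.\<close>

theorem rel_dim_resolution_le: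
  assumes res: "resolution act S d \<epsilon>" and res': "resolution act S' d' \<epsilon>'"
  shows "rel_dim \<kappa> (cycles_mod S d n) (boundaries_mod S d n) \<le>
    rel_dim \<kappa> (cycles_mod S' d' n) (boundaries_mod S' d' n)"
proof -
  obtain \<phi> where "chain_map S d \<epsilon> S' d' \<epsilon>' \<phi>" by (rule chain_map_exists[OF res res'])
  then have \<phi>_lin: "linear_over smul (\<phi> n)"
    and \<phi>_in: "\<phi> n ` free_on P (S n) \<subseteq> free_on P (S' n)"
    and \<phi>_\<epsilon>: "x \<in> free_on P (S 0) \<Longrightarrow> \<epsilon>' (\<phi> 0 x) = \<epsilon> x"
    and \<phi>_d: "x \<in> free_on P (S (Suc n)) \<Longrightarrow> d' n (\<phi> (Suc n) x) = \<phi> n (d n x)" for n x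
    by (simp_all add: chain_map_def)
  obtain \<psi> where "chain_map S' d' \<epsilon>' S d \<epsilon> \<psi>" by (rule chain_map_exists[OF res' res])
  then have \<psi>_lin: "linear_over smul (\<psi> n)"
    and \<psi>_in: "\<psi> n ` free_on P (S' n) \<subseteq> free_on P (S n)"
    and \<psi>_\<epsilon>: "x \<in> free_on P (S' 0) \<Longrightarrow> \<epsilon> (\<psi> 0 x) = \<epsilon>' x"
    and \<psi>_d: "x \<in> free_on P (S' (Suc n)) \<Longrightarrow> d n (\<psi> (Suc n) x) = \<psi> n (d' n x)" for n x
    by (simp_all add: chain_map_def)
  have comp_in: "\<psi> n (\<phi> n x) \<in> free_on P (S n)" if "x \<in> free_on P (S n)" for n x
    using image_subsetD[OF \<psi>_in image_subsetD[OF \<phi>_in that]] .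
  \<comment> \<open>Both \<psi> \<phi> and the identity cover the identity of the resolved module,
    so their difference covers zero.\<close>
  have "chain_map S d (\<lambda>_. 0) S d \<epsilon> (\<lambda>n x. \<psi> n (\<phi> n x) - x)"
    unfolding chain_map_def
  proof (intro conjI allI ballI)
    show "linear_over smul (\<lambda>x. \<psi> n (\<phi> n x) - x)" for n
      by (intro linear_over_minus linear_over_comp[OF \<phi>_lin \<psi>_lin] linear_over_id)
    show "(\<lambda>x. \<psi> n (\<phi> n x) - x) ` free_on P (S n) \<subseteq> free_on P (S n)" for n
      using comp_in by (auto intro: free_on_diff)
    show "\<epsilon> (\<psi> 0 (\<phi> 0 x) - x) = 0" if "x \<in> free_on P (S 0)" for x
    proof -
      have "\<phi> 0 x \<in> free_on P (S' 0)" using image_subsetD[OF \<phi>_in that] .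
      then show ?thesis
        by (simp add: linear_over_diff[OF resolutionD(3)[OF res]] \<psi>_\<epsilon> \<phi>_\<epsilon> that)
    qed
    show "d n (\<psi> (Suc n) (\<phi> (Suc n) x) - x) = \<psi> n (\<phi> n (d n x)) - d n x"
      if "x \<in> free_on P (S (Suc n))" for n x
    proof -
      have "\<phi> (Suc n) x \<in> free_on P (S' (Suc n))" using image_subsetD[OF \<phi>_in that] .
      then show ?thesis
        by (simp add: linear_over_diff[OF resolutionD(2)[OF res]] \<psi>_d \<phi>_d that)
    qed
  qed
  then obtain h where h_lin: "\<And>n. linear_over smul (h n)"
    and h_in: "\<And>n. h n ` free_on P (S n) \<subseteq> free_on P (S (Suc n))"
    and h_0: "\<And>x. x \<in> free_on P (S 0) \<Longrightarrow> \<psi> 0 (\<phi> 0 x) - x = d 0 (h 0 x)"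
    and h_Suc: "\<And>n x. x \<in> free_on P (S (Suc n)) \<Longrightarrow>
      \<psi> (Suc n) (\<phi> (Suc n) x) - x = d (Suc n) (h (Suc n) x) + h n (d n x)"
    by (rule null_homotopy_exists[OF res]) (rule that, simp_all)
  show ?thesis
  proof (rule rel_dim_le[of "\<phi> n"])
    show "\<phi> n ` cycles_mod S d n \<subseteq> cycles_mod S' d' n"
    proof safe
      fix x assume x: "x \<in> cycles_mod S d n"
      have "d' k (\<phi> n x) i \<in> I" if "n = Suc k" for k i
      proof -
        have "d' k (\<phi> n x) i = \<phi> k (d k x) i"
          using x \<phi>_d that by (simp add: cycles_mod_def)
        also have "\<dots> \<in> I"
          using x that resolutionD(4)[OF res]
          by (intro linear_over_ideal[OF \<phi>_lin resolutionD(1)[OF res] \<phi>_in]) (auto simp: cycles_mod_def)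
        finally show ?thesis .
      qed
      then show "\<phi> n x \<in> cycles_mod S' d' n"
        using x \<phi>_in[of n] by (simp add: cycles_mod_def image_subset_iff)
    qed
    have lin: "linear_over smul (d k)" for k using resolutionD(2)[OF res] .
    show "x + y \<in> cycles_mod S d n" if "x \<in> cycles_mod S d n" "y \<in> cycles_mod S d n" for x y
      using that by (auto simp: cycles_mod_def linear_over_add[OF lin] intro: I_add free_on_add)
    show "smul (\<kappa> c) x \<in> cycles_mod S d n" if "x \<in> cycles_mod S d n" for c x
      using that by (auto simp: cycles_mod_def linear_over_smul[OF lin] smul_def[of _ "d _ _"]
          intro: I_mult P_scalar free_on_smul)
    show "0 \<in> cycles_mod S d n" by (auto simp: cycles_mod_def linear_over_0[OF lin] free_on_0 I_0)
    show "z \<in> boundaries_mod S d n" if z: "z \<in> cycles_mod S d n" "\<phi> n z \<in> boundaries_mod S' d' n" for z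
    proof -
      have zf: "z \<in> free_on P (S n)" using z by (simp add: cycles_mod_def)
      obtain y where y: "y \<in> free_on P (S' (Suc n))" "\<And>i. \<phi> n z i - d' n y i \<in> I"
        using z(2) by (auto simp: boundaries_mod_def)
      have dy: "d' n y \<in> free_on P (S' n)" using resolutionD(4)[OF res' y(1)] .
      define u where "u = \<phi> n z - d' n y"
      have u: "u \<in> free_on P (S' n)" "\<And>i. u i \<in> I"
        using y(2) free_on_diff[OF image_subsetD[OF \<phi>_in zf] dy] by (simp_all add: u_def)
      have \<psi>u: "\<psi> n u i \<in> I" for i
        by (rule linear_over_ideal[OF \<psi>_lin resolutionD(1)[OF res'] \<psi>_in u])
      have \<psi>u': "\<psi> n u = \<psi> n (\<phi> n z) - d n (\<psi> (Suc n) y)"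
        by (simp add: u_def linear_over_diff[OF \<psi>_lin] \<psi>_d[OF y(1)])
      \<comment> \<open>Solving the homotopy relation \<psi> \<phi> z - z = d h z + h d z for z,
        with \<phi> z = u + d' y, gives z - d w = \<psi> u - h d z. Both terms have entries in I,
        the second because z is a cycle modulo I.\<close>
      define w where "w = \<psi> (Suc n) y - h n z"
      have w: "w \<in> free_on P (S (Suc n))"
        unfolding w_def using image_subsetD[OF \<psi>_in y(1)] image_subsetD[OF h_in zf] by (rule free_on_diff)
      have "z i - d n w i \<in> I" for i
      proof (cases n)
        case 0
        have "\<psi> n (\<phi> n z) i - z i = d n (h n z) i" using h_0 zf 0 by (metis minus_apply)
        then have "z i - d n w i = \<psi> n u i"
          by (simp add: w_def \<psi>u' linear_over_diff[OF lin] algebra_simps)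
        then show ?thesis using \<psi>u by simp
      next
        case (Suc k)
        have "\<psi> n (\<phi> n z) i - z i = d n (h n z) i + h k (d k z) i"
          using h_Suc[of z k] zf Suc by (metis minus_apply plus_fun_apply)
        then have "z i - d n w i = \<psi> n u i - h k (d k z) i"
          by (simp add: w_def \<psi>u' linear_over_diff[OF lin] algebra_simps)
        moreover have "h k (d k z) i \<in> I"
          using z(1) zf Suc resolutionD(4)[OF res]
          by (intro linear_over_ideal[OF h_lin resolutionD(1)[OF res] h_in]) (auto simp: cycles_mod_def)
        ultimately show ?thesis using \<psi>u I_diff by simp
      qed
      then show ?thesis using zf w by (auto simp: boundaries_mod_def)
    qed
  qed (rule \<phi>_lin)
qed

end

section \<open>Estimating \<open>rel_dim\<close> by coordinates\<close>

text \<open>Gaussian elimination: a pivot in the equation p removes one equation and one unknown,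
  which keeps the unknowns in the majority.\<close>

lemma exists_linear_relation:
  fixes M :: "'n \<Rightarrow> 'c \<Rightarrow> 'k::field"
  assumes "finite C" "finite N" "card C < card N"
  shows "\<exists>l. (\<exists>i\<in>N. l i \<noteq> 0) \<and> (\<forall>q\<in>C. (\<Sum>i\<in>N. l i * M i q) = 0)"
  using assms
proof (induction C arbitrary: N M)
  case empty
  then have "N \<noteq> {}" by auto
  then show ?case by (intro exI[of _ "\<lambda>_. 1"]) auto
next
  case (insert p C)
  show ?case
  proof (cases "\<forall>i\<in>N. M i p = 0")
    case True
    obtain l where "\<exists>i\<in>N. l i \<noteq> 0" "\<forall>q\<in>C. (\<Sum>i\<in>N. l i * M i q) = 0"
      using insert.IH[of N M] insert.prems insert.hyps by auto
    then show ?thesis using True by (intro exI[of _ l]) auto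
  next
    case False
    then obtain k where k: "k \<in> N" "M k p \<noteq> 0" by blast
    define N' where "N' = N - {k}"
    define M' where "M' i q = M i q - M i p / M k p * M k q" for i q
    have N': "finite N'" "card C < card N'" "N = insert k N'" "k \<notin> N'"
      using insert.prems insert.hyps k by (auto simp: N'_def)
    obtain l where l: "\<exists>i\<in>N'. l i \<noteq> 0" "\<forall>q\<in>C. (\<Sum>i\<in>N'. l i * M' i q) = 0"
      using insert.IH[OF N'(1,2), of M'] by blast
    \<comment> \<open>The coefficient at the pivot k is the one that makes the eliminated equation p
      hold.\<close>
    define l' where "l' i = (if i = k then - (\<Sum>j\<in>N'. l j * (M j p / M k p)) else l i)" for i
    have sum: "(\<Sum>i\<in>N. l' i * M i q) = (\<Sum>i\<in>N'. l i * M' i q)" for q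
    proof -
      have "(\<Sum>i\<in>N'. l' i * M i q) = (\<Sum>i\<in>N'. l i * M i q)"
        using N'(4) by (intro sum.cong) (auto simp: l'_def)
      then show ?thesis
        unfolding N'(3) sum.insert[OF N'(1,4)]
        by (simp add: l'_def M'_def right_diff_distrib sum_subtractf sum_distrib_right mult.assoc)
    qed
    have "M' i p = 0" for i using k by (simp add: M'_def)
    then have "\<forall>q\<in>insert p C. (\<Sum>i\<in>N. l' i * M i q) = 0" using l(2) unfolding sum by simp
    moreover have "\<exists>i\<in>N. l' i \<noteq> 0" using l(1) N'(3,4) unfolding l'_def by auto
    ultimately show ?thesis by blast
  qed
qed

text \<open>Every element of Z is congruent modulo B to one of Q, and on Q the coordinates
  \<open>L q\<close> with q in C detect membership in B; so more than \<open>card C\<close> elements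
  of Z have a nontrivial combination in B.\<close>

lemma rel_dim_le_card:
  fixes L :: "'c \<Rightarrow> ('i \<Rightarrow> 'r::comm_ring_1) \<Rightarrow> 'k::field"
  assumes C: "finite C"
    and L_add: "\<And>q x y. L q (x + y) = L q x + L q y"
    and L_smul: "\<And>q c x. L q (smul (\<kappa> c) x) = c * L q x"
    and Q: "0 \<in> Q" "\<And>x y. x \<in> Q \<Longrightarrow> y \<in> Q \<Longrightarrow> x + y \<in> Q" "\<And>c x. x \<in> Q \<Longrightarrow> smul (\<kappa> c) x \<in> Q"
    and B: "0 \<in> B" "\<And>x y. x \<in> B \<Longrightarrow> y \<in> B \<Longrightarrow> x + y \<in> B" "\<And>c x. x \<in> B \<Longrightarrow> smul (\<kappa> c) x \<in> B"
    and reduce: "\<And>z. z \<in> Z \<Longrightarrow> \<exists>y\<in>Q. z - y \<in> B"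
    and coords: "\<And>y. y \<in> Q \<Longrightarrow> (\<And>q. q \<in> C \<Longrightarrow> L q y = 0) \<Longrightarrow> y \<in> B"
  shows "rel_dim \<kappa> Z B \<le> enat (card C)"
  unfolding rel_dim_def
proof (rule SUP_least, rule ccontr)
  fix n :: nat
  assume "n \<in> {n. \<exists>x. (\<forall>i<n. x i \<in> Z) \<and> (\<forall>c. (\<Sum>i<n. smul (\<kappa> (c i)) (x i)) \<in> B \<longrightarrow> (\<forall>i<n. c i = 0))}"
  then obtain x where x: "\<And>i. i < n \<Longrightarrow> x i \<in> Z"
    "\<And>c. (\<Sum>i<n. smul (\<kappa> (c i)) (x i)) \<in> B \<Longrightarrow> \<forall>i<n. c i = 0" by blast
  assume "\<not> enat n \<le> enat (card C)"
  then have "card C < card {..<n}" by simp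
  have "\<forall>i\<in>{..<n}. \<exists>y. y \<in> Q \<and> x i - y \<in> B"
    using reduce x(1) by blast
  from bchoice[OF this] obtain y
    where y: "\<And>i. i < n \<Longrightarrow> y i \<in> Q" "\<And>i. i < n \<Longrightarrow> x i - y i \<in> B" by blast
  obtain l where l: "\<exists>i\<in>{..<n}. l i \<noteq> 0" "\<forall>q\<in>C. (\<Sum>i<n. l i * L q (y i)) = 0"
    using exists_linear_relation[OF C _ \<open>card C < card {..<n}\<close>, of "\<lambda>i q. L q (y i)"] by auto
  have L0: "L q 0 = 0" for q using L_add[of q 0 0] by (metis add.right_neutral add_left_cancel)
  have Lsum: "L q (\<Sum>i\<in>A. f i) = (\<Sum>i\<in>A. L q (f i))" for q f and A :: "nat set"
    by (induction A rule: infinite_finite_induct)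
      (simp_all only: sum.infinite sum.empty sum.insert L0 L_add simp_thms)
  have closed: "(\<Sum>i\<in>A. f i) \<in> V" if "0 \<in> V" "\<And>x y. x \<in> V \<Longrightarrow> y \<in> V \<Longrightarrow> x + y \<in> V" "\<And>i. i \<in> A \<Longrightarrow> f i \<in> V"
    for V and f :: "nat \<Rightarrow> 'i \<Rightarrow> 'r" and A
    using that(3) by (induction A rule: infinite_finite_induct) (simp_all add: that(1,2))
  have "(\<Sum>i<n. smul (\<kappa> (l i)) (y i)) \<in> B"
  proof (rule coords)
    show "(\<Sum>i<n. smul (\<kappa> (l i)) (y i)) \<in> Q"
      using Q y(1) by (intro closed) simp_all
    show "L q (\<Sum>i<n. smul (\<kappa> (l i)) (y i)) = 0" if "q \<in> C" for q
      using l(2) that by (simp add: Lsum L_smul)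
  qed
  moreover have "(\<Sum>i<n. smul (\<kappa> (l i)) (x i - y i)) \<in> B"
    using B y(2) by (intro closed) simp_all
  moreover have "(\<Sum>i<n. smul (\<kappa> (l i)) (x i)) =
      (\<Sum>i<n. smul (\<kappa> (l i)) (y i)) + (\<Sum>i<n. smul (\<kappa> (l i)) (x i - y i))"
    by (simp add: smul_simps sum_subtractf)
  ultimately have "(\<Sum>i<n. smul (\<kappa> (l i)) (x i)) \<in> B" using B(2) by simp
  then show False using x(2) l(1) by blast
qed

lemma card_le_rel_dim:
  fixes x :: "'c \<Rightarrow> 'i \<Rightarrow> 'r::comm_ring_1"
  assumes C: "finite C" and x: "\<And>q. q \<in> C \<Longrightarrow> x q \<in> Z"
    and indep: "\<And>l q. (\<Sum>q\<in>C. smul (\<kappa> (l q)) (x q)) \<in> B \<Longrightarrow> q \<in> C \<Longrightarrow> l q = 0"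
  shows "enat (card C) \<le> rel_dim \<kappa> Z B"
proof -
  obtain e where e: "bij_betw e {..<card C} C"
    using ex_bij_betw_nat_finite[OF C] by (auto simp: atLeast0LessThan)
  have e_in: "i < card C \<Longrightarrow> e i \<in> C" for i using e by (auto simp: bij_betw_def)
  have "\<forall>i<card C. c i = 0" if c: "(\<Sum>i<card C. smul (\<kappa> (c i)) (x (e i))) \<in> B" for c
  proof (intro allI impI)
    fix i assume i: "i < card C"
    define l where "l q = c (inv_into {..<card C} e q)" for q
    have le: "l (e j) = c j" if "j < card C" for j
      using that e by (simp add: l_def bij_betw_def inv_into_f_f)
    have "(\<Sum>q\<in>C. smul (\<kappa> (l q)) (x q)) = (\<Sum>i<card C. smul (\<kappa> (l (e i))) (x (e i)))"
      by (rule sum.reindex_bij_betw[OF e, symmetric])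
    also have "\<dots> = (\<Sum>i<card C. smul (\<kappa> (c i)) (x (e i)))"
      by (intro sum.cong) (simp_all add: le)
    finally have "(\<Sum>q\<in>C. smul (\<kappa> (l q)) (x q)) \<in> B" using c by simp
    then have "l (e i) = 0" by (rule indep) (rule e_in[OF i])
    then show "c i = 0" by (simp add: le[OF i])
  qed
  then show ?thesis
    unfolding rel_dim_def using x e_in
    by (intro SUP_upper CollectI exI[of _ "\<lambda>i. x (e i)"]) simp
qed

section \<open>The Koszul complex\<close>

abbreviation "lookup \<equiv> Poly_Mapping.lookup"

abbreviation "keys \<equiv> Poly_Mapping.keys"

abbreviation "single \<equiv> Poly_Mapping.single"

abbreviation unit_exp :: "nat \<Rightarrow> nat \<Rightarrow>\<^sub>0 nat" where
  "unit_exp i \<equiv> single i 1"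

definition polys_on :: "nat \<Rightarrow> 'f::field mpoly set" where
  "polys_on m = {p. \<forall>t\<in>keys p. keys t \<subseteq> {1..m}}"

text \<open>The Stanley-Reisner ideal in monomial form, as shown in
  \<open>stanley_reisner_ideal_eq\<close>: membership can be tested coefficient by
  coefficient.\<close>

definition nonface_polys :: "nat \<Rightarrow> nat set set \<Rightarrow> 'f::field mpoly set" where
  "nonface_polys m K =
     {p. \<forall>t\<in>keys p. keys t \<subseteq> {1..m} \<and> keys t \<notin> K}"

lemma lookup_single_mult:
  fixes p :: "(nat \<Rightarrow>\<^sub>0 nat) \<Rightarrow>\<^sub>0 'f::comm_semiring_1"
  shows "lookup (single s c * p) (s + t) = c * lookup p t"
  by (simp add: lookup_mult lookup_single when_mult)

lemma lookup_single_mult_notin: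
  fixes p :: "(nat \<Rightarrow>\<^sub>0 nat) \<Rightarrow>\<^sub>0 'f::comm_semiring_1"
  assumes "\<And>u. t \<noteq> s + u"
  shows "lookup (single s c * p) t = 0"
proof -
  have "t \<notin> keys (single s c * p)"
    using keys_mult[of "single s c" p] assms by (auto split: if_splits)
  then show ?thesis by (simp add: in_keys_iff)
qed

lemma unit_exp_add_diff: "lookup t i \<noteq> 0 \<Longrightarrow> unit_exp i + (t - unit_exp i) = t"
  by (rule poly_mapping_eqI) (auto simp: lookup_add lookup_minus lookup_single when_def)

lemma diff_unit_exp_add: "lookup t i \<noteq> 0 \<Longrightarrow> t - unit_exp i + unit_exp i = t"
  using unit_exp_add_diff[of t i] by (simp add: add.commute)

lemma lookup_mvar_mult:
  "lookup (mvar i * p) t =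
    (if lookup t i = 0 then 0 else lookup p (t - unit_exp i))"
proof (cases "lookup t i = 0")
  case True
  then have "t \<noteq> unit_exp i + u" for u by (auto simp: lookup_add)
  then show ?thesis using True by (simp add: mvar_def lookup_single_mult_notin)
next
  case False
  then show ?thesis
    using lookup_single_mult[of "unit_exp i" 1 p "t - unit_exp i"] unit_exp_add_diff[OF False]
    by (simp add: mvar_def)
qed

lemma lookup_mult_0:
  fixes p q :: "(nat \<Rightarrow>\<^sub>0 nat) \<Rightarrow>\<^sub>0 'f::comm_semiring_1"
  shows "lookup (p * q) 0 = lookup p 0 * lookup q 0"
proof -
  have "0 \<noteq> l + r" if "l \<noteq> 0" for l r :: "nat \<Rightarrow>\<^sub>0 nat"
    using that by (auto simp: poly_mapping_eq_iff lookup_add fun_eq_iff)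
  then have "Sum_any (\<lambda>r. lookup q r when 0 = l + r) = (lookup q 0 when l = 0)" for l
    by (cases "l = 0") simp_all
  then show ?thesis by (simp add: lookup_mult mult_when)
qed

lemma lookup_mconst_mult: "lookup (mconst c * p) t = c * lookup p t"
  using lookup_single_mult[of 0 c p t] by (simp add: mconst_def)

lemma lookup_minus_1_power_mult:
  fixes p :: "(nat \<Rightarrow>\<^sub>0 nat) \<Rightarrow>\<^sub>0 'f::comm_ring_1"
  shows "lookup ((-1) ^ n * p) t = (-1) ^ n * lookup p t"
  by (cases "even n") auto

lemma keys_add_exp: "keys (s + t :: nat \<Rightarrow>\<^sub>0 nat) = keys s \<union> keys t"
  by (auto simp: in_keys_iff lookup_add)

lemma nonface_polys_mult:
  assumes "p \<in> polys_on m" "q \<in> nonface_polys m K" and K: "\<And>\<sigma> \<tau>. \<sigma> \<in> K \<Longrightarrow> \<tau> \<subseteq> \<sigma> \<Longrightarrow> \<tau> \<in> K"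
  shows "p * q \<in> nonface_polys m K"
  unfolding nonface_polys_def
proof (intro CollectI ballI)
  fix t assume "t \<in> keys (p * q)"
  then obtain a b where ab: "a \<in> keys p" "b \<in> keys q" "t = a + b"
    using keys_mult[of p q] by blast
  then have "keys a \<subseteq> {1..m}" "keys b \<subseteq> {1..m}" "keys b \<notin> K"
    using assms(1,2) by (auto simp: polys_on_def nonface_polys_def)
  then show "keys t \<subseteq> {1..m} \<and> keys t \<notin> K"
    unfolding ab(3) keys_add_exp using K[of "keys a \<union> keys b" "keys b"]
    by blast
qed

lemma coefficient_ring_polys:
  assumes "\<And>\<sigma> \<tau>. \<sigma> \<in> K \<Longrightarrow> \<tau> \<subseteq> \<sigma> \<Longrightarrow> \<tau> \<in> K"
  shows "coefficient_ring (polys_on m :: 'f::field mpoly set) mconst (nonface_polys m K)"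
proof -
  \<comment> \<open>For the empty family no monomial is a face, so closure facts for the ring are
    instances of those for the ideal.\<close>
  have polys_on_eq: "polys_on m = (nonface_polys m {} :: 'f mpoly set)"
    by (simp add: polys_on_def nonface_polys_def)
  have add: "p + q \<in> nonface_polys m L" if "p \<in> nonface_polys m L" "q \<in> nonface_polys m L"
    for p q :: "'f mpoly" and L
    unfolding nonface_polys_def
  proof (intro CollectI ballI)
    fix t assume "t \<in> keys (p + q)"
    then have "t \<in> keys p \<or> t \<in> keys q" using keys_add[of p q] by blast
    then show "keys t \<subseteq> {1..m} \<and> keys t \<notin> L"
      using that by (auto simp only: nonface_polys_def)
  qed
  show ?thesis
  proof
    show "p * q \<in> nonface_polys m K" if "p \<in> polys_on m" "q \<in> nonface_polys m K" for p q :: "'f mpoly"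
      by (rule nonface_polys_mult[OF that]) (rule assms)
    show "p * q \<in> polys_on m" if "p \<in> polys_on m" "q \<in> polys_on m" for p q :: "'f mpoly"
      using nonface_polys_mult[of p m q "{}"] that by (simp add: polys_on_eq)
    show "p + q \<in> polys_on m" if "p \<in> polys_on m" "q \<in> polys_on m" for p q :: "'f mpoly"
      using add that by (simp add: polys_on_eq)
    show "- p \<in> polys_on m" if "p \<in> polys_on m" for p :: "'f mpoly"
      using that by (simp add: polys_on_def in_keys_iff)
    show "p + q \<in> nonface_polys m K" if "p \<in> nonface_polys m K" "q \<in> nonface_polys m K" for p q :: "'f mpoly"
      using that by (rule add)
  qed (auto simp: polys_on_def nonface_polys_def mconst_def)
qed

section \<open>The Koszul differential\<close>

definition koszul_sign :: "nat \<Rightarrow> nat set \<Rightarrow> 'a::comm_ring_1" where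
  "koszul_sign i J = (-1) ^ card {k \<in> J. k < i}"

lemma koszul_sign_sq [simp]: "koszul_sign i J * koszul_sign i J = (1 :: 'a::comm_ring_1)"
  by (simp add: koszul_sign_def flip: power_mult_distrib)

lemma koszul_sign_sq_left [simp]: "koszul_sign i J * (koszul_sign i J * a) = (a :: 'a::comm_ring_1)"
  by (simp flip: mult.assoc)

lemma koszul_sign_insert:
  assumes "v \<notin> J"
  shows "koszul_sign i (insert v J) = (if v < i then - koszul_sign i J else (koszul_sign i J :: 'a::comm_ring_1))"
proof -
  have "{k \<in> insert v J. k < i} = (if v < i then insert v {k \<in> J. k < i} else {k \<in> J. k < i})"
    by auto
  then show ?thesis using assms by (simp add: koszul_sign_def)
qed

lemma koszul_sign_swap:
  assumes "i \<noteq> v" "i \<notin> J" "v \<notin> J"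
  shows "koszul_sign i (insert v J) * koszul_sign v (insert i J) =
    - (koszul_sign i J * koszul_sign v J :: 'a::comm_ring_1)"
  using assms by (simp add: koszul_sign_insert)

lemma lookup_koszul_sign_mult:
  fixes p :: "(nat \<Rightarrow>\<^sub>0 nat) \<Rightarrow>\<^sub>0 'f::comm_ring_1"
  shows "lookup (koszul_sign i J * p) t = koszul_sign i J * lookup p t"
  by (simp add: koszul_sign_def lookup_minus_1_power_mult)

text \<open>\<open>x J\<close> is the coefficient of the exterior basis element e_J. The usual rule
  sending e_J to the signed sum of the x_i e_(J - {i}) is written here on coefficients, so J
  collects contributions from the sets \<open>insert i J\<close>.\<close>

definition koszul_d :: "nat \<Rightarrow> (nat set \<Rightarrow> 'f::field mpoly) \<Rightarrow> nat set \<Rightarrow> 'f mpoly" where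
  "koszul_d m x J = (\<Sum>i\<in>{1..m} - J. koszul_sign i J * (mvar i * x (insert i J)))"

lemma lookup_koszul_d:
  "lookup (koszul_d m x J) t =
    (\<Sum>i | i \<in> {1..m} - J \<and> lookup t i \<noteq> 0.
       koszul_sign i J * lookup (x (insert i J)) (t - unit_exp i))"
  unfolding koszul_d_def lookup_sum lookup_koszul_sign_mult lookup_mvar_mult
  by (intro sum.mono_neutral_cong_right) auto

lemma linear_over_koszul_d: "linear_over smul (koszul_d m)"
  by (auto simp: linear_over_def koszul_d_def smul_def fun_eq_iff algebra_simps sum.distrib sum_distrib_left)

text \<open>The terms cancel in pairs as indices are added one at a time. Exchanging i and k in the
  whole sum would only show that twice the sum is 0, which says nothing in characteristic 2.\<close>

lemma sum_antisymmetric: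
  fixes F :: "'i \<Rightarrow> 'i \<Rightarrow> 'a::ab_group_add"
  assumes "finite B" "\<And>i k. i \<in> B \<Longrightarrow> k \<in> B \<Longrightarrow> i \<noteq> k \<Longrightarrow> F i k = - F k i"
  shows "(\<Sum>i\<in>B. \<Sum>k\<in>B - {i}. F i k) = 0"
  using assms
proof (induction B)
  case (insert b B)
  have IH: "(\<Sum>i\<in>B. \<Sum>k\<in>B - {i}. F i k) = 0"
    by (rule insert.IH) (use insert.prems in blast)
  have "(\<Sum>i\<in>insert b B. \<Sum>k\<in>insert b B - {i}. F i k) =
      (\<Sum>k\<in>B. F b k) + (\<Sum>i\<in>B. \<Sum>k\<in>insert b B - {i}. F i k)"
    using insert.hyps by (simp add: insert_Diff_if)
  also have "(\<Sum>i\<in>B. \<Sum>k\<in>insert b B - {i}. F i k) = (\<Sum>i\<in>B. F i b + (\<Sum>k\<in>B - {i}. F i k))"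
    using insert.hyps by (intro sum.cong refl) (auto simp: insert_Diff_if)
  also have "\<dots> = (\<Sum>i\<in>B. F i b)"
    using IH by (simp add: sum.distrib)
  also have "(\<Sum>k\<in>B. F b k) + (\<Sum>i\<in>B. F i b) = (\<Sum>k\<in>B. F b k + F k b)"
    by (simp add: sum.distrib)
  also have "\<dots> = 0"
  proof (intro sum.neutral ballI)
    fix k assume "k \<in> B"
    then have "F b k = - F k b" using insert.hyps by (intro insert.prems(1)) auto
    then show "F b k + F k b = 0" by simp
  qed
  finally show ?case .
qed simp

lemma koszul_d_d [simp]: "koszul_d m (koszul_d m x) = 0"
proof
  fix J
  define F where "F i k = koszul_sign i J * koszul_sign k (insert i J) * (mvar i * mvar k * x (insert k (insert i J)))"
    for i k
  have "koszul_d m (koszul_d m x) J = (\<Sum>i\<in>{1..m} - J. \<Sum>k\<in>{1..m} - insert i J. F i k)"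
    by (simp only: koszul_d_def F_def sum_distrib_left mult_ac)
  also have "\<dots> = (\<Sum>i\<in>{1..m} - J. \<Sum>k\<in>{1..m} - J - {i}. F i k)"
    by (intro sum.cong) auto
  also have "\<dots> = 0"
  proof (rule sum_antisymmetric)
    fix i k assume "i \<in> {1..m} - J" "k \<in> {1..m} - J" "i \<noteq> k"
    then have "koszul_sign i J * koszul_sign k (insert i J) =
        - (koszul_sign k J * koszul_sign i (insert k J) :: 'a mpoly)"
      by (cases "i < k") (simp_all add: koszul_sign_insert mult.commute)
    moreover have "mvar i * mvar k * x (insert k (insert i J)) = mvar k * mvar i * x (insert i (insert k J))"
      by (simp add: insert_commute mult.commute)
    ultimately show "F i k = - F k i"
      unfolding F_def by simp
  qed simp
  finally show "koszul_d m (koszul_d m x) J = 0 J" by simp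
qed

section \<open>Contracting homotopy and exactness\<close>

definition indicator_exp :: "nat set \<Rightarrow> nat \<Rightarrow>\<^sub>0 nat" where
  "indicator_exp J = (\<Sum>i\<in>J. unit_exp i)"

lemma lookup_indicator_exp:
  "finite J \<Longrightarrow> lookup (indicator_exp J) i = (if i \<in> J then 1 else 0)"
  unfolding indicator_exp_def lookup_sum lookup_single when_def by simp

lemma keys_indicator_exp [simp]: "finite J \<Longrightarrow> keys (indicator_exp J) = J"
  by (rule Set.set_eqI) (simp add: in_keys_iff lookup_indicator_exp)

lemma indicator_exp_insert:
  "finite J \<Longrightarrow> i \<notin> J \<Longrightarrow> indicator_exp (insert i J) = unit_exp i + indicator_exp J"
  by (simp add: indicator_exp_def)

text \<open>Moves the variable with index \<open>v a\<close> from the monomial to the set, in multidegree \<open>a\<close>.\<close>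

definition koszul_h ::
  "((nat \<Rightarrow>\<^sub>0 nat) \<Rightarrow> nat) \<Rightarrow> (nat set \<Rightarrow> 'f::field mpoly) \<Rightarrow> nat set \<Rightarrow> 'f mpoly" where
  "koszul_h v x J = (if finite J then Abs_poly_mapping (\<lambda>t. let u = v (t + indicator_exp J) in
     if u \<in> J then koszul_sign u (J - {u}) * lookup (x (J - {u})) (t + unit_exp u) else 0) else 0)"

lemma lookup_koszul_h:
  assumes "finite J"
  shows "lookup (koszul_h v x J) t = (let u = v (t + indicator_exp J) in
     if u \<in> J then koszul_sign u (J - {u}) * lookup (x (J - {u})) (t + unit_exp u) else 0)"
proof -
  let ?f = "\<lambda>t. let u = v (t + indicator_exp J) in
     if u \<in> J then koszul_sign u (J - {u}) * lookup (x (J - {u})) (t + unit_exp u) else 0"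
  \<comment> \<open>\<open>Abs_poly_mapping\<close> is only meaningful for finite support. The
    vertex u varies with t but stays in J, so finitely many shifted sets of keys cover the
    support.\<close>
  have "{t. ?f t \<noteq> 0} \<subseteq> (\<Union>u\<in>J. (\<lambda>s. s - unit_exp u) ` keys (x (J - {u})))"
  proof
    fix t assume t: "t \<in> {t. ?f t \<noteq> 0}"
    define u where "u = v (t + indicator_exp J)"
    have u: "u \<in> J" "lookup (x (J - {u})) (t + unit_exp u) \<noteq> 0"
      using t by (auto simp: Let_def u_def split: if_splits)
    then have "t + unit_exp u \<in> keys (x (J - {u}))" "t = (t + unit_exp u) - unit_exp u"
      by (auto simp: in_keys_iff)
    then show "t \<in> (\<Union>u\<in>J. (\<lambda>s. s - unit_exp u) ` keys (x (J - {u})))"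
      using u(1) by blast
  qed
  then have "finite {t. ?f t \<noteq> 0}" by (rule finite_subset) (use assms in auto)
  then show ?thesis using assms by (simp add: koszul_h_def)
qed

text \<open>The homotopy identity d h + h d = 1 in a multidegree whose support contains the chosen
  u. The term h d x is written out, because what matters later is whether this single coefficient of
  d x vanishes.\<close>

lemma koszul_homotopy:
  assumes J: "J \<subseteq> {1..m}" and u: "u = v (t + indicator_exp J)" "u \<in> keys (t + indicator_exp J)"
    "u \<in> {1..m}"
  shows "lookup (koszul_d m (koszul_h v x) J) t =
    lookup (x J) t - (if u \<in> J then koszul_sign u (J - {u}) *
      lookup (koszul_d m x (J - {u})) (t + unit_exp u) else 0)"
proof -
  have fJ: "finite J" using J finite_subset by blast
  let ?T = "{i. i \<in> {1..m} - J \<and> lookup t i \<noteq> 0}"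
  have fT: "finite ?T" by simp
  \<comment> \<open>The differential preserves the multidegree \<open>t + indicator_exp J\<close>,
    so the choice function picks the same u in every term of the sum.\<close>
  have exp: "t - unit_exp i + indicator_exp (insert i J) = t + indicator_exp J" if "i \<in> ?T" for i
    using that fJ diff_unit_exp_add[of t i]
    by (simp add: indicator_exp_insert flip: add.assoc)
  have h: "lookup (koszul_h v x (insert i J)) (t - unit_exp i) =
      (if u \<in> insert i J then koszul_sign u (insert i J - {u}) *
        lookup (x (insert i J - {u})) (t - unit_exp i + unit_exp u) else 0)" if "i \<in> ?T" for i
    using fJ exp[OF that] u(1) by (simp add: lookup_koszul_h Let_def)
  have D: "lookup (koszul_d m (koszul_h v x) J) t =
      (\<Sum>i\<in>?T. koszul_sign i J * (if u \<in> insert i J then koszul_sign u (insert i J - {u}) *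
        lookup (x (insert i J - {u})) (t - unit_exp i + unit_exp u) else 0))"
    unfolding lookup_koszul_d by (rule sum.cong) (use h in auto)
  show ?thesis
  proof (cases "u \<in> J")
    case False
    then have "lookup t u \<noteq> 0"
      using u(2) fJ by (simp add: in_keys_iff lookup_add lookup_indicator_exp)
    then have uT: "u \<in> ?T" using False u(3) by simp
    have "lookup (koszul_d m (koszul_h v x) J) t =
        (\<Sum>i\<in>?T. if i = u then lookup (x J) t else 0)"
      unfolding D
    proof (rule sum.cong)
      fix i assume "i \<in> ?T"
      then show "koszul_sign i J * (if u \<in> insert i J then koszul_sign u (insert i J - {u}) *
          lookup (x (insert i J - {u})) (t - unit_exp i + unit_exp u) else 0) =
          (if i = u then lookup (x J) t else 0)"
        using False diff_unit_exp_add[of t i] by auto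
    qed simp
    also have "\<dots> = lookup (x J) t" using fT uT by (subst sum.delta) auto
    finally show ?thesis using False by simp
  next
    case True
    define L where "L = J - {u}"
    have L: "J = insert u L" "u \<notin> L" using True by (auto simp: L_def)
    have uT: "u \<notin> ?T" using True by simp
    \<comment> \<open>The sum for d x at J - {u} has one term more than the sum for d h x at J,
      namely i = u; this term yields x itself, and the others cancel by
      \<open>koszul_sign_swap\<close>.\<close>
    have eq: "{i. i \<in> {1..m} - L \<and> lookup (t + unit_exp u) i \<noteq> 0} = insert u ?T"
      using L u(3) by (auto simp: lookup_add lookup_single)
    have "lookup (koszul_d m x L) (t + unit_exp u) =
        koszul_sign u L * lookup (x J) t +
        (\<Sum>i\<in>?T. koszul_sign i L * lookup (x (insert i L)) (t + unit_exp u - unit_exp i))"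
      unfolding lookup_koszul_d eq sum.insert[OF fT uT] by (simp flip: L(1))
    also have "(\<Sum>i\<in>?T. koszul_sign i L * lookup (x (insert i L)) (t + unit_exp u - unit_exp i)) =
        (\<Sum>i\<in>?T. koszul_sign i L * lookup (x (insert i L)) (t - unit_exp i + unit_exp u))"
    proof (rule sum.cong)
      fix i assume i: "i \<in> ?T"
      then have "t + unit_exp u - unit_exp i = t - unit_exp i + unit_exp u"
        by (intro poly_mapping_eqI) (auto simp: lookup_add lookup_minus lookup_single when_def)
      then show "koszul_sign i L * lookup (x (insert i L)) (t + unit_exp u - unit_exp i) =
          koszul_sign i L * lookup (x (insert i L)) (t - unit_exp i + unit_exp u)"
        by simp
    qed simp
    finally have dL: "koszul_sign u L * lookup (koszul_d m x L) (t + unit_exp u) =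
        lookup (x J) t + koszul_sign u L *
        (\<Sum>i\<in>?T. koszul_sign i L * lookup (x (insert i L)) (t - unit_exp i + unit_exp u))"
      by (simp add: distrib_left)
    have "lookup (koszul_d m (koszul_h v x) J) t =
        (\<Sum>i\<in>?T. - (koszul_sign u L * (koszul_sign i L * lookup (x (insert i L)) (t - unit_exp i + unit_exp u))))"
      unfolding D
    proof (rule sum.cong)
      fix i assume i: "i \<in> ?T"
      then have "i \<noteq> u" "i \<notin> L" using L by auto
      then have "insert i J - {u} = insert i L" using L by auto
      moreover have "koszul_sign i J * koszul_sign u (insert i L) = - (koszul_sign u L * koszul_sign i L :: 'a)"
        unfolding L(1) mult.commute[of "koszul_sign u L"]
        by (rule koszul_sign_swap[OF \<open>i \<noteq> u\<close> \<open>i \<notin> L\<close> L(2)])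
      ultimately show "koszul_sign i J * (if u \<in> insert i J then koszul_sign u (insert i J - {u}) *
          lookup (x (insert i J - {u})) (t - unit_exp i + unit_exp u) else 0) =
          - (koszul_sign u L * (koszul_sign i L * lookup (x (insert i L)) (t - unit_exp i + unit_exp u)))"
        using True by (simp flip: mult.assoc)
    qed simp
    also have "\<dots> = - (koszul_sign u L * (\<Sum>i\<in>?T. koszul_sign i L *
        lookup (x (insert i L)) (t - unit_exp i + unit_exp u)))"
      by (simp add: sum_negf sum_distrib_left)
    finally show ?thesis using True dL by (simp add: L_def[symmetric])
  qed
qed

definition subsets_of_card :: "nat \<Rightarrow> nat \<Rightarrow> nat set set" where
  "subsets_of_card m n = {J. J \<subseteq> {1..m} \<and> card J = n}"

lemma finite_subsets_of_card [simp]: "finite (subsets_of_card m n)"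
  by (rule finite_subset[of _ "Pow {1..m}"]) (auto simp: subsets_of_card_def)

lemma mvar_in_polys_on: "i \<in> {1..m} \<Longrightarrow> mvar i \<in> polys_on m"
  by (auto simp: mvar_def polys_on_def)

interpretation polys: coefficient_ring "polys_on m" mconst "nonface_polys m {}" for m
  by (rule coefficient_ring_polys) auto

lemma koszul_sign_in_polys_on: "koszul_sign i J \<in> polys_on m"
proof -
  have "koszul_sign i J = (1 :: 'f::field mpoly) \<or> koszul_sign i J = (-1 :: 'f mpoly)" for i J
    by (cases "even (card {k \<in> J. k < i})") (auto simp: koszul_sign_def)
  then show ?thesis using polys.P_1 polys.P_uminus[OF polys.P_1] by metis
qed

lemma koszul_d_maps:
  "x \<in> free_on (polys_on m) (subsets_of_card m (Suc n)) \<Longrightarrow>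
    koszul_d m x \<in> free_on (polys_on m) (subsets_of_card m n)"
proof -
  assume x: "x \<in> free_on (polys_on m) (subsets_of_card m (Suc n))"
  have "x (insert i J) = 0" if "i \<in> {1..m} - J" "J \<notin> subsets_of_card m n" for i J
  proof -
    have "insert i J \<notin> subsets_of_card m (Suc n)"
      using that finite_subset[of J "{1..m}"] by (auto simp: subsets_of_card_def)
    then show ?thesis using x by (simp add: free_on_def)
  qed
  then show ?thesis
    using x unfolding free_on_def koszul_d_def
    by (auto intro!: polys.P_sum polys.P_mult mvar_in_polys_on koszul_sign_in_polys_on sum.neutral)
qed

definition admissible :: "nat \<Rightarrow> ((nat \<Rightarrow>\<^sub>0 nat) \<Rightarrow> nat) \<Rightarrow> bool" where
  "admissible m v \<longleftrightarrow> (\<forall>a. a \<noteq> 0 \<longrightarrow> keys a \<subseteq> {1..m} \<longrightarrow> v a \<in> keys a)"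

lemma koszul_h_maps:
  assumes x: "x \<in> free_on (polys_on m) (subsets_of_card m n)" and v: "admissible m v"
  shows "koszul_h v x \<in> free_on (polys_on m) (subsets_of_card m (Suc n))"
proof -
  have nz: "finite J \<and> J \<in> subsets_of_card m (Suc n) \<and> keys t \<subseteq> {1..m}"
    if "lookup (koszul_h v x J) t \<noteq> 0" for J t
  proof -
    have fJ: "finite J" using that by (auto simp: koszul_h_def split: if_splits)
    define u where "u = v (t + indicator_exp J)"
    have u: "u \<in> J" and nz: "lookup (x (J - {u})) (t + unit_exp u) \<noteq> 0"
      using that fJ by (auto simp: lookup_koszul_h u_def Let_def split: if_splits)
    have "x (J - {u}) \<noteq> 0" using nz by auto
    then have JS: "J - {u} \<in> subsets_of_card m n" using x by (auto simp: free_on_def)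
    have "x (J - {u}) \<in> polys_on m" using x by (auto simp: free_on_def)
    then have keys: "keys (t + unit_exp u) \<subseteq> {1..m}"
      using nz by (auto simp: polys_on_def in_keys_iff)
    then have k: "keys t \<subseteq> {1..m}" "u \<in> {1..m}" by (auto simp: keys_add_exp)
    have "J \<subseteq> {1..m}" using JS k(2) by (auto simp: subsets_of_card_def)
    then have "J \<in> subsets_of_card m (Suc n)"
      using JS card_Suc_Diff1[OF fJ u] by (simp add: subsets_of_card_def)
    then show ?thesis using fJ k by blast
  qed
  show ?thesis
    unfolding free_on_def
  proof (intro CollectI conjI allI impI)
    show "koszul_h v x J \<in> polys_on m" for J
      unfolding polys_on_def
    proof (intro CollectI ballI)
      fix t assume "t \<in> keys (koszul_h v x J)"
      then have "lookup (koszul_h v x J) t \<noteq> 0" by (simp add: in_keys_iff)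
      then show "keys t \<subseteq> {1..m}" using nz by blast
    qed
    show "koszul_h v x J = 0" if "J \<notin> subsets_of_card m (Suc n)" for J
    proof (rule poly_mapping_eqI)
      show "lookup (koszul_h v x J) t = lookup 0 t" for t
        using nz[of J t] that by auto
    qed
  qed
qed

lemma koszul_d_maps_0:
  assumes "x \<in> free_on (polys_on m) (subsets_of_card m 0)"
  shows "koszul_d m x = 0"
proof
  fix J
  have "x (insert i J) = 0" if "i \<in> {1..m} - J" for i
  proof -
    have "card (insert i J) \<noteq> 0" if "insert i J \<subseteq> {1..m}"
      using finite_subset[OF that] by (simp only: card_eq_0_iff) auto
    then have "insert i J \<notin> subsets_of_card m 0" by (auto simp only: subsets_of_card_def)
    then show ?thesis using assms by (simp add: free_on_def)
  qed
  then show "koszul_d m x J = 0 J" by (simp add: koszul_d_def)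
qed

text \<open>Locates all positions where x differs from d h x: degree 0, which has no vertex to move,
  or a position where h d x is nonzero. It serves for honest cycles in \<open>koszul_exact\<close>
  and for cycles modulo nonfaces in \<open>critical_remainder\<close>.\<close>

lemma koszul_remainder:
  assumes x: "x \<in> free_on (polys_on m) (subsets_of_card m n)" and v: "admissible m v"
    and nz: "lookup (x J) t \<noteq> lookup (koszul_d m (koszul_h v x) J) t"
  shows "J = {} \<and> t = 0 \<or> J \<in> subsets_of_card m n \<and> keys t \<subseteq> {1..m} \<and>
    v (t + indicator_exp J) \<in> J \<and>
    lookup (koszul_d m x (J - {v (t + indicator_exp J)}))
      (t + unit_exp (v (t + indicator_exp J))) \<noteq> 0"
proof -
  define y where "y = koszul_d m (koszul_h v x)"
  have y: "y \<in> free_on (polys_on m) (subsets_of_card m n)"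
    unfolding y_def by (intro koszul_d_maps koszul_h_maps x v)
  have J: "J \<in> subsets_of_card m n"
  proof (rule ccontr)
    assume "J \<notin> subsets_of_card m n"
    then have "x J = 0" "y J = 0" using x y by (simp_all add: free_on_def)
    then show False using nz by (simp add: y_def)
  qed
  then have Jm: "J \<subseteq> {1..m}" by (simp add: subsets_of_card_def)
  then have fJ: "finite J" using finite_subset by blast
  have t: "keys t \<subseteq> {1..m}"
  proof (rule ccontr)
    assume t: "\<not> keys t \<subseteq> {1..m}"
    have "x J \<in> polys_on m" "y J \<in> polys_on m" using x y by (simp_all add: free_on_def)
    then have "t \<notin> keys (x J)" "t \<notin> keys (y J)"
      using t unfolding polys_on_def by blast+
    then show False using nz by (simp add: y_def in_keys_iff)
  qed
  define u where "u = v (t + indicator_exp J)"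
  show ?thesis
  proof (cases "t + indicator_exp J = 0")
    case True
    then have "keys t \<union> J = {}"
      using keys_add_exp[of t "indicator_exp J"] fJ by simp
    then show ?thesis by simp
  next
    case False
    have keys: "keys (t + indicator_exp J) \<subseteq> {1..m}"
      using t Jm fJ by (simp add: keys_add_exp)
    then have u: "u \<in> keys (t + indicator_exp J)"
      using v False unfolding admissible_def u_def by blast
    then have "u \<in> {1..m}" using keys by blast
    from koszul_homotopy[where v = v and x = x, OF Jm u_def u this] nz
    have "u \<in> J \<and> lookup (koszul_d m x (J - {u})) (t + unit_exp u) \<noteq> 0"
      by (auto split: if_splits)
    then show ?thesis using J t by (simp add: u_def)
  qed
qed

lemma lookup_koszul_d_0: "lookup (koszul_d m x J) 0 = 0"
  by (simp add: lookup_koszul_d)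

text \<open>For d x = 0 the remainder is confined to the constant coefficient at the empty set,
  which the last assumption removes. Any admissible choice of vertices will do; the minimum is
  one.\<close>

lemma koszul_exact:
  assumes x: "x \<in> free_on (polys_on m) (subsets_of_card m n)"
    and "koszul_d m x = 0" "lookup (x {}) 0 = 0"
  shows "x \<in> koszul_d m ` free_on (polys_on m) (subsets_of_card m (Suc n))"
proof -
  define v where "v a = Min (keys a)" for a :: "nat \<Rightarrow>\<^sub>0 nat"
  have v: "admissible m v" by (auto simp: admissible_def v_def intro!: Min_in)
  have "x = koszul_d m (koszul_h v x)"
  proof (intro ext poly_mapping_eqI, rule ccontr)
    fix J t
    assume nz: "lookup (x J) t \<noteq> lookup (koszul_d m (koszul_h v x) J) t"
    then have "\<not> (J = {} \<and> t = 0)" using assms(3) lookup_koszul_d_0 by metis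
    with koszul_remainder[OF x v nz] assms(2) show False by simp
  qed
  then show ?thesis using koszul_h_maps[OF x v] by (rule image_eqI)
qed

lemma koszul_resolution:
  "coefficient_ring.resolution (polys_on m) (\<lambda>r y. lookup r 0 * y) (subsets_of_card m)
     (\<lambda>_. koszul_d m) (\<lambda>x. lookup (x {}) 0 :: 'f::field)"
  unfolding polys.resolution_def
proof (intro conjI allI ballI)
  show "linear_over (\<lambda>r y. lookup r 0 * y)
      (\<lambda>x :: nat set \<Rightarrow> 'f mpoly. lookup (x {}) 0)"
    by (simp add: linear_over_def lookup_add smul_def lookup_mult_0)
  show "koszul_d m ` free_on (polys_on m) (subsets_of_card m (Suc n)) \<subseteq> free_on (polys_on m) (subsets_of_card m n)" for n
    using koszul_d_maps by (rule image_subsetI)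
  show "(\<lambda>x. lookup (x {}) 0 :: 'f) ` free_on (polys_on m) (subsets_of_card m 0) = UNIV"
  proof (intro equalityI subset_UNIV subsetI)
    fix c :: 'f
    show "c \<in> (\<lambda>x. lookup (x {}) 0) ` free_on (polys_on m) (subsets_of_card m 0)"
      by (rule image_eqI[of _ _ "\<lambda>J. if J = {} then mconst c else 0"])
        (auto simp: mconst_def free_on_def subsets_of_card_def polys_on_def)
  qed
  show "(lookup (x {}) 0 = 0) = (x \<in> koszul_d m ` free_on (polys_on m) (subsets_of_card m 1))"
    if x: "x \<in> free_on (polys_on m) (subsets_of_card m 0)" for x :: "nat set \<Rightarrow> 'f mpoly"
    using koszul_exact[OF x koszul_d_maps_0[OF x]] by (auto simp: lookup_koszul_d_0)
  show "(koszul_d m x = 0) = (x \<in> koszul_d m ` free_on (polys_on m) (subsets_of_card m (Suc (Suc n))))"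
    if x: "x \<in> free_on (polys_on m) (subsets_of_card m (Suc n))" for n and x :: "nat set \<Rightarrow> 'f mpoly"
  proof -
    \<comment> \<open>In positive homological degree the empty set is not an index, so the
      augmentation condition of \<open>koszul_exact\<close> is automatic.\<close>
    have "x {} = 0" using x by (simp add: free_on_def subsets_of_card_def)
    then show ?thesis using koszul_exact[OF x] by auto
  qed
qed (simp_all add: linear_over_koszul_d)

lemma indicator_exp_eq:
  assumes "\<And>i. lookup t i \<le> 1"
  shows "t = indicator_exp (keys t)"
proof (rule poly_mapping_eqI)
  fix i show "lookup t i = lookup (indicator_exp (keys t)) i"
    using assms[of i] by (auto simp: lookup_indicator_exp in_keys_iff)
qed

section \<open>Homology of the Koszul complex modulo the nonfaces\<close>

text \<open>A pair (U, \<sigma>) stands for the monomial \<open>indicator_exp \<sigma>\<close> at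
  the index J = U - \<sigma>; its homological degree n is card J.\<close>

definition critical_cells :: "nat \<Rightarrow> nat set set \<Rightarrow> (nat set \<Rightarrow> nat) \<Rightarrow> nat \<Rightarrow> (nat set \<times> nat set) set" where
  "critical_cells m K w n =
     {(U, \<sigma>). U \<in> Pow {1..m} - {{}} \<and> \<sigma> \<in> critical_faces K U (w U) \<and> card U = n + card \<sigma>}"

lemma finite_critical_cells [simp]: "finite (critical_cells m K w n)"
  by (rule finite_subset[of _ "Pow {1..m} \<times> Pow {1..m}"])
    (auto simp: critical_cells_def critical_faces_def)

lemma sum_card_critical_cells:
  assumes "m < N"
  shows "(\<Sum>n<N. card (critical_cells m K w n)) =
    (\<Sum>U\<in>Pow {1..m} - {{}}. card (critical_faces K U (w U)))"
proof -
  have fin: "finite U" if "U \<in> Pow {1..m}" for U using that finite_subset[of U "{1..m}"] by simp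
  have "(\<Sum>n<N. card (critical_cells m K w n)) = card (\<Union>n<N. critical_cells m K w n)"
    by (rule card_UN_disjoint[symmetric]) (simp, simp, auto simp only: critical_cells_def)
  also have "(\<Union>n<N. critical_cells m K w n) =
      Sigma (Pow {1..m} - {{}}) (\<lambda>U. critical_faces K U (w U))"
  proof (intro equalityI subsetI)
    fix x assume "x \<in> Sigma (Pow {1..m} - {{}}) (\<lambda>U. critical_faces K U (w U))"
    then obtain U \<sigma> where x: "x = (U, \<sigma>)" "U \<in> Pow {1..m} - {{}}" "\<sigma> \<in> critical_faces K U (w U)"
      by blast
    have "card \<sigma> \<le> card U"
      using x(2,3) fin by (intro card_mono) (auto simp: critical_faces_def)
    moreover have "card U \<le> m" using x(2) card_mono[of "{1..m}" U] by simp
    ultimately have "x \<in> critical_cells m K w (card U - card \<sigma>)" "card U - card \<sigma> < N"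
      using x assms by (simp_all add: critical_cells_def)
    then show "x \<in> (\<Union>n<N. critical_cells m K w n)" by blast
  qed (auto simp: critical_cells_def)
  also have "card \<dots> = (\<Sum>U\<in>Pow {1..m} - {{}}. card (critical_faces K U (w U)))"
    using fin by (intro card_SigmaI) auto
  finally show ?thesis .
qed

text \<open>Choosing an exponent that is at least 2, if there is one, leaves critical cells only in squarefree degrees.\<close>

definition squarefree_choice :: "(nat set \<Rightarrow> nat) \<Rightarrow> (nat \<Rightarrow>\<^sub>0 nat) \<Rightarrow> nat" where
  "squarefree_choice w a = (if \<exists>i. lookup a i \<ge> 2
     then SOME i. lookup a i \<ge> 2 else w (keys a))"

lemma squarefree_choice_ge_2:
  "lookup a i \<ge> 2 \<Longrightarrow> lookup a (squarefree_choice w a) \<ge> 2"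
  unfolding squarefree_choice_def by (metis (mono_tags, lifting) someI)

lemma admissible_squarefree_choice:
  assumes w: "\<And>U. U \<subseteq> {1..m} \<Longrightarrow> U \<noteq> {} \<Longrightarrow> w U \<in> U"
  shows "admissible m (squarefree_choice w)"
  unfolding admissible_def
proof (intro allI impI)
  fix a :: "nat \<Rightarrow>\<^sub>0 nat" assume a: "a \<noteq> 0" "keys a \<subseteq> {1..m}"
  show "squarefree_choice w a \<in> keys a"
  proof (cases "\<exists>i. lookup a i \<ge> 2")
    case True
    then obtain i where "lookup a i \<ge> 2" by blast
    then show ?thesis using squarefree_choice_ge_2[of a i w] by (simp add: in_keys_iff)
  next
    case False
    then show ?thesis using w[of "keys a"] a by (simp add: squarefree_choice_def)
  qed
qed

context
  fixes m :: nat and K :: "nat set set"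
  assumes K: "simplicial_complex_on m K"
begin

interpretation face: coefficient_ring "polys_on m" mconst "nonface_polys m K"
  by (rule coefficient_ring_polys) (rule subface[OF K])

abbreviation koszul_cycles :: "nat \<Rightarrow> (nat set \<Rightarrow> 'f::field mpoly) set" where
  "koszul_cycles \<equiv> face.cycles_mod (subsets_of_card m) (\<lambda>_. koszul_d m)"

abbreviation koszul_boundaries :: "nat \<Rightarrow> (nat set \<Rightarrow> 'f::field mpoly) set" where
  "koszul_boundaries \<equiv> face.boundaries_mod (subsets_of_card m) (\<lambda>_. koszul_d m)"

lemma koszul_cycle_nonface:
  assumes "z \<in> koszul_cycles n"
  shows "koszul_d m z J \<in> nonface_polys m K"
proof (cases n)
  case 0
  then have "koszul_d m z = 0" using assms by (intro koszul_d_maps_0) (simp add: face.cycles_mod_def)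
  then show ?thesis by (simp add: face.I_0)
next
  case (Suc k)
  then show ?thesis using assms by (simp add: face.cycles_mod_def)
qed

lemma nonface_polys_lookup:
  "p \<in> nonface_polys m K \<Longrightarrow> keys t \<in> K \<Longrightarrow> lookup p t = 0"
  by (auto simp: nonface_polys_def in_keys_iff)

lemma nonface_polysI:
  assumes "p \<in> polys_on m" "\<And>t. keys t \<in> K \<Longrightarrow> lookup p t = 0"
  shows "p \<in> nonface_polys m K"
  unfolding nonface_polys_def
proof (intro CollectI ballI conjI)
  fix t assume t: "t \<in> keys p"
  then show "keys t \<subseteq> {1..m}" using assms(1) unfolding polys_on_def by blast
  show "keys t \<notin> K" using t assms(2)[of t] by (auto simp: in_keys_iff)
qed

text \<open>If the coefficient of d z at t times x_u is nonzero while t is a face monomial, then the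
  support of t becomes a nonface by adding u. So u is not in that support, its total exponent is 1,
  and by the choice of u no exponent is larger.\<close>

lemma critical_remainder:
  assumes w: "\<And>U. U \<subseteq> {1..m} \<Longrightarrow> U \<noteq> {} \<Longrightarrow> w U \<in> U"
    and z: "z \<in> koszul_cycles n" and t: "keys t \<in> K"
    and nz: "lookup (z J) t \<noteq>
      lookup (koszul_d m (koszul_h (squarefree_choice w) z) J) t"
  shows "J = {} \<and> t = 0 \<and> n = 0 \<or>
    (\<exists>(U, \<sigma>)\<in>critical_cells m K w n. J = U - \<sigma> \<and> t = indicator_exp \<sigma>)"
proof -
  define v where "v = squarefree_choice w"
  define u where "u = v (t + indicator_exp J)"
  have zf: "z \<in> free_on (polys_on m) (subsets_of_card m n)" using z by (simp add: face.cycles_mod_def)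
  have v: "admissible m v" unfolding v_def by (rule admissible_squarefree_choice) (rule w)
  have JS: "J \<in> subsets_of_card m n"
  proof (rule ccontr)
    assume J: "J \<notin> subsets_of_card m n"
    have "koszul_d m (koszul_h v z) \<in> free_on (polys_on m) (subsets_of_card m n)"
      by (intro koszul_d_maps koszul_h_maps zf v)
    then have "z J = 0" "koszul_d m (koszul_h v z) J = 0" using zf J by (simp_all add: free_on_def)
    then show False using nz by (simp add: v_def)
  qed
  then have J: "J \<subseteq> {1..m}" "finite J" "card J = n"
    using finite_subset[of J "{1..m}"] by (auto simp: subsets_of_card_def)
  from koszul_remainder[OF zf v nz[folded v_def], folded u_def]
  consider "J = {}" "t = 0" | "u \<in> J" "lookup (koszul_d m z (J - {u})) (t + unit_exp u) \<noteq> 0"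
    by blast
  then show ?thesis
  proof cases
    case 1
    then show ?thesis using J by simp
  next
    case 2
    define \<sigma> where "\<sigma> = keys t"
    have "keys (t + unit_exp u) \<notin> K"
      using nonface_polys_lookup[OF koszul_cycle_nonface[OF z]] 2(2) by blast
    then have ins: "insert u \<sigma> \<notin> K" by (simp add: keys_add_exp \<sigma>_def)
    then have u\<sigma>: "u \<notin> \<sigma>" using t by (auto simp: insert_absorb \<sigma>_def)
    \<comment> \<open>An exponent of at least 2 anywhere would have made
      \<open>squarefree_choice\<close> pick such a vertex, but u occurs once in J and not in
      t.\<close>
    have le1: "lookup (t + indicator_exp J) i \<le> 1" for i
    proof (rule ccontr)
      assume "\<not> lookup (t + indicator_exp J) i \<le> 1"
      then have "lookup (t + indicator_exp J) u \<ge> 2"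
        unfolding u_def v_def by (intro squarefree_choice_ge_2[of _ i]) simp
      then show False using u\<sigma> J(2) 2(1)
        by (simp add: lookup_add lookup_indicator_exp \<sigma>_def in_keys_iff)
    qed
    have t_eq: "t = indicator_exp \<sigma>"
      unfolding \<sigma>_def
    proof (rule indicator_exp_eq)
      show "lookup t i \<le> 1" for i
        using le1[of i] by (simp add: lookup_add)
    qed
    have disj: "\<sigma> \<inter> J = {}"
    proof (rule ccontr)
      assume "\<sigma> \<inter> J \<noteq> {}"
      then obtain i where i: "i \<in> \<sigma>" "i \<in> J" by blast
      then show False using le1[of i] J(2)
        by (simp add: lookup_add lookup_indicator_exp \<sigma>_def in_keys_iff)
    qed
    define U where "U = \<sigma> \<union> J"
    have \<sigma>: "\<sigma> \<in> K" "\<sigma> \<subseteq> {1..m}" "finite \<sigma>"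
      using t face_subset[OF K] by (auto simp: \<sigma>_def)
    have "keys (t + indicator_exp J) = U"
      using J(2) by (simp add: keys_add_exp U_def \<sigma>_def)
    moreover have "\<not> (\<exists>i. lookup (t + indicator_exp J) i \<ge> 2)"
      using le1 by (metis Suc_1 not_less_eq_eq)
    ultimately have uw: "u = w U" by (simp add: u_def v_def squarefree_choice_def)
    have "\<sigma> \<subseteq> U - {w U}" unfolding uw[symmetric] using u\<sigma> by (auto simp: U_def)
    then have crit: "\<sigma> \<in> critical_faces K U (w U)"
      using \<sigma>(1) ins by (simp add: critical_faces_def uw)
    have "card U = n + card \<sigma>"
      using card_Un_disjoint[OF \<sigma>(3) J(2) disj] J(3) by (simp add: U_def)
    moreover have "U \<subseteq> {1..m}" "U \<noteq> {}" using \<sigma>(2) J(1) 2(1) by (auto simp: U_def)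
    ultimately have "(U, \<sigma>) \<in> critical_cells m K w n"
      using crit by (simp add: critical_cells_def)
    moreover have "J = U - \<sigma>" using disj by (auto simp: U_def)
    ultimately show ?thesis using t_eq by blast
  qed
qed

lemma rel_dim_koszul_le:
  assumes w: "\<And>U. U \<subseteq> {1..m} \<Longrightarrow> U \<noteq> {} \<Longrightarrow> w U \<in> U"
  shows "rel_dim mconst (koszul_cycles n :: (nat set \<Rightarrow> 'f::field mpoly) set) (koszul_boundaries n) \<le>
    enat (card (critical_cells m K w n) + (if n = 0 then 1 else 0))"
proof -
  \<comment> \<open>The coordinates that survive: one for each critical cell, and in homological
    degree 0 the constant coefficient at the empty set, which is the +1 of the bound.\<close>
  define C where "C = (\<lambda>(U, \<sigma>). (U - \<sigma>, indicator_exp \<sigma>)) ` critical_cells m K w n \<union>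
    (if n = 0 then {({}, 0)} else {})"
  define Q where "Q = {y \<in> free_on (polys_on m :: 'f mpoly set) (subsets_of_card m n).
    \<forall>J t. keys t \<in> K \<longrightarrow> (J, t) \<notin> C \<longrightarrow> lookup (y J) t = 0}"
  define v where "v = squarefree_choice w"
  have v: "admissible m v" unfolding v_def by (rule admissible_squarefree_choice) (rule w)
  have finC: "finite C" by (simp add: C_def)
  have add: "koszul_d m (x + y) = koszul_d m x + koszul_d m y"
    and sm: "koszul_d m (smul c x) = smul c (koszul_d m x)" for x y :: "nat set \<Rightarrow> 'f mpoly" and c
    using linear_over_add[OF linear_over_koszul_d] linear_over_smul[OF linear_over_koszul_d] by auto
  have "rel_dim mconst (koszul_cycles n :: (nat set \<Rightarrow> 'f mpoly) set) (koszul_boundaries n) \<le> enat (card C)"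
  proof (rule rel_dim_le_card[where L = "\<lambda>(J, t) x. lookup (x J) t" and Q = Q])
    show "finite C" by (rule finC)
    show "(case q of (J, t) \<Rightarrow> \<lambda>x. lookup (x J) t) (x + y) =
        (case q of (J, t) \<Rightarrow> \<lambda>x. lookup (x J) t) x +
        (case q of (J, t) \<Rightarrow> \<lambda>x. lookup (x J) t) y" for q and x y :: "nat set \<Rightarrow> 'f mpoly"
      by (simp add: case_prod_unfold lookup_add)
    show "(case q of (J, t) \<Rightarrow> \<lambda>x. lookup (x J) t) (smul (mconst c) x) =
        c * (case q of (J, t) \<Rightarrow> \<lambda>x. lookup (x J) t) x" for q c and x :: "nat set \<Rightarrow> 'f mpoly"
      by (simp add: case_prod_unfold smul_def lookup_mconst_mult)
    show "0 \<in> Q" by (simp add: Q_def face.free_on_0)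
    show "x + y \<in> Q" if "x \<in> Q" "y \<in> Q" for x y
      using that by (simp add: Q_def face.free_on_add lookup_add)
    show "smul (mconst c) x \<in> Q" if "x \<in> Q" for c x
      using that by (simp add: Q_def face.free_on_smul face.P_scalar)
        (simp add: smul_def lookup_mconst_mult)
    show "0 \<in> koszul_boundaries n"
      unfolding face.boundaries_mod_def using face.I_0
      by (intro CollectI conjI bexI[of _ 0] face.free_on_0)
        (simp add: linear_over_0[OF linear_over_koszul_d])
    show "x + y \<in> koszul_boundaries n" if xy: "x \<in> koszul_boundaries n" "y \<in> koszul_boundaries n"
      for x y :: "nat set \<Rightarrow> 'f mpoly"
    proof -
      obtain a b where ab: "a \<in> free_on (polys_on m) (subsets_of_card m (Suc n))"
        "b \<in> free_on (polys_on m) (subsets_of_card m (Suc n))"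
        "\<And>i. x i - koszul_d m a i \<in> nonface_polys m K" "\<And>i. y i - koszul_d m b i \<in> nonface_polys m K"
        using xy by (auto simp: face.boundaries_mod_def)
      have "(x + y) i - koszul_d m (a + b) i \<in> nonface_polys m K" for i
        using face.I_add[OF ab(3)[of i] ab(4)[of i]] by (simp add: add algebra_simps)
      then show ?thesis
        using xy face.free_on_add[OF ab(1,2)] face.free_on_add unfolding face.boundaries_mod_def by blast
    qed
    show "smul (mconst c) x \<in> koszul_boundaries n" if x: "x \<in> koszul_boundaries n"
      for c and x :: "nat set \<Rightarrow> 'f mpoly"
    proof -
      obtain a where a: "a \<in> free_on (polys_on m) (subsets_of_card m (Suc n))"
        "\<And>i. x i - koszul_d m a i \<in> nonface_polys m K"
        using x by (auto simp: face.boundaries_mod_def)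
      have "smul (mconst c) x i - koszul_d m (smul (mconst c) a) i \<in> nonface_polys m K" for i
        using face.I_mult[OF face.P_scalar[of c] a(2)[of i]] unfolding sm by (simp add: smul_def right_diff_distrib)
      then show ?thesis
        using x face.free_on_smul[OF face.P_scalar a(1)] face.free_on_smul[OF face.P_scalar]
        unfolding face.boundaries_mod_def by blast
    qed
    \<comment> \<open>The remainder z - d h z represents the class of z and, among face monomials,
      is supported on C.\<close>
    show "\<exists>y\<in>Q. z - y \<in> koszul_boundaries n" if z: "z \<in> koszul_cycles n" for z :: "nat set \<Rightarrow> 'f mpoly"
    proof
      have zf: "z \<in> free_on (polys_on m) (subsets_of_card m n)" using z by (simp add: face.cycles_mod_def)
      have h: "koszul_h v z \<in> free_on (polys_on m) (subsets_of_card m (Suc n))"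
        by (rule koszul_h_maps[OF zf v])
      have dh: "koszul_d m (koszul_h v z) \<in> free_on (polys_on m) (subsets_of_card m n)"
        by (rule koszul_d_maps[OF h])
      have eq: "z - (z - koszul_d m (koszul_h v z)) = koszul_d m (koszul_h v z)"
        by (rule ext) simp
      show "z - (z - koszul_d m (koszul_h v z)) \<in> koszul_boundaries n"
        unfolding eq face.boundaries_mod_def using dh h face.I_0
        by (intro CollectI conjI bexI[of _ "koszul_h v z"]) simp_all
      have "lookup ((z - koszul_d m (koszul_h v z)) J) t = 0"
        if t: "keys t \<in> K" "(J, t) \<notin> C" for J t
      proof (rule ccontr)
        assume "\<not> ?thesis"
        then have "lookup (z J) t \<noteq>
          lookup (koszul_d m (koszul_h (squarefree_choice w) z) J) t"
          by (simp add: lookup_minus v_def)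
        from critical_remainder[OF w z t(1) this] have "(J, t) \<in> C"
          unfolding C_def by (auto intro!: rev_image_eqI)
        then show False using t(2) by simp
      qed
      then show "z - koszul_d m (koszul_h v z) \<in> Q"
        using face.free_on_diff[OF zf dh] unfolding Q_def by blast
    qed
    show "y \<in> koszul_boundaries n"
      if y: "y \<in> Q" and q: "\<And>q. q \<in> C \<Longrightarrow> (case q of (J, t) \<Rightarrow> \<lambda>x. lookup (x J) t) y = 0" for y
    proof -
      have yf: "y \<in> free_on (polys_on m) (subsets_of_card m n)" using y by (simp add: Q_def)
      have "y J \<in> nonface_polys m K" for J
      proof (rule nonface_polysI)
        show "y J \<in> polys_on m" using yf by (simp add: free_on_def)
        show "lookup (y J) t = 0" if "keys t \<in> K" for t
          using that y q[of "(J, t)"] by (cases "(J, t) \<in> C") (simp_all add: Q_def)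
      qed
      then show ?thesis
        unfolding face.boundaries_mod_def using yf
        by (intro CollectI conjI bexI[of _ 0] face.free_on_0)
          (simp_all add: linear_over_0[OF linear_over_koszul_d])
    qed
  qed
  also have "card C \<le> card (critical_cells m K w n) + (if n = 0 then 1 else 0)"
    unfolding C_def using card_image_le[OF finite_critical_cells[of m K w n]]
    by (intro card_Un_le[THEN order_trans] add_mono) auto
  finally show ?thesis by simp
qed

section \<open>Skeleta: independence of the critical cells\<close>

context
  fixes d :: nat
  assumes skeleton: "\<And>\<sigma>. \<sigma> \<in> K \<longleftrightarrow> \<sigma> \<subseteq> {1..m} \<and> card \<sigma> \<le> d"
begin

lemma critical_face_skeleton:
  assumes "\<sigma> \<in> critical_faces K U u" "U \<subseteq> {1..m}" "u \<in> U"
  shows "card \<sigma> = d"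
proof -
  have \<sigma>: "u \<notin> \<sigma>" "\<sigma> \<subseteq> U" "\<sigma> \<in> K" "insert u \<sigma> \<notin> K" using assms(1) by (auto simp: critical_faces_def)
  have "finite \<sigma>" using \<sigma>(2) assms(2) finite_subset[of \<sigma> "{1..m}"] by auto
  then have "card (insert u \<sigma>) = Suc (card \<sigma>)" using \<sigma>(1) by simp
  moreover have "insert u \<sigma> \<subseteq> {1..m}" using \<sigma>(2) assms(2,3) by blast
  ultimately show ?thesis using \<sigma>(3,4) unfolding skeleton by simp
qed

text \<open>The monomial of \<sigma> times the exterior basis element of U - \<sigma>. In a
  squarefree degree U the Koszul differential moves a vertex into \<sigma>, so modulo nonfaces that
  strand is the augmented cochain complex of K restricted to U; hence the name.\<close>

definition cell_cochain :: "nat set \<times> nat set \<Rightarrow> nat set \<Rightarrow> 'f::field mpoly" where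
  "cell_cochain = (\<lambda>(U, \<sigma>) J. if J = U - \<sigma> then single (indicator_exp \<sigma>) 1 else 0)"

lemma lookup_cell_cochain:
  "lookup (cell_cochain (U, \<sigma>) J) t =
    (if J = U - \<sigma> \<and> t = indicator_exp \<sigma> then 1 else 0)"
  by (auto simp: cell_cochain_def lookup_single)

lemma critical_cellD:
  assumes "(U, \<sigma>) \<in> critical_cells m K w n" "w U \<in> U"
  shows "U \<subseteq> {1..m}" "finite U" "\<sigma> \<subseteq> U" "w U \<notin> \<sigma>" "finite \<sigma>" "card \<sigma> = d" "card U = n + d"
proof -
  have U: "U \<subseteq> {1..m}" "\<sigma> \<in> critical_faces K U (w U)" "card U = n + card \<sigma>"
    using assms(1) by (auto simp: critical_cells_def)
  show "U \<subseteq> {1..m}" by fact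
  show "finite U" using U(1) finite_subset by blast
  show "\<sigma> \<subseteq> U" "w U \<notin> \<sigma>" using U(2) by (auto simp: critical_faces_def)
  then show "finite \<sigma>" using \<open>finite U\<close> finite_subset by blast
  show "card \<sigma> = d" by (rule critical_face_skeleton[OF U(2,1) assms(2)])
  then show "card U = n + d" using U(3) by simp
qed

text \<open>Here \<sigma> already has d elements, so moving any further vertex into it produces a
  nonface.\<close>

lemma cell_cochain_cycle:
  assumes cell: "(U, \<sigma>) \<in> critical_cells m K w n" "w U \<in> U"
  shows "(cell_cochain (U, \<sigma>) :: nat set \<Rightarrow> 'f::field mpoly) \<in> koszul_cycles n"
proof -
  define x :: "nat set \<Rightarrow> 'f mpoly" where "x = cell_cochain (U, \<sigma>)"
  note c = critical_cellD[OF cell]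
  have "card (U - \<sigma>) = n" using c by (simp add: card_Diff_subset)
  then have "x \<in> free_on (polys_on m) (subsets_of_card m n)"
    using c(1,3,5) by (auto simp: x_def free_on_def cell_cochain_def polys_on_def subsets_of_card_def)
  moreover have "koszul_d m x J \<in> nonface_polys m K" for J
    unfolding nonface_polys_def
  proof (intro CollectI ballI)
    fix t assume "t \<in> keys (koszul_d m x J)"
    then have "lookup (koszul_d m x J) t \<noteq> 0" by (simp add: in_keys_iff)
    then obtain i where i: "i \<in> {i. i \<in> {1..m} - J \<and> lookup t i \<noteq> 0}"
      "koszul_sign i J * lookup (x (insert i J)) (t - unit_exp i) \<noteq> 0"
      unfolding lookup_koszul_d by (rule sum.not_neutral_contains_not_neutral)
    then have "lookup (x (insert i J)) (t - unit_exp i) \<noteq> 0" by auto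
    then have eq: "insert i J = U - \<sigma>" "t - unit_exp i = indicator_exp \<sigma>"
      unfolding x_def lookup_cell_cochain by presburger+
    have "t = indicator_exp \<sigma> + unit_exp i" using diff_unit_exp_add[of t i] i(1) unfolding eq(2) by simp
    then have keys: "keys t = insert i \<sigma>" using c(5) by (simp add: keys_add_exp)
    have "i \<in> U" "i \<notin> \<sigma>" using eq(1) by blast+
    then show "keys t \<subseteq> {1..m} \<and> keys t \<notin> K"
      using c(1,3,5,6) unfolding keys skeleton by auto
  qed
  ultimately show ?thesis by (simp add: face.cycles_mod_def x_def)
qed

text \<open>Pairing with the boundary of the simplex \<sigma> \<union> {v}, where v = w U. It is a
  cycle of K because every facet has d elements, so boundaries pair to zero with it. Critical faces
  for U avoid v, and \<sigma> is the only facet doing so; the pairing therefore isolates the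
  coefficient of (U, \<sigma>).\<close>

lemma cell_cochains_independent:
  assumes w: "\<And>U. U \<subseteq> {1..m} \<Longrightarrow> U \<noteq> {} \<Longrightarrow> w U \<in> U"
    and bd: "(\<Sum>q\<in>critical_cells m K w n. smul (mconst (l q)) (cell_cochain q)) \<in> koszul_boundaries n"
    and cell: "(U, \<sigma>) \<in> critical_cells m K w n"
  shows "l (U, \<sigma>) = (0 :: 'f::field)"
proof -
  let ?C = "critical_cells m K w n"
  have wU: "w U' \<in> U'" if "(U', \<sigma>') \<in> ?C" for U' \<sigma>'
    using that w[of U'] by (auto simp: critical_cells_def)
  note c = critical_cellD[OF cell wU[OF cell]]
  define y where "y = (\<Sum>q\<in>?C. smul (mconst (l q)) (cell_cochain q))"
  obtain a where a: "\<And>i. y i - koszul_d m a i \<in> nonface_polys m K"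
    using bd by (auto simp: face.boundaries_mod_def y_def)
  define u where "u = y - koszul_d m a"
  have u: "u i \<in> nonface_polys m K" for i using a by (simp add: u_def)
  \<comment> \<open>This holds over the polynomial ring, not just modulo nonfaces, so the
    coefficient at the nonface monomial t below may be compared.\<close>
  have du: "koszul_d m u = koszul_d m y"
    by (simp add: u_def linear_over_diff[OF linear_over_koszul_d])
  have ly: "lookup (y J) t = (\<Sum>q\<in>?C. l q * lookup (cell_cochain q J) t)" for J t
    by (simp add: y_def sum_fun_apply lookup_sum smul_def lookup_mconst_mult)
  define v where "v = w U"
  define J where "J = U - insert v \<sigma>"
  \<comment> \<open>The coefficient of the differential at J and t is the signed sum over the facets
    of \<sigma> \<union> {v}, that is, the pairing with the boundary of this simplex.\<close>
  define t where "t = indicator_exp (insert v \<sigma>)"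
  have v: "v \<in> U" "v \<notin> \<sigma>" using wU[OF cell] c(4) by (auto simp: v_def)
  have T: "{i. i \<in> {1..m} - J \<and> lookup t i \<noteq> 0} = insert v \<sigma>"
    using c v by (auto simp: t_def J_def lookup_indicator_exp)
  have tdiff: "t - unit_exp i = indicator_exp (insert v \<sigma> - {i})" if "i \<in> insert v \<sigma>" for i
    using that c(5) by (intro poly_mapping_eqI) (auto simp: t_def lookup_minus lookup_single lookup_indicator_exp when_def)
  have u0: "lookup (koszul_d m u J) t = 0"
    unfolding lookup_koszul_d T
  proof (rule sum.neutral, rule ballI)
    fix i assume i: "i \<in> insert v \<sigma>"
    have "card (insert v \<sigma> - {i}) = d" using i v(2) c(5,6) by (simp add: card_Diff_singleton)
    moreover have "insert v \<sigma> - {i} \<subseteq> {1..m}" using v c(1,3) by blast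
    ultimately have "keys (t - unit_exp i) \<in> K"
      using c(5) unfolding tdiff[OF i] skeleton by simp
    then show "koszul_sign i J * lookup (u (insert i J)) (t - unit_exp i) = 0"
      using nonface_polys_lookup[OF u] by simp
  qed
  have y0: "lookup (y (insert i J)) (t - unit_exp i) = (if i = v then l (U, \<sigma>) else 0)"
    if i: "i \<in> insert v \<sigma>" for i
  proof -
    have iff: "insert i J = U' - \<sigma>' \<and> t - unit_exp i = indicator_exp \<sigma>' \<longleftrightarrow> i = v \<and> U' = U \<and> \<sigma>' = \<sigma>"
      if q: "(U', \<sigma>') \<in> ?C" for U' \<sigma>'
    proof
      assume "i = v \<and> U' = U \<and> \<sigma>' = \<sigma>"
      moreover have "insert v J = U - \<sigma>" using v unfolding J_def by blast
      moreover have "t - unit_exp v = indicator_exp \<sigma>" using tdiff[of v] v(2) by simp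
      ultimately show "insert i J = U' - \<sigma>' \<and> t - unit_exp i = indicator_exp \<sigma>'" by simp
    next
      assume A: "insert i J = U' - \<sigma>' \<and> t - unit_exp i = indicator_exp \<sigma>'"
      note c' = critical_cellD[OF q wU[OF q]]
      have "indicator_exp \<sigma>' = indicator_exp (insert v \<sigma> - {i})" using A tdiff[OF i] by argo
      then have "keys (indicator_exp \<sigma>') = keys (indicator_exp (insert v \<sigma> - {i}))"
        by (rule arg_cong)
      then have \<sigma>': "\<sigma>' = insert v \<sigma> - {i}" using c(5) c'(5) by simp
      have "U' = (U' - \<sigma>') \<union> \<sigma>'" using c'(3) by blast
      also have "\<dots> = insert i J \<union> \<sigma>'" using A by argo
      also have "\<dots> = U" using i v c(3) unfolding \<sigma>' J_def by blast
      finally have "U' = U" .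
      then have "v \<notin> \<sigma>'" using c'(4) by (simp add: v_def)
      then have "i = v" using i unfolding \<sigma>' by blast
      moreover have "\<sigma>' = \<sigma>" unfolding \<sigma>' \<open>i = v\<close> using v(2) by blast
      ultimately show "i = v \<and> U' = U \<and> \<sigma>' = \<sigma>" using \<open>U' = U\<close> by blast
    qed
    have "l q * lookup (cell_cochain q (insert i J)) (t - unit_exp i) =
        (if q = (U, \<sigma>) then (if i = v then l (U, \<sigma>) else 0) else 0)" if "q \<in> ?C" for q
    proof -
      obtain U' \<sigma>' where q: "q = (U', \<sigma>')" by (cases q)
      show ?thesis unfolding q lookup_cell_cochain iff[OF that[unfolded q]] by auto
    qed
    then show ?thesis unfolding ly using cell by (simp add: sum.delta)
  qed
  have "lookup (koszul_d m y J) t =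
      (\<Sum>i\<in>insert v \<sigma>. if i = v then koszul_sign v J * l (U, \<sigma>) else 0)"
    unfolding lookup_koszul_d T using y0 by (intro sum.cong) auto
  also have "\<dots> = koszul_sign v J * l (U, \<sigma>)" using c(5) by (subst sum.delta) auto
  finally have "koszul_sign v J * l (U, \<sigma>) = 0" using u0 du by simp
  then have "koszul_sign v J * (koszul_sign v J * l (U, \<sigma>)) = koszul_sign v J * 0" by (rule arg_cong)
  then show ?thesis unfolding koszul_sign_sq_left mult_zero_right .
qed

lemma rel_dim_koszul_ge:
  assumes w: "\<And>U. U \<subseteq> {1..m} \<Longrightarrow> U \<noteq> {} \<Longrightarrow> w U \<in> U"
  shows "enat (card (critical_cells m K w n) + (if n = 0 then 1 else 0)) \<le>
    rel_dim mconst (koszul_cycles n :: (nat set \<Rightarrow> 'f::field mpoly) set) (koszul_boundaries n)"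
proof (cases "n = 0")
  case False
  have "enat (card (critical_cells m K w n)) \<le>
      rel_dim mconst (koszul_cycles n :: (nat set \<Rightarrow> 'f mpoly) set) (koszul_boundaries n)"
  proof (rule card_le_rel_dim[where x = cell_cochain])
    show "cell_cochain q \<in> koszul_cycles n" if "q \<in> critical_cells m K w n" for q
    proof -
      obtain U \<sigma> where q: "q = (U, \<sigma>)" by (cases q)
      then have "w U \<in> U" using that w[of U] by (auto simp: critical_cells_def)
      then show ?thesis using cell_cochain_cycle that q by simp
    qed
    show "l q = 0"
      if "(\<Sum>q\<in>critical_cells m K w n. smul (mconst (l q)) (cell_cochain q)) \<in> koszul_boundaries n"
        "q \<in> critical_cells m K w n" for l :: "_ \<Rightarrow> 'f" and q
      using cell_cochains_independent[OF w that(1)] that(2) by (cases q) simp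
  qed simp
  then show ?thesis using False by simp
next
  case True
  \<comment> \<open>In degree 0 a cell would have \<sigma> = U, which contains w U. Only the class
    of the constant 1 is left.\<close>
  have "critical_cells m K w n = {}"
  proof (intro equals0I)
    fix q assume q: "q \<in> critical_cells m K w n"
    obtain U \<sigma> where q': "q = (U, \<sigma>)" by (cases q)
    then have wU: "w U \<in> U" using q w[of U] by (auto simp: critical_cells_def)
    note c = critical_cellD[OF q[unfolded q'] wU]
    have "\<sigma> = U" using c(2,3,6,7) True card_subset_eq[of U \<sigma>] by simp
    then show False using c(4) wU by simp
  qed
  moreover have "enat (card {()}) \<le> rel_dim mconst (koszul_cycles n :: (nat set \<Rightarrow> 'f mpoly) set) (koszul_boundaries n)"
  proof (rule card_le_rel_dim[where x = "\<lambda>_. cell_cochain ({}, {})"])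
    show "cell_cochain ({}, {}) \<in> koszul_cycles n"
    proof -
      have "cell_cochain ({}, {}) \<in> free_on (polys_on m) (subsets_of_card m 0)"
        by (auto simp: free_on_def cell_cochain_def polys_on_def subsets_of_card_def)
      then show ?thesis using True by (simp add: face.cycles_mod_def)
    qed
    show "l q = 0" if bd: "(\<Sum>q\<in>{()}. smul (mconst (l q)) (cell_cochain ({}, {}))) \<in> koszul_boundaries n"
      for l :: "unit \<Rightarrow> 'f" and q
    proof -
      obtain a where a: "smul (mconst (l q)) (cell_cochain ({}, {})) {} - koszul_d m a {} \<in> nonface_polys m K"
        using bd by (auto simp: face.boundaries_mod_def)
      \<comment> \<open>Constant coefficients at the empty set are compared: every value of the
        differential vanishes there, and so does the ideal, since the support of the monomial 1 is a
        face.\<close>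
      have "lookup (smul (mconst (l q)) (cell_cochain ({}, {})) {} - koszul_d m a {}) 0 = 0"
        using empty_face[OF K] by (intro nonface_polys_lookup[OF a]) simp
      then show ?thesis
        by (simp add: lookup_minus lookup_koszul_d_0 smul_def lookup_mconst_mult lookup_cell_cochain
            indicator_exp_def)
    qed
  qed simp
  ultimately show ?thesis using True by simp
qed

end

end

section \<open>From quotient modules to representatives\<close>

text \<open>Presents a record structure V as the image of a subgroup Z of a type-class group, so
  that computations in V become computations on representatives. It is applied in layers:
  polynomials, cosets modulo the ideal, tuples of cosets, homology classes.\<close>

locale additive_image =
  fixes V :: "('a, 'z) ring_scheme" (structure) and f :: "'v::ab_group_add \<Rightarrow> 'a" and Z :: "'v set"
  assumes carrier: "carrier V = f ` Z"
    and zero: "\<zero>\<^bsub>V\<^esub> = f 0"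
    and add: "\<And>x y. x \<in> Z \<Longrightarrow> y \<in> Z \<Longrightarrow> f x \<oplus>\<^bsub>V\<^esub> f y = f (x + y)"
    and Z_0: "0 \<in> Z"
    and Z_add: "\<And>x y. x \<in> Z \<Longrightarrow> y \<in> Z \<Longrightarrow> x + y \<in> Z"
    and Z_uminus: "\<And>x. x \<in> Z \<Longrightarrow> - x \<in> Z"
begin

lemma Z_sum: "(\<And>i. i \<in> F \<Longrightarrow> g i \<in> Z) \<Longrightarrow> sum g F \<in> Z"
  by (induction F rule: infinite_finite_induct) (auto simp: Z_0 Z_add)

lemma Z_diff: "x \<in> Z \<Longrightarrow> y \<in> Z \<Longrightarrow> x - y \<in> Z"
  using Z_add[of x "- y"] Z_uminus[of y] by simp

lemma abelian_group: "abelian_group V"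
proof (rule abelian_groupI)
  show "\<exists>y\<in>carrier V. y \<oplus>\<^bsub>V\<^esub> x = \<zero>\<^bsub>V\<^esub>" if x: "x \<in> carrier V" for x
  proof -
    obtain z where z: "z \<in> Z" "x = f z" using x by (auto simp: carrier)
    then have "f (- z) \<oplus>\<^bsub>V\<^esub> x = \<zero>\<^bsub>V\<^esub>" by (simp add: add Z_uminus zero)
    then show ?thesis using z(1) Z_uminus by (auto simp: carrier)
  qed
qed (auto simp: carrier zero add Z_0 Z_add add_ac)

lemma finsum_eq:
  assumes "finite F" "\<And>i. i \<in> F \<Longrightarrow> g i \<in> Z" "\<And>i. i \<in> F \<Longrightarrow> h i = f (g i)"
  shows "finsum V h F = f (\<Sum>i\<in>F. g i)"
proof -
  interpret abelian_group V by (rule abelian_group)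
  show ?thesis
    using assms
  proof (induction F)
    case (insert i F)
    have "h \<in> F \<rightarrow> carrier V" "h i \<in> carrier V" using insert.prems by (auto simp: carrier)
    then have "finsum V h (insert i F) = h i \<oplus>\<^bsub>V\<^esub> finsum V h F"
      using insert.hyps by (intro finsum_insert)
    also have "finsum V h F = f (\<Sum>i\<in>F. g i)" using insert by simp
    also have "h i \<oplus>\<^bsub>V\<^esub> f (\<Sum>i\<in>F. g i) = f (g i + (\<Sum>i\<in>F. g i))"
      using insert.prems by (simp add: add Z_sum)
    finally show ?case using insert.hyps by simp
  qed (simp add: zero)
qed

lemma eq_iff:
  assumes "x \<in> Z" "y \<in> Z"
  shows "f x = f y \<longleftrightarrow> f (x - y) = \<zero>\<^bsub>V\<^esub>"
proof -
  interpret abelian_group V by (rule abelian_group)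
  have in_carrier: "f (x - y) \<in> carrier V" "f y \<in> carrier V" using assms Z_diff by (auto simp: carrier)
  have "f x = f (x - y) \<oplus>\<^bsub>V\<^esub> f y" using assms by (simp add: add Z_diff)
  then show ?thesis using in_carrier by (auto simp: add.r_cancel_one' add.r_cancel_one)
qed

context
  fixes B :: "'v set"
  assumes subset: "B \<subseteq> Z"
    and closed: "0 \<in> B \<and> (\<forall>x\<in>B. \<forall>y\<in>B. x + y \<in> B) \<and> (\<forall>x\<in>B. - x \<in> B)"
begin

lemma closure_facts: "B \<subseteq> Z" "0 \<in> B" "\<And>x y. x \<in> B \<Longrightarrow> y \<in> B \<Longrightarrow> x + y \<in> B" "\<And>x. x \<in> B \<Longrightarrow> - x \<in> B"
  using subset closed by auto

lemma coset_eq: "x \<in> Z \<Longrightarrow> f ` B +>\<^bsub>V\<^esub> f x = (\<lambda>b. f (b + x)) ` B"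
  using closure_facts(1) by (auto simp: a_r_coset_def' add subset_iff intro!: image_eqI)

lemma coset_shift:
  assumes "x \<in> Z" "b \<in> B"
  shows "f ` B +>\<^bsub>V\<^esub> f (b + x) = f ` B +>\<^bsub>V\<^esub> f x"
proof -
  have bx: "b + x \<in> Z" using assms closure_facts(1) Z_add by blast
  have "(\<lambda>c. f (c + (b + x))) ` B = (\<lambda>c. f (c + x)) ` B"
  proof (intro equalityI image_subsetI)
    fix c assume "c \<in> B"
    then show "f (c + (b + x)) \<in> (\<lambda>c. f (c + x)) ` B"
      using assms(2) closure_facts(3) by (intro image_eqI[of _ _ "c + b"]) (auto simp: add.assoc)
    show "f (c + x) \<in> (\<lambda>c. f (c + (b + x))) ` B"
      using closure_facts(3)[OF \<open>c \<in> B\<close> closure_facts(4)[OF assms(2)]] by (intro image_eqI[of _ _ "c + - b"]) (auto simp: algebra_simps)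
  qed
  then show ?thesis using assms(1) bx by (simp add: coset_eq)
qed

lemma coset_0: "f ` B +>\<^bsub>V\<^esub> f 0 = f ` B"
  by (simp add: coset_eq Z_0)

lemma coset_add:
  assumes "x \<in> Z" "y \<in> Z"
  shows "set_add V (f ` B +>\<^bsub>V\<^esub> f x) (f ` B +>\<^bsub>V\<^esub> f y) = f ` B +>\<^bsub>V\<^esub> f (x + y)"
proof -
  have BZ: "b \<in> B \<Longrightarrow> b \<in> Z" for b using closure_facts(1) by blast
  have "set_add V (f ` B +>\<^bsub>V\<^esub> f x) (f ` B +>\<^bsub>V\<^esub> f y) = (\<Union>b\<in>B. \<Union>c\<in>B. {f ((b + c) + (x + y))})"
    using assms by (auto simp: set_add_def' coset_eq add BZ Z_add add_ac)
  also have "\<dots> = (\<lambda>b. f (b + (x + y))) ` B"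
  proof (intro equalityI subsetI)
    fix u assume "u \<in> (\<Union>b\<in>B. \<Union>c\<in>B. {f ((b + c) + (x + y))})"
    then show "u \<in> (\<lambda>b. f (b + (x + y))) ` B" using closure_facts(3) by blast
  next
    fix u assume "u \<in> (\<lambda>b. f (b + (x + y))) ` B"
    then obtain b where "b \<in> B" "u = f ((b + 0) + (x + y))" by auto
    then show "u \<in> (\<Union>b\<in>B. \<Union>c\<in>B. {f ((b + c) + (x + y))})" using closure_facts(2) by blast
  qed
  finally show ?thesis using assms by (simp add: coset_eq Z_add)
qed

text \<open>As f may identify elements of Z, f x in the image of B does not by itself put x in B;
  the assumption \<open>sat\<close> says that B is a union of fibres.\<close>

lemma coset_eq_self_iff:
  assumes "x \<in> Z" and sat: "\<forall>x\<in>B. \<forall>y\<in>Z. f x = f y \<longrightarrow> y \<in> B"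
  shows "f ` B +>\<^bsub>V\<^esub> f x = f ` B \<longleftrightarrow> x \<in> B"
proof
  assume "f ` B +>\<^bsub>V\<^esub> f x = f ` B"
  then have "f (0 + x) \<in> f ` B" using closure_facts(2) assms(1) coset_eq by blast
  then show "x \<in> B" using sat assms(1) by (metis add_0 imageE)
next
  assume "x \<in> B"
  then show "f ` B +>\<^bsub>V\<^esub> f x = f ` B" using coset_shift[OF Z_0, of x] coset_0 by simp
qed

lemma a_rcosets_eq: "a_rcosets\<^bsub>V\<^esub> (f ` B) = (\<lambda>x. f ` B +>\<^bsub>V\<^esub> f x) ` Z"
  by (auto simp: A_RCOSETS_def' carrier)

end

end

text \<open>\<open>dim_over\<close> speaks of independent sets in V, \<open>rel_dim\<close> of
  independent families of representatives. One direction chooses representatives; the other must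
  check that an independent family yields distinct elements of V.\<close>

theorem dim_over_eq_rel_dim:
  fixes V :: "('r::comm_ring_1, 'a) module" and \<kappa> :: "'k::field \<Rightarrow> 'r" and f :: "('i \<Rightarrow> 'r) \<Rightarrow> 'a"
  assumes "additive_image V f Z"
    and smult: "\<And>c x. x \<in> Z \<Longrightarrow> smul (\<kappa> c) x \<in> Z" "\<And>c x. x \<in> Z \<Longrightarrow> \<kappa> c \<odot>\<^bsub>V\<^esub> f x = f (smul (\<kappa> c) x)"
    and zero_iff: "\<And>x. x \<in> Z \<Longrightarrow> f x = \<zero>\<^bsub>V\<^esub> \<longleftrightarrow> x \<in> B"
    and \<kappa>: "\<kappa> 0 = 0" "\<kappa> 1 = 1" "\<kappa> (-1) = -1"
  shows "dim_over \<kappa> V = rel_dim \<kappa> Z B"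
proof -
  interpret V: additive_image V f Z by fact
  have comb: "(\<Oplus>\<^bsub>V\<^esub>i\<in>F. \<kappa> (c i) \<odot>\<^bsub>V\<^esub> f (x i)) = f (\<Sum>i\<in>F. smul (\<kappa> (c i)) (x i))"
    "(\<Sum>i\<in>F. smul (\<kappa> (c i)) (x i)) \<in> Z"
    if "finite F" "\<And>i. i \<in> F \<Longrightarrow> x i \<in> Z" for F c and x :: "'j \<Rightarrow> 'i \<Rightarrow> 'r"
    using that smult by (auto intro!: V.finsum_eq V.Z_sum)
  show ?thesis
  proof (rule antisym)
    show "dim_over \<kappa> V \<le> rel_dim \<kappa> Z B"
      unfolding dim_over_def
    proof (rule SUP_least)
      fix E assume "E \<in> {E. finite E \<and> E \<subseteq> carrier V \<and> lin_indep_over \<kappa> V E}"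
      then have E: "finite E" "E \<subseteq> carrier V" "lin_indep_over \<kappa> V E" by auto
      have "\<forall>e\<in>E. \<exists>x. x \<in> Z \<and> e = f x" using E(2) by (auto simp: V.carrier)
      from bchoice[OF this] obtain x where x: "\<And>e. e \<in> E \<Longrightarrow> x e \<in> Z" "\<And>e. e \<in> E \<Longrightarrow> e = f (x e)" by blast
      show "enat (card E) \<le> rel_dim \<kappa> Z B"
      proof (rule card_le_rel_dim[where x = x])
        fix l e assume sum: "(\<Sum>e\<in>E. smul (\<kappa> (l e)) (x e)) \<in> B" and e: "e \<in> E"
        have "(\<Oplus>\<^bsub>V\<^esub>e\<in>E. \<kappa> (l e) \<odot>\<^bsub>V\<^esub> e) = f (\<Sum>e\<in>E. smul (\<kappa> (l e)) (x e))"
        proof (rule V.finsum_eq)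
          show "\<kappa> (l e) \<odot>\<^bsub>V\<^esub> e = f (smul (\<kappa> (l e)) (x e))" if "e \<in> E" for e
            using smult(2)[OF x(1)[OF that], of "l e"] by (simp flip: x(2)[OF that])
        qed (use E(1) x(1) smult(1) in auto)
        also have "\<dots> = \<zero>\<^bsub>V\<^esub>" using sum zero_iff[OF comb(2)[OF E(1) x(1)]] by simp
        finally show "l e = 0" using E(3) e unfolding lin_indep_over_def by blast
      qed (use E x in auto)
    qed
    show "rel_dim \<kappa> Z B \<le> dim_over \<kappa> V"
      unfolding rel_dim_def
    proof (rule SUP_least)
      fix n :: nat
      assume "n \<in> {n. \<exists>x. (\<forall>i<n. x i \<in> Z) \<and>
        (\<forall>c. (\<Sum>i<n. smul (\<kappa> (c i)) (x i)) \<in> B \<longrightarrow> (\<forall>i<n. c i = 0))}"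
      then obtain x where x: "\<And>i. i < n \<Longrightarrow> x i \<in> Z"
        and indep: "\<And>c i. (\<Sum>i<n. smul (\<kappa> (c i)) (x i)) \<in> B \<Longrightarrow> i < n \<Longrightarrow> c i = 0"
        by blast
      have inj: "inj_on (\<lambda>i. f (x i)) {..<n}"
      proof (rule inj_onI, rule ccontr)
        fix i j assume ij: "i \<in> {..<n}" "j \<in> {..<n}" "f (x i) = f (x j)" "i \<noteq> j"
        \<comment> \<open>Two indices with equal image would give the nontrivial relation x i - x j
          in B.\<close>
        define c :: "nat \<Rightarrow> 'k" where "c k = (if k = i then 1 else if k = j then -1 else 0)" for k
        have "(\<Sum>k<n. smul (\<kappa> (c k)) (x k)) = (\<Sum>k\<in>{i, j}. smul (\<kappa> (c k)) (x k))"
          using ij by (intro sum.mono_neutral_right) (auto simp: c_def \<kappa> smul_def)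
        also have "\<dots> = x i - x j"
          using ij(4) by (auto simp: c_def \<kappa> smul_def fun_eq_iff)
        also have "x i - x j \<in> B"
          using V.eq_iff[of "x i" "x j"] V.Z_diff[of "x i" "x j"] zero_iff[of "x i - x j"] x ij by simp
        finally have "c i = 0" using indep ij(1) by blast
        then show False by (simp add: c_def)
      qed
      define E where "E = (\<lambda>i. f (x i)) ` {..<n}"
      have "lin_indep_over \<kappa> V E"
        unfolding lin_indep_over_def
      proof (intro allI impI ballI)
        fix c e assume sum: "(\<Oplus>\<^bsub>V\<^esub>x\<in>E. \<kappa> (c x) \<odot>\<^bsub>V\<^esub> x) = \<zero>\<^bsub>V\<^esub>" and "e \<in> E"
        then obtain i where i: "i < n" "e = f (x i)" by (auto simp: E_def)
        define y where "y e = x (inv_into {..<n} (\<lambda>i. f (x i)) e)" for e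
        have y: "y (f (x i)) = x i" if "i < n" for i
          using inv_into_f_f[OF inj, of i] that by (simp add: y_def)
        have "(\<Oplus>\<^bsub>V\<^esub>e\<in>E. \<kappa> (c e) \<odot>\<^bsub>V\<^esub> e) = f (\<Sum>e\<in>E. smul (\<kappa> (c e)) (y e))"
          using x smult y by (intro V.finsum_eq) (auto simp: E_def)
        also have "(\<Sum>e\<in>E. smul (\<kappa> (c e)) (y e)) = (\<Sum>i<n. smul (\<kappa> (c (f (x i)))) (x i))"
          unfolding E_def using inj y by (subst sum.reindex) (auto intro!: sum.cong)
        finally have "f (\<Sum>i<n. smul (\<kappa> (c (f (x i)))) (x i)) = \<zero>\<^bsub>V\<^esub>" using sum by simp
        moreover have "(\<Sum>i<n. smul (\<kappa> (c (f (x i)))) (x i)) \<in> Z"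
          using x by (intro comb(2)) auto
        ultimately have "(\<Sum>i<n. smul (\<kappa> (c (f (x i)))) (x i)) \<in> B"
          using zero_iff by blast
        then show "c e = 0" using indep[of "\<lambda>i. c (f (x i))" i] i by simp
      qed
      moreover have "finite E" "E \<subseteq> carrier V" "card E = n"
        using x inj by (auto simp: E_def V.carrier card_image)
      ultimately show "enat n \<le> dim_over \<kappa> V"
        unfolding dim_over_def by (intro SUP_upper2[of E]) auto
    qed
  qed
qed

section \<open>The polynomial ring and the Stanley-Reisner ideal\<close>

lemma poly_ring_on_simps [simp]:
  "carrier (poly_ring_on m) = polys_on m" "\<zero>\<^bsub>poly_ring_on m\<^esub> = 0" "\<one>\<^bsub>poly_ring_on m\<^esub> = 1"
  "p \<oplus>\<^bsub>poly_ring_on m\<^esub> q = p + q" "p \<otimes>\<^bsub>poly_ring_on m\<^esub> q = p * q"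
  by (simp_all add: poly_ring_on_def ring_of_type_algebra_def polys_on_def)

lemma additive_image_poly_ring_on: "additive_image (poly_ring_on m) (\<lambda>p. p) (polys_on m)"
  by standard (auto intro: polys.P_0 polys.P_add polys.P_uminus)

lemma cring_poly_ring_on: "cring (poly_ring_on m)"
proof (rule cringI)
  show "abelian_group (poly_ring_on m)"
    using additive_image.abelian_group[OF additive_image_poly_ring_on] .
  show "Group.comm_monoid (poly_ring_on m)"
    by (rule comm_monoidI) (auto simp: mult_ac intro: polys.P_1 polys.P_mult)
qed (auto simp: algebra_simps)

lemma prod_mvar: "finite J \<Longrightarrow> (\<Prod>i\<in>J. mvar i) = single (indicator_exp J) 1"
  by (induction J rule: finite_induct) (auto simp: mvar_def mult_single indicator_exp_def)

lemma poly_mapping_sum_single: "p = (\<Sum>t\<in>keys p. single t (lookup p t))"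
  by (rule poly_mapping_eqI) (simp add: lookup_sum lookup_single when_def in_keys_iff)

lemma ideal_nonface_polys:
  assumes "\<And>\<sigma> \<tau>. \<sigma> \<in> K \<Longrightarrow> \<tau> \<subseteq> \<sigma> \<Longrightarrow> \<tau> \<in> K"
  shows "ideal (nonface_polys m K :: 'f::field mpoly set) (poly_ring_on m)"
proof -
  interpret face: coefficient_ring "polys_on m :: 'f mpoly set" mconst "nonface_polys m K"
    by (rule coefficient_ring_polys) (rule assms)
  interpret R: cring "poly_ring_on m :: 'f mpoly ring" by (rule cring_poly_ring_on)
  have inv: "\<ominus>\<^bsub>poly_ring_on m\<^esub> p = - p" if "p \<in> polys_on m" for p :: "'f mpoly"
    using that by (intro R.minus_equality) (auto intro: face.P_uminus)
  show ?thesis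
  proof (rule idealI)
    show "subgroup (nonface_polys m K :: 'f mpoly set) (add_monoid (poly_ring_on m))"
    proof (rule R.add.subgroupI)
      show "nonface_polys m K \<noteq> ({} :: 'f mpoly set)" using face.I_0 by blast
      show "\<ominus>\<^bsub>poly_ring_on m\<^esub> p \<in> nonface_polys m K" if p: "p \<in> nonface_polys m K" for p :: "'f mpoly"
        using inv[of p] face.I_uminus[OF p] subsetD[OF face.I_subset p] by (simp only:)
    qed (use face.I_subset face.I_add in auto)
    show "x \<otimes>\<^bsub>poly_ring_on m\<^esub> a \<in> nonface_polys m K" "a \<otimes>\<^bsub>poly_ring_on m\<^esub> x \<in> nonface_polys m K"
      if "a \<in> nonface_polys m K" "x \<in> carrier (poly_ring_on m)" for a x :: "'f mpoly"
      using face.I_mult[of x a] that by (simp_all add: mult.commute)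
  qed (rule R.ring_axioms)
qed

text \<open>A monomial with nonface support J is a multiple of the generator belonging to J.
  Conversely the nonface monomials span an ideal, because nonfaces are closed under
  enlargement.\<close>

lemma stanley_reisner_ideal_eq:
  assumes K: "\<And>\<sigma> \<tau>. \<sigma> \<in> K \<Longrightarrow> \<tau> \<subseteq> \<sigma> \<Longrightarrow> \<tau> \<in> K"
  shows "stanley_reisner_ideal m K = (nonface_polys m K :: 'f::field mpoly set)"
proof -
  have I_ideal: "ideal (nonface_polys m K :: 'f mpoly set) (poly_ring_on m)"
    by (rule ideal_nonface_polys) (rule K)
  let ?G = "{\<Prod>i\<in>J. mvar i :: 'f mpoly | J. J \<subseteq> {1..m} \<and> J \<notin> K}"
  show ?thesis
    unfolding stanley_reisner_ideal_def
  proof (intro equalityI)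
    have "?G \<subseteq> nonface_polys m K"
    proof clarify
      fix J assume J: "J \<subseteq> {1..m}" "J \<notin> K"
      then have fJ: "finite J" using finite_subset by blast
      show "(\<Prod>i\<in>J. mvar i :: 'f mpoly) \<in> nonface_polys m K"
        using J fJ by (simp add: prod_mvar nonface_polys_def)
    qed
    then show "genideal (poly_ring_on m) ?G \<subseteq> nonface_polys m K"
      unfolding genideal_def using I_ideal by blast
    show "nonface_polys m K \<subseteq> genideal (poly_ring_on m) ?G"
      unfolding genideal_def
    proof (intro subsetI InterI)
      fix p :: "'f mpoly" and I assume p: "p \<in> nonface_polys m K" and "I \<in> {I. ideal I (poly_ring_on m) \<and> ?G \<subseteq> I}"
      then have I: "ideal I (poly_ring_on m)" "?G \<subseteq> I" by auto
      interpret I: ideal I "poly_ring_on m" by (rule I(1))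
      note sub = ideal.axioms(1)[OF I(1)]
      have zero: "0 \<in> I" using additive_subgroup.zero_closed[OF sub] by simp
      have add: "a + b \<in> I" if "a \<in> I" "b \<in> I" for a b
        using additive_subgroup.a_closed[OF sub that] by simp
      have monomial: "single t c \<in> I" if "t \<in> keys p" for t c
      proof -
        define J where "J = keys t"
        have J: "J \<subseteq> {1..m}" "J \<notin> K" "finite J" using p that by (auto simp: nonface_polys_def J_def)
        have "(\<Prod>i\<in>J. mvar i) \<in> I" using I(2) J by blast
        moreover have "keys (t - indicator_exp J) \<subseteq> J"
          using J(3) by (auto simp: in_keys_iff lookup_minus J_def)
        then have "single (t - indicator_exp J) c \<in> polys_on m"
          using J(1) by (auto simp: polys_on_def)
        ultimately have "single (t - indicator_exp J) c * (\<Prod>i\<in>J. mvar i) \<in> I"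
          using I.I_l_closed by simp
        also have "t - indicator_exp J + indicator_exp J = t"
          using J(3) by (intro poly_mapping_eqI) (auto simp: lookup_add lookup_minus lookup_indicator_exp J_def in_keys_iff)
        then have "single (t - indicator_exp J) c * (\<Prod>i\<in>J. mvar i) = single t c"
          using J(3) by (simp add: prod_mvar mult_single)
        finally show ?thesis .
      qed
      have "(\<Sum>t\<in>F. single t (lookup p t)) \<in> I" if "F \<subseteq> keys p" for F
        using finite_subset[OF that finite_keys] that
        by (induction F rule: finite_induct) (auto simp: zero monomial intro!: add)
      from this[OF order_refl] show "p \<in> I" by (simp flip: poly_mapping_sum_single)
    qed
  qed
qed

section \<open>Module records, tuples and matrices\<close>

lemma regular_module_simps [simp]:
  "carrier (regular_module R) = carrier R" "\<zero>\<^bsub>regular_module R\<^esub> = \<zero>\<^bsub>R\<^esub>"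
  "x \<oplus>\<^bsub>regular_module R\<^esub> y = x \<oplus>\<^bsub>R\<^esub> y" "x \<odot>\<^bsub>regular_module R\<^esub> y = x \<otimes>\<^bsub>R\<^esub> y"
  by (simp_all add: regular_module_def ring.defs module.defs)

lemma power_module_simps [simp]:
  "carrier (power_module M k) = {..<k} \<rightarrow>\<^sub>E carrier M"
  "\<zero>\<^bsub>power_module M k\<^esub> = (\<lambda>i\<in>{..<k}. \<zero>\<^bsub>M\<^esub>)"
  "x \<oplus>\<^bsub>power_module M k\<^esub> y = (\<lambda>i\<in>{..<k}. x i \<oplus>\<^bsub>M\<^esub> y i)"
  "r \<odot>\<^bsub>power_module M k\<^esub> x = (\<lambda>i\<in>{..<k}. r \<odot>\<^bsub>M\<^esub> x i)"
  by (simp_all add: power_module_def)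

lemma residue_field_module_simps [simp]:
  "carrier residue_field_module = UNIV" "\<zero>\<^bsub>residue_field_module\<^esub> = 0"
  "x \<oplus>\<^bsub>residue_field_module\<^esub> y = x + y" "p \<odot>\<^bsub>residue_field_module\<^esub> y = lookup p 0 * y"
  by (simp_all add: residue_field_module_def ring.defs module.defs ring_of_type_algebra_def)

lemma stanley_reisner_module_simps [simp]:
  "carrier (stanley_reisner_module m K) = a_rcosets\<^bsub>poly_ring_on m\<^esub> (stanley_reisner_ideal m K)"
  "\<zero>\<^bsub>stanley_reisner_module m K\<^esub> = stanley_reisner_ideal m K"
  "x \<oplus>\<^bsub>stanley_reisner_module m K\<^esub> y = set_add (poly_ring_on m) x y"
  "p \<odot>\<^bsub>stanley_reisner_module m K\<^esub> y = rcoset_mult (poly_ring_on m) (stanley_reisner_ideal m K)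
     (stanley_reisner_ideal m K +>\<^bsub>poly_ring_on m\<^esub> p) y"
  by (simp_all add: stanley_reisner_module_def stanley_reisner_ring_def ring.defs module.defs FactRing_def)

text \<open>Mediates between two conventions: tuples of \<open>power_module\<close> are undefined
  outside {..<k}, whereas vectors of \<open>free_on\<close> are 0 there.\<close>

definition tuple_map :: "('v \<Rightarrow> 'a) \<Rightarrow> nat \<Rightarrow> (nat \<Rightarrow> 'v) \<Rightarrow> nat \<Rightarrow> 'a" where
  "tuple_map f k x = (\<lambda>i\<in>{..<k}. f (x i))"

definition matrix_apply :: "nat \<Rightarrow> nat \<Rightarrow> (nat \<Rightarrow> nat \<Rightarrow> 'r::comm_ring_1) \<Rightarrow> (nat \<Rightarrow> 'r) \<Rightarrow> nat \<Rightarrow> 'r" where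
  "matrix_apply k l A x = (\<lambda>i. if i < l then \<Sum>j<k. A i j * x j else 0)"

lemma linear_over_matrix_apply: "linear_over smul (matrix_apply k l A)"
  by (auto simp: linear_over_def matrix_apply_def smul_def fun_eq_iff algebra_simps sum.distrib sum_distrib_left)

context additive_image
begin

lemma additive_image_power:
  fixes Q :: "(nat \<Rightarrow> 'v) set"
  assumes Q: "Q = {x. (\<forall>i. x i \<in> Z) \<and> (\<forall>i. i \<notin> {..<k} \<longrightarrow> x i = 0)}"
  shows "tuple_map f k ` Q = {..<k} \<rightarrow>\<^sub>E carrier V"
    "tuple_map f k 0 = (\<lambda>i\<in>{..<k}. \<zero>)"
    "\<And>x y. x \<in> Q \<Longrightarrow> y \<in> Q \<Longrightarrow> (\<lambda>i\<in>{..<k}. tuple_map f k x i \<oplus> tuple_map f k y i) = tuple_map f k (x + y)"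
    "0 \<in> Q" "\<And>x y. x \<in> Q \<Longrightarrow> y \<in> Q \<Longrightarrow> x + y \<in> Q" "\<And>x. x \<in> Q \<Longrightarrow> - x \<in> Q"
proof -
  show "tuple_map f k ` Q = {..<k} \<rightarrow>\<^sub>E carrier V"
  proof (intro equalityI subsetI)
    fix z assume z: "z \<in> {..<k} \<rightarrow>\<^sub>E carrier V"
    have "\<forall>i\<in>{..<k}. \<exists>x. x \<in> Z \<and> z i = f x" using z by (auto simp: carrier PiE_iff)
    from bchoice[OF this] obtain x where x: "\<And>i. i < k \<Longrightarrow> x i \<in> Z" "\<And>i. i < k \<Longrightarrow> z i = f (x i)" by auto
    define x' where "x' i = (if i < k then x i else 0)" for i
    have "z = tuple_map f k x'"
    proof
      fix i show "z i = tuple_map f k x' i"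
        using z x(2) by (cases "i < k") (auto simp: tuple_map_def x'_def PiE_iff extensional_def)
    qed
    moreover have "x' \<in> Q" using x(1) Z_0 by (auto simp: Q x'_def)
    ultimately show "z \<in> tuple_map f k ` Q" by (rule image_eqI)
  qed (auto simp: tuple_map_def Q carrier split: if_splits)
qed (auto simp: tuple_map_def zero Q add Z_0 Z_add Z_uminus fun_eq_iff restrict_def)

end

lemma matrix_map_tuple_map:
  fixes V :: "('r::comm_ring_1, 'a) module"
  assumes "additive_image V f Z"
    and smult: "\<And>p q. p \<in> Z \<Longrightarrow> q \<in> Z \<Longrightarrow> p \<odot>\<^bsub>V\<^esub> f q = f (p * q)" "\<And>p q. p \<in> Z \<Longrightarrow> q \<in> Z \<Longrightarrow> p * q \<in> Z"
    and A: "\<And>i j. i < l \<Longrightarrow> j < k \<Longrightarrow> A i j \<in> Z" and x: "\<And>j. x j \<in> Z"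
  shows "matrix_map V k l A (tuple_map f k x) = tuple_map f l (matrix_apply k l A x)"
proof -
  interpret additive_image V f Z by fact
  have "(\<Oplus>\<^bsub>V\<^esub>j\<in>{..<k}. A i j \<odot>\<^bsub>V\<^esub> tuple_map f k x j) = f (\<Sum>j<k. A i j * x j)" if "i < l" for i
    by (rule finsum_eq) (auto simp: tuple_map_def smult A x that)
  then show ?thesis
    by (auto simp: matrix_map_def tuple_map_def matrix_apply_def)
qed

lemma quotient_module_simps [simp]:
  "carrier (quotient_module M W) = a_rcosets\<^bsub>M\<^esub> W" "\<zero>\<^bsub>quotient_module M W\<^esub> = W"
  "x \<oplus>\<^bsub>quotient_module M W\<^esub> y = set_add M x y"
  "r \<odot>\<^bsub>quotient_module M W\<^esub> C = (\<Union>x\<in>C. W +>\<^bsub>M\<^esub> (r \<odot>\<^bsub>M\<^esub> x))"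
  by (simp_all add: quotient_module_def)

section \<open>The tensored complex on representatives\<close>

context
  fixes m :: nat and K :: "nat set set"
  assumes K: "simplicial_complex_on m K"
begin

interpretation face: coefficient_ring "polys_on m" mconst "nonface_polys m K"
  by (rule coefficient_ring_polys) (rule subface[OF K])

definition face_coset :: "'f::field mpoly \<Rightarrow> 'f mpoly set" where
  "face_coset p = nonface_polys m K +>\<^bsub>poly_ring_on m\<^esub> p"

lemma ideal_eq: "stanley_reisner_ideal m K = (nonface_polys m K :: 'f::field mpoly set)"
  by (rule stanley_reisner_ideal_eq) (rule subface[OF K])

interpretation R: additive_image "poly_ring_on m" "\<lambda>p. p" "polys_on m"
  by (rule additive_image_poly_ring_on)

lemma nonface_closed: "0 \<in> (nonface_polys m K :: 'f::field mpoly set) \<and>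
    (\<forall>x\<in>nonface_polys m K. \<forall>y\<in>nonface_polys m K. x + y \<in> (nonface_polys m K :: 'f mpoly set)) \<and>
    (\<forall>x\<in>nonface_polys m K. - x \<in> (nonface_polys m K :: 'f mpoly set))"
  using face.I_0 face.I_add face.I_uminus by blast

lemma additive_image_stanley_reisner:
  "additive_image (stanley_reisner_module m K) (face_coset :: 'f::field mpoly \<Rightarrow> _) (polys_on m)"
proof
  show "carrier (stanley_reisner_module m K) = face_coset ` polys_on m"
    using R.a_rcosets_eq[OF face.I_subset nonface_closed] by (simp add: ideal_eq face_coset_def[abs_def])
  show "\<zero>\<^bsub>stanley_reisner_module m K\<^esub> = face_coset (0 :: 'f mpoly)"
    by (simp add: ideal_eq face_coset_def R.coset_0[OF face.I_subset nonface_closed, simplified])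
  show "face_coset x \<oplus>\<^bsub>stanley_reisner_module m K\<^esub> face_coset y = face_coset (x + y)"
    if "x \<in> polys_on m" "y \<in> polys_on m" for x y
    using R.coset_add[OF face.I_subset nonface_closed that] by (simp add: face_coset_def)
qed (auto intro: face.P_0 face.P_add face.P_uminus)

interpretation M: additive_image "stanley_reisner_module m K" face_coset "polys_on m"
  by (rule additive_image_stanley_reisner)

lemma smult_face_coset:
  assumes "p \<in> polys_on m" "q \<in> polys_on m"
  shows "p \<odot>\<^bsub>stanley_reisner_module m K\<^esub> face_coset q = face_coset (p * q)"
proof -
  interpret I: ideal "nonface_polys m K" "poly_ring_on m"
    by (rule ideal_nonface_polys) (rule subface[OF K])
  show ?thesis
    using I.rcoset_mult_add[of p q] assms by (simp add: ideal_eq face_coset_def)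
qed

lemma face_coset_eq_iff:
  assumes "p \<in> polys_on m" "q \<in> polys_on m"
  shows "face_coset p = face_coset q \<longleftrightarrow> p - q \<in> nonface_polys m K"
proof -
  have "face_coset (p - q) = \<zero>\<^bsub>stanley_reisner_module m K\<^esub> \<longleftrightarrow> p - q \<in> nonface_polys m K"
    using R.coset_eq_self_iff[OF face.I_subset nonface_closed face.P_diff[OF assms]]
    by (simp add: ideal_eq face_coset_def)
  then show ?thesis using M.eq_iff[OF assms] by simp
qed

lemma tuple_face_coset_eq_iff:
  assumes "x \<in> free_on (polys_on m) {..<k}" "y \<in> free_on (polys_on m) {..<k}"
  shows "tuple_map face_coset k x = tuple_map face_coset k y \<longleftrightarrow> (\<forall>i. x i - y i \<in> nonface_polys m K)"
proof -
  have "tuple_map face_coset k x = tuple_map face_coset k y \<longleftrightarrow> (\<forall>i<k. face_coset (x i) = face_coset (y i))"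
    by (auto simp: tuple_map_def restrict_def fun_eq_iff)
  also have "\<dots> \<longleftrightarrow> (\<forall>i<k. x i - y i \<in> nonface_polys m K)"
    using assms by (simp add: face_coset_eq_iff free_on_def)
  also have "\<dots> \<longleftrightarrow> (\<forall>i. x i - y i \<in> nonface_polys m K)"
  proof -
    have "x i - y i \<in> nonface_polys m K" if "\<not> i < k" for i
      using assms that face.I_0 by (simp add: free_on_def)
    then show ?thesis by blast
  qed
  finally show ?thesis .
qed

context
  fixes b :: "nat \<Rightarrow> nat" and A :: "nat \<Rightarrow> nat \<Rightarrow> nat \<Rightarrow> 'f::field mpoly"
  assumes A: "\<And>n i j. i < b n \<Longrightarrow> j < b (Suc n) \<Longrightarrow> A n i j \<in> polys_on m"
begin

abbreviation "diff n \<equiv> matrix_apply (b (Suc n)) (b n) (A n)"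

abbreviation "free n \<equiv> free_on (polys_on m :: 'f mpoly set) {..<b n}"

abbreviation "coset_tuple n \<equiv> tuple_map (face_coset :: 'f mpoly \<Rightarrow> _) (b n)"

lemma diff_maps: "x \<in> free (Suc n) \<Longrightarrow> diff n x \<in> free n"
  using A by (auto simp: free_on_def matrix_apply_def intro!: face.P_sum face.P_mult face.P_0)

lemma matrix_map_coset_tuple:
  "x \<in> free (Suc n) \<Longrightarrow>
    matrix_map (stanley_reisner_module m K) (b (Suc n)) (b n) (A n) (coset_tuple (Suc n) x) = coset_tuple n (diff n x)"
  by (rule matrix_map_tuple_map[OF additive_image_stanley_reisner smult_face_coset face.P_mult A])
    (auto simp: free_on_def)

lemma free_eq: "free n = {x. (\<forall>i. x i \<in> polys_on m) \<and> (\<forall>i. i \<notin> {..<b n} \<longrightarrow> x i = 0)}"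
  by (simp add: free_on_def)

lemmas power_facts = M.additive_image_power[OF free_eq]

lemma tensor_cycles_eq:
  "tensor_cycles (stanley_reisner_module m K) b A n =
    coset_tuple n ` face.cycles_mod (\<lambda>n. {..<b n}) diff n"
proof (cases n)
  case 0
  have "face.cycles_mod (\<lambda>n. {..<b n}) diff 0 = free 0" by (simp add: face.cycles_mod_def)
  then show ?thesis using power_facts(1)[of 0] by (simp add: 0 tensor_cycles_def)
next
  case (Suc k)
  have eq: "coset_tuple k (diff k x) = \<zero>\<^bsub>power_module (stanley_reisner_module m K) (b k)\<^esub> \<longleftrightarrow>
      (\<forall>i. diff k x i \<in> nonface_polys m K)" if "x \<in> free (Suc k)" for x
    using tuple_face_coset_eq_iff[OF diff_maps[OF that] face.free_on_0] power_facts(2)[of k] by simp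
  have "tensor_cycles (stanley_reisner_module m K) b A n =
      {z \<in> coset_tuple (Suc k) ` free (Suc k).
        matrix_map (stanley_reisner_module m K) (b (Suc k)) (b k) (A k) z =
        \<zero>\<^bsub>power_module (stanley_reisner_module m K) (b k)\<^esub>}"
    by (simp add: Suc tensor_cycles_def a_kernel_def' power_facts(1))
  also have "\<dots> = coset_tuple (Suc k) ` {x \<in> free (Suc k). \<forall>i. diff k x i \<in> nonface_polys m K}"
    using matrix_map_coset_tuple[of _ k] eq by auto
  finally show ?thesis by (simp add: Suc face.cycles_mod_def)
qed

text \<open>\<open>boundaries_mod\<close> exceeds the image of the differential only by vectors with
  entries in the ideal, which become zero as tuples of cosets.\<close>

lemma tensor_boundaries_eq:
  "tensor_boundaries (stanley_reisner_module m K) b A n =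
    coset_tuple n ` face.boundaries_mod (\<lambda>n. {..<b n}) diff n"
proof -
  have "tensor_boundaries (stanley_reisner_module m K) b A n =
      (\<lambda>y. coset_tuple n (diff n y)) ` free (Suc n)"
  proof -
    have "carrier (power_module (stanley_reisner_module m K) (b (Suc n))) = coset_tuple (Suc n) ` free (Suc n)"
      using power_facts(1)[of "Suc n"] by simp
    then show ?thesis
      unfolding tensor_boundaries_def
      by (simp only: image_image) (intro image_cong refl matrix_map_coset_tuple)
  qed
  also have "\<dots> = coset_tuple n ` face.boundaries_mod (\<lambda>n. {..<b n}) diff n"
  proof (intro equalityI image_subsetI)
    fix y assume y: "y \<in> free (Suc n)"
    then have "diff n y \<in> face.boundaries_mod (\<lambda>n. {..<b n}) diff n"
      using diff_maps face.I_0 by (auto simp: face.boundaries_mod_def intro!: bexI[of _ y])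
    then show "coset_tuple n (diff n y) \<in> coset_tuple n ` face.boundaries_mod (\<lambda>n. {..<b n}) diff n"
      by (rule imageI)
  next
    fix x assume "x \<in> face.boundaries_mod (\<lambda>n. {..<b n}) diff n"
    then obtain y where y: "x \<in> free n" "y \<in> free (Suc n)" "\<forall>i. x i - diff n y i \<in> nonface_polys m K"
      by (auto simp: face.boundaries_mod_def)
    then have "coset_tuple n x = coset_tuple n (diff n y)"
      using tuple_face_coset_eq_iff[OF y(1) diff_maps[OF y(2)]] by simp
    then show "coset_tuple n x \<in> (\<lambda>y. coset_tuple n (diff n y)) ` free (Suc n)"
      using y(2) by (rule image_eqI)
  qed
  finally show ?thesis .
qed

text \<open>Two nested quotients, modulo the ideal and modulo boundaries, are collapsed into one on
  representatives. The relation \<open>dd\<close> provides that boundaries are cycles.\<close>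

theorem dim_over_tensor_homology:
  assumes dd: "\<And>n x. x \<in> free (Suc (Suc n)) \<Longrightarrow> diff n (diff (Suc n) x) = 0"
  shows "dim_over mconst (tensor_homology (stanley_reisner_module m K) b A n) =
    rel_dim mconst (face.cycles_mod (\<lambda>n. {..<b n}) diff n) (face.boundaries_mod (\<lambda>n. {..<b n}) diff n)"
proof -
  define Z where "Z = face.cycles_mod (\<lambda>n. {..<b n}) diff n"
  define B where "B = face.boundaries_mod (\<lambda>n. {..<b n}) diff n"
  define G where "G = (power_module (stanley_reisner_module m K) (b n))
    \<lparr>carrier := tensor_cycles (stanley_reisner_module m K) b A n\<rparr>"
  define W where "W = coset_tuple n ` B"
  define q where "q x = W +>\<^bsub>G\<^esub> coset_tuple n x" for x
  have lin: "linear_over smul (diff n)" for n by (rule linear_over_matrix_apply)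
  have uminus: "- x = smul (-1) x" for x :: "nat \<Rightarrow> 'f mpoly" by (simp add: smul_def fun_eq_iff)
  have ZF: "Z \<subseteq> free n" by (auto simp: Z_def face.cycles_mod_def)
  have BF: "B \<subseteq> free n" by (auto simp: B_def face.boundaries_mod_def)
  have Z_add: "x + y \<in> Z" if "x \<in> Z" "y \<in> Z" for x y
    using that by (auto simp: Z_def face.cycles_mod_def linear_over_add[OF lin] intro: face.free_on_add face.I_add)
  have Z_smul: "smul r x \<in> Z" if "r \<in> polys_on m" "x \<in> Z" for r x
    using that by (auto simp: Z_def face.cycles_mod_def linear_over_smul[OF lin] smul_def[of r "diff _ _"]
        intro: face.free_on_smul face.I_mult)
  have Z_0: "0 \<in> Z"
    by (simp add: Z_def face.cycles_mod_def linear_over_0[OF lin] face.free_on_0 face.I_0)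
  have B_add: "x + y \<in> B" if xy: "x \<in> B" "y \<in> B" for x y
  proof -
    obtain x' y' where *: "x' \<in> free (Suc n)" "y' \<in> free (Suc n)"
      "\<And>i. x i - diff n x' i \<in> nonface_polys m K" "\<And>i. y i - diff n y' i \<in> nonface_polys m K"
      using xy by (auto simp: B_def face.boundaries_mod_def)
    have "(x + y) i - diff n (x' + y') i \<in> nonface_polys m K" for i
      using face.I_add[OF *(3,4)[of i]] by (simp add: linear_over_add[OF lin] algebra_simps)
    then show ?thesis
      using xy face.free_on_add[OF *(1,2)] face.free_on_add unfolding B_def face.boundaries_mod_def by blast
  qed
  have B_smul: "smul r x \<in> B" if r: "r \<in> polys_on m" and x: "x \<in> B" for r x
  proof -
    obtain x' where *: "x' \<in> free (Suc n)" "\<And>i. x i - diff n x' i \<in> nonface_polys m K"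
      using x by (auto simp: B_def face.boundaries_mod_def)
    have "smul r x i - diff n (smul r x') i \<in> nonface_polys m K" for i
      using face.I_mult[OF r *(2)[of i]] unfolding linear_over_smul[OF lin]
      by (simp add: smul_def right_diff_distrib)
    then show ?thesis
      using x face.free_on_smul[OF r *(1)] face.free_on_smul[OF r] unfolding B_def face.boundaries_mod_def by blast
  qed
  have B_0: "0 \<in> B"
    unfolding B_def face.boundaries_mod_def
    by (intro CollectI conjI bexI[of _ 0] face.free_on_0)
      (simp add: linear_over_0[OF lin] face.I_0)
  have BZ: "B \<subseteq> Z"
  proof
    fix x assume x: "x \<in> B"
    then obtain y where y: "y \<in> free (Suc n)" "\<And>i. x i - diff n y i \<in> nonface_polys m K"
      by (auto simp: B_def face.boundaries_mod_def)
    have "diff k x i \<in> nonface_polys m K" if n: "n = Suc k" for k i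
    proof -
      have xd: "x - diff n y \<in> free (Suc k)"
        using BF x diff_maps[OF y(1)] n face.free_on_diff by blast
      have "diff k (x - diff n y) i \<in> nonface_polys m K"
        using y(2) diff_maps[of _ k]
        by (intro face.linear_over_ideal[OF lin _ _ xd]) (auto simp: image_subset_iff)
      moreover have "diff k (diff n y) = 0" using dd y(1) n by simp
      ultimately show ?thesis by (simp add: linear_over_diff[OF lin])
    qed
    then show "x \<in> Z" using BF x by (auto simp: Z_def face.cycles_mod_def)
  qed
  have minus_one: "- 1 \<in> (polys_on m :: 'f mpoly set)" by (intro face.P_uminus face.P_1)
  interpret G: additive_image G "coset_tuple n" Z
  proof
    show "carrier G = coset_tuple n ` Z" by (simp add: G_def Z_def tensor_cycles_eq)
    show "\<zero>\<^bsub>G\<^esub> = coset_tuple n 0" using power_facts(2)[of n] by (simp add: G_def)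
    show "coset_tuple n x \<oplus>\<^bsub>G\<^esub> coset_tuple n y = coset_tuple n (x + y)" if "x \<in> Z" "y \<in> Z" for x y
      using power_facts(3)[of x n y] that ZF by (auto simp: G_def)
    show "- x \<in> Z" if "x \<in> Z" for x using Z_smul[OF minus_one that] by (simp only: uminus)
  qed (use Z_0 Z_add in auto)
  have B_uminus: "- x \<in> B" if "x \<in> B" for x using B_smul[OF minus_one that] by (simp only: uminus)
  have B_closed: "0 \<in> B \<and> (\<forall>x\<in>B. \<forall>y\<in>B. x + y \<in> B) \<and> (\<forall>x\<in>B. - x \<in> B)"
    using B_0 B_add B_uminus by blast
  note B_facts = BZ B_closed
  \<comment> \<open>Tuples of cosets agree when the entries differ by elements of the ideal, and B
    absorbs such differences.\<close>
  have sat: "\<forall>x\<in>B. \<forall>y\<in>Z. coset_tuple n x = coset_tuple n y \<longrightarrow> y \<in> B"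
  proof (intro ballI impI)
    fix x y assume x: "x \<in> B" and y: "y \<in> Z" and eq: "coset_tuple n x = coset_tuple n y"
    have yx: "y i - x i \<in> nonface_polys m K" for i
      using eq tuple_face_coset_eq_iff[of y "b n" x] x y BF ZF by auto
    obtain x' where x': "x' \<in> free (Suc n)" "\<And>i. x i - diff n x' i \<in> nonface_polys m K"
      using x by (auto simp: B_def face.boundaries_mod_def)
    have "y i - diff n x' i \<in> nonface_polys m K" for i
      using face.I_add[OF yx[of i] x'(2)[of i]] by simp
    then show "y \<in> B" using y ZF x'(1) unfolding B_def face.boundaries_mod_def by blast
  qed
  have tens: "tensor_homology (stanley_reisner_module m K) b A n = quotient_module G W"
    by (simp add: tensor_homology_def G_def W_def B_def tensor_boundaries_eq)
  show ?thesis
    unfolding tens Z_def[symmetric] B_def[symmetric]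
  proof (rule dim_over_eq_rel_dim[where f = q])
    show "additive_image (quotient_module G W) q Z"
    proof
      show "carrier (quotient_module G W) = q ` Z"
        using G.a_rcosets_eq[OF B_facts] by (simp add: W_def q_def[abs_def])
      show "\<zero>\<^bsub>quotient_module G W\<^esub> = q 0"
        using G.coset_0[OF B_facts] by (simp add: W_def q_def)
      show "q x \<oplus>\<^bsub>quotient_module G W\<^esub> q y = q (x + y)" if "x \<in> Z" "y \<in> Z" for x y
        using G.coset_add[OF B_facts that] by (simp add: W_def q_def)
    qed (use G.Z_0 G.Z_add G.Z_uminus in auto)
    show "smul (mconst c) x \<in> Z" if "x \<in> Z" for c x
      using Z_smul[OF face.P_scalar that] .
    show "q x = \<zero>\<^bsub>quotient_module G W\<^esub> \<longleftrightarrow> x \<in> B" if "x \<in> Z" for x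
      using G.coset_eq_self_iff[OF B_facts that sat] by (simp add: q_def W_def)
    show "mconst c \<odot>\<^bsub>quotient_module G W\<^esub> q x = q (smul (mconst c) x)" if x: "x \<in> Z" for c x
    proof -
      have sm: "mconst c \<odot>\<^bsub>G\<^esub> coset_tuple n y = coset_tuple n (smul (mconst c) y)" if "y \<in> Z" for y
      proof -
        have "y i \<in> polys_on m" for i using that ZF by (auto simp: free_on_def)
        then have "mconst c \<odot>\<^bsub>stanley_reisner_module m K\<^esub> face_coset (y i) = face_coset (mconst c * y i)" for i
          using smult_face_coset[OF face.P_scalar] by blast
        then show ?thesis
          by (simp add: G_def tuple_map_def smul_def restrict_def fun_eq_iff del: stanley_reisner_module_simps)
      qed
      have q_eq: "q x = (\<lambda>z. coset_tuple n (z + x)) ` B"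
        using G.coset_eq[OF B_facts x] by (simp add: q_def W_def)
      \<comment> \<open>The scalar action on a coset is a union over all its members; as B is closed
        under scalars, each member contributes the same coset.\<close>
      have shift: "W +>\<^bsub>G\<^esub> (mconst c \<odot>\<^bsub>G\<^esub> coset_tuple n (z + x)) = q (smul (mconst c) x)" if z: "z \<in> B" for z
      proof -
        have "z + x \<in> Z" using z BZ x Z_add by blast
        then have "mconst c \<odot>\<^bsub>G\<^esub> coset_tuple n (z + x) = coset_tuple n (smul (mconst c) z + smul (mconst c) x)"
          by (simp add: sm smul_simps)
        then show ?thesis
          using G.coset_shift[OF B_facts Z_smul[OF face.P_scalar x] B_smul[OF face.P_scalar z]]
          by (simp add: q_def W_def)
      qed
      show ?thesis
        unfolding quotient_module_simps q_eq image_image using shift B_0 by auto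
    qed
  qed (simp_all add: mconst_def single_uminus)
qed

end

end

section \<open>Free resolutions of the residue field\<close>

interpretation reg: additive_image "regular_module (poly_ring_on m)" "\<lambda>p. p" "polys_on m" for m
  by standard (auto intro: polys.P_0 polys.P_add polys.P_uminus)

interpretation residue: additive_image "residue_field_module :: ('f::field mpoly, 'f) module" "\<lambda>c. c" UNIV
  by standard auto

definition matrix_augmentation :: "nat \<Rightarrow> (nat \<Rightarrow> 'f::field) \<Rightarrow> (nat \<Rightarrow> 'f mpoly) \<Rightarrow> 'f" where
  "matrix_augmentation k e x = (\<Sum>j<k. lookup (x j) 0 * e j)"

lemma linear_over_matrix_augmentation:
  "linear_over (\<lambda>r y. lookup r 0 * y) (matrix_augmentation k e)"
  by (auto simp: linear_over_def matrix_augmentation_def smul_def lookup_add lookup_mult_0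
      algebra_simps sum.distrib sum_distrib_left)

text \<open>Translates the record-based notion into the one on function spaces. Kernels and images
  correspond under the injective maps t n, so equalities between them can be pulled back.\<close>

lemma free_resolution_iff:
  "free_resolution (poly_ring_on m) (residue_field_module :: ('f::field mpoly, 'f) module) b A e \<longleftrightarrow>
    (\<forall>n. \<forall>i<b n. \<forall>j<b (Suc n). A n i j \<in> polys_on m) \<and>
    coefficient_ring.resolution (polys_on m) (\<lambda>r y. lookup r 0 * y) (\<lambda>n. {..<b n})
      (\<lambda>n. matrix_apply (b (Suc n)) (b n) (A n)) (matrix_augmentation (b 0) e)"
proof (cases "\<forall>n. \<forall>i<b n. \<forall>j<b (Suc n). A n i j \<in> (polys_on m :: 'f mpoly set)")
  case True
  let ?M = "regular_module (poly_ring_on m) :: ('f mpoly, 'f mpoly) module"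
  let ?N = "residue_field_module :: ('f mpoly, 'f) module"
  define F where "F n = free_on (polys_on m :: 'f mpoly set) {..<b n}" for n
  define d where "d n = matrix_apply (b (Suc n)) (b n) (A n)" for n
  define t where "t n = tuple_map (\<lambda>p :: 'f mpoly. p) (b n)" for n
  have F_eq: "F n = {x. (\<forall>i. x i \<in> polys_on m) \<and> (\<forall>i. i \<notin> {..<b n} \<longrightarrow> x i = 0)}" for n
    by (simp add: F_def free_on_def)
  note pow = reg.additive_image_power[OF F_eq]
  have carrier: "carrier (power_module ?M (b n)) = t n ` F n" for n
    using pow(1)[of n] by (simp add: t_def)
  have zero: "\<zero>\<^bsub>power_module ?M (b n)\<^esub> = t n 0" for n
    using pow(2)[of n] by (simp add: t_def)
  \<comment> \<open>\<open>t n\<close> only replaces the value 0 outside {..<b n} by an undefined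
    one.\<close>
  have inj: "inj_on (t n) (F n)" for n
    by (rule inj_onI) (auto simp: t_def tuple_map_def F_eq restrict_def fun_eq_iff, metis)
  have d_F: "d n x \<in> F n" if "x \<in> F (Suc n)" for n x
    using that True by (auto simp: d_def F_def free_on_def matrix_apply_def intro!: polys.P_sum polys.P_mult polys.P_0)
  have map: "matrix_map ?M (b (Suc n)) (b n) (A n) (t (Suc n) x) = t n (d n x)" if "x \<in> F (Suc n)" for n x
    unfolding t_def d_def
    by (rule matrix_map_tuple_map[OF reg.additive_image_axioms[of m]])
      (use that True in \<open>auto simp: F_eq intro: polys.P_mult\<close>)
  have ker: "a_kernel (power_module ?M (b (Suc n))) (power_module ?M (b n)) (matrix_map ?M (b (Suc n)) (b n) (A n)) =
      t (Suc n) ` {x \<in> F (Suc n). d n x = 0}" for n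
  proof -
    have "t n (d n x) = t n 0 \<longleftrightarrow> d n x = 0" if "x \<in> F (Suc n)" for x
      using inj_on_eq_iff[OF inj d_F[OF that] pow(4)[of n]] .
    then show ?thesis
      unfolding a_kernel_def' carrier zero using map by auto
  qed
  have im: "matrix_map ?M (b (Suc n)) (b n) (A n) ` carrier (power_module ?M (b (Suc n))) =
      t n ` d n ` F (Suc n)" for n
    unfolding carrier image_image by (intro image_cong refl map)
  have aug: "(\<Oplus>\<^bsub>?N\<^esub>j\<in>{..<b 0}. t 0 x j \<odot>\<^bsub>?N\<^esub> e j) = matrix_augmentation (b 0) e x" for x
    unfolding matrix_augmentation_def by (rule residue.finsum_eq) (auto simp: t_def tuple_map_def)
  have d_sub: "d n ` F (Suc n) \<subseteq> F n" for n using d_F by auto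
  have "free_resolution (poly_ring_on m) ?N b A e \<longleftrightarrow>
      matrix_augmentation (b 0) e ` F 0 = UNIV \<and>
      t 0 ` {x \<in> F 0. matrix_augmentation (b 0) e x = 0} = t 0 ` d 0 ` F 1 \<and>
      (\<forall>n. t (Suc n) ` {x \<in> F (Suc n). d n x = 0} = t (Suc n) ` d (Suc n) ` F (Suc (Suc n)))"
  proof -
    have k0: "a_kernel (power_module ?M (b 0)) ?N (\<lambda>x. \<Oplus>\<^bsub>?N\<^esub>j\<in>{..<b 0}. x j \<odot>\<^bsub>?N\<^esub> e j) =
        t 0 ` {x \<in> F 0. matrix_augmentation (b 0) e x = 0}"
      unfolding a_kernel_def' carrier using aug by auto
    have i0: "(\<lambda>x. \<Oplus>\<^bsub>?N\<^esub>j\<in>{..<b 0}. x j \<odot>\<^bsub>?N\<^esub> e j) ` carrier (power_module ?M (b 0)) =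
        matrix_augmentation (b 0) e ` F 0"
      unfolding carrier image_image aug ..
    have i1: "matrix_map ?M (b (Suc 0)) (b 0) (A 0) ` carrier (power_module ?M (b 1)) = t 0 ` d 0 ` F 1"
      unfolding One_nat_def by (rule im)
    show ?thesis
      unfolding free_resolution_def Let_def k0 i0 ker im[of "Suc _"] i1 using True by simp
  qed
  also have "\<dots> \<longleftrightarrow> matrix_augmentation (b 0) e ` F 0 = UNIV \<and>
      {x \<in> F 0. matrix_augmentation (b 0) e x = 0} = d 0 ` F 1 \<and>
      (\<forall>n. {x \<in> F (Suc n). d n x = 0} = d (Suc n) ` F (Suc (Suc n)))"
    using inj_on_image_eq_iff[OF inj] d_sub by (simp add: Collect_subset)
  also have "\<dots> \<longleftrightarrow> coefficient_ring.resolution (polys_on m) (\<lambda>r y. lookup r 0 * y) (\<lambda>n. {..<b n})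
      d (matrix_augmentation (b 0) e)"
  proof -
    have set_eq: "{x \<in> B. Q x} = C \<longleftrightarrow> (\<forall>x\<in>B. Q x \<longleftrightarrow> x \<in> C)" if "C \<subseteq> B"
      for B C :: "(nat \<Rightarrow> 'f mpoly) set" and Q
      using that by blast
    have d_sub_1: "d 0 ` F 1 \<subseteq> F 0" unfolding One_nat_def by (rule d_sub)
    show ?thesis
      unfolding polys.resolution_def F_def[symmetric] set_eq[OF d_sub_1] set_eq[OF d_sub]
      using d_sub linear_over_matrix_augmentation[of "b 0" e]
      by (simp add: linear_over_matrix_apply d_def)
  qed
  finally show ?thesis using True by (simp add: d_def[abs_def])
next
  case False
  then show ?thesis by (auto simp: free_resolution_def Let_def)
qed

text \<open>Without a witness the \<open>SOME\<close> in \<open>Tor\<close> would be unspecified.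
  The witness is the Koszul complex with the n-subsets enumerated by numbers below their
  count.\<close>

theorem free_resolution_exists:
  "\<exists>b A e. free_resolution (poly_ring_on m) (residue_field_module :: ('f::field mpoly, 'f) module) b A e"
proof -
  let ?act = "\<lambda>r :: 'f mpoly. \<lambda>y. lookup r 0 * y"
  let ?aug = "\<lambda>x :: nat set \<Rightarrow> 'f mpoly. lookup (x {}) 0"
  define S where "S = subsets_of_card m"
  define b where "b n = card (S n)" for n
  have finS: "finite (S n)" for n by (simp add: S_def)
  have "\<exists>f. bij_betw f {..<b n} (S n)" for n
    using ex_bij_betw_nat_finite[OF finS] by (simp add: b_def atLeast0LessThan)
  then obtain en where en: "\<And>n. bij_betw (en n) {..<b n} (S n)" by metis
  define iv where "iv n = inv_into {..<b n} (en n)" for n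
  have en_in: "i < b n \<Longrightarrow> en n i \<in> S n" for n i using bij_betw_apply[OF en] by auto
  have iv_in: "J \<in> S n \<Longrightarrow> iv n J < b n" for n J
    using inv_into_into[of J "en n" "{..<b n}"] en[of n] by (simp add: iv_def bij_betw_def)
  have iv_en: "i < b n \<Longrightarrow> iv n (en n i) = i" for n i
    using en by (simp add: iv_def bij_betw_def)
  have en_iv: "J \<in> S n \<Longrightarrow> en n (iv n J) = J" for n J
    using bij_betw_inv_into_right[OF en] by (simp add: iv_def)
  define F where "F n = free_on (polys_on m :: 'f mpoly set) {..<b n}" for n
  define G where "G n = free_on (polys_on m :: 'f mpoly set) (S n)" for n
  \<comment> \<open>U and V are the inverse changes of index between numbers and subsets; all
    conditions are transported along them.\<close>
  define U where "U n x = (\<lambda>J. if J \<in> S n then x (iv n J) else 0)" for n and x :: "nat \<Rightarrow> 'f mpoly"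
  define V where "V n y = (\<lambda>i. if i < b n then y (en n i) else 0)" for n and y :: "nat set \<Rightarrow> 'f mpoly"
  have U_in: "U n x \<in> G n" if "x \<in> F n" for n x
    using that by (auto simp: U_def F_def G_def free_on_def intro: polys.P_0)
  have V_in: "V n y \<in> F n" if "y \<in> G n" for n y
    using that by (auto simp: V_def F_def G_def free_on_def intro: polys.P_0)
  have UV: "U n (V n y) = y" if "y \<in> G n" for n y
    using that by (auto simp: U_def V_def G_def free_on_def iv_in en_iv)
  have VU: "V n (U n x) = x" if "x \<in> F n" for n x
    using that by (auto simp: U_def V_def F_def free_on_def iv_en en_in)
  define A where "A n i j = (koszul_d m (basis_vec (en (Suc n) j)) (en n i) :: 'f mpoly)" for n i j
  define e where "e j = ?aug (basis_vec (en 0 j))" for j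
  define d where "d n = matrix_apply (b (Suc n)) (b n) (A n)" for n
  have kd: "koszul_d m y \<in> G n" if "y \<in> G (Suc n)" for n and y :: "nat set \<Rightarrow> 'f mpoly"
    using koszul_d_maps that by (simp add: G_def S_def)
  have d_eq: "d n x = V n (koszul_d m (U (Suc n) x))" if x: "x \<in> F (Suc n)" for n x
  proof
    fix i
    have "koszul_d m (U (Suc n) x) (en n i) = (\<Sum>J\<in>S (Suc n). x (iv (Suc n) J) * koszul_d m (basis_vec J) (en n i))"
      using linear_over_expand[OF linear_over_koszul_d finS U_in[OF x, unfolded G_def]]
      by (simp add: sum_fun_apply smul_def U_def)
    also have "\<dots> = (\<Sum>j<b (Suc n). x j * A n i j)"
      by (subst sum.reindex_bij_betw[OF en, symmetric]) (simp add: iv_en A_def)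
    finally show "d n x i = V n (koszul_d m (U (Suc n) x)) i"
      by (simp add: d_def matrix_apply_def V_def mult.commute)
  qed
  have Ud: "U n (d n x) = koszul_d m (U (Suc n) x)" if x: "x \<in> F (Suc n)" for n x
    unfolding d_eq[OF x] by (rule UV[OF kd[OF U_in[OF x]]])
  have aug_lin: "linear_over ?act ?aug"
    by (simp add: linear_over_def lookup_add smul_def lookup_mult_0)
  have aug_eq: "matrix_augmentation (b 0) e x = ?aug (U 0 x)" if x: "x \<in> F 0" for x
  proof -
    have "?aug (U 0 x) = (\<Sum>J\<in>S 0. lookup (x (iv 0 J)) 0 * ?aug (basis_vec J))"
      using linear_over_expand[OF aug_lin finS U_in[OF x, unfolded G_def]] by (simp add: U_def)
    also have "\<dots> = (\<Sum>j<b 0. lookup (x j) 0 * e j)"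
      by (subst sum.reindex_bij_betw[OF en, symmetric]) (simp add: iv_en e_def)
    finally show ?thesis by (simp add: matrix_augmentation_def)
  qed
  have image_iff: "U n x \<in> koszul_d m ` G (Suc n) \<longleftrightarrow> x \<in> d n ` F (Suc n)" if x: "x \<in> F n" for n x
  proof
    assume "U n x \<in> koszul_d m ` G (Suc n)"
    then obtain y where y: "y \<in> G (Suc n)" "U n x = koszul_d m y" by blast
    have "x = V n (koszul_d m (U (Suc n) (V (Suc n) y)))" using VU[OF x] UV[OF y(1)] y(2) by simp
    also have "\<dots> = d n (V (Suc n) y)" using d_eq[OF V_in[OF y(1)]] by simp
    finally show "x \<in> d n ` F (Suc n)" using V_in[OF y(1)] by (rule image_eqI)
  next
    assume "x \<in> d n ` F (Suc n)"
    then obtain z where "z \<in> F (Suc n)" "x = d n z" by blast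
    then show "U n x \<in> koszul_d m ` G (Suc n)" using Ud U_in by auto
  qed
  have res: "polys.resolution m ?act S (\<lambda>_. koszul_d m) ?aug"
    unfolding S_def by (rule koszul_resolution)
  have "polys.resolution m ?act (\<lambda>n. {..<b n}) d (matrix_augmentation (b 0) e)"
    unfolding polys.resolution_def F_def[symmetric]
  proof (intro conjI allI ballI)
    show "linear_over smul (d n)" for n by (simp add: d_def linear_over_matrix_apply)
    show "d n ` F (Suc n) \<subseteq> F n" for n using d_eq kd U_in V_in by auto
    show "matrix_augmentation (b 0) e ` F 0 = UNIV"
    proof (intro equalityI subset_UNIV subsetI)
      fix c
      have "c \<in> ?aug ` G 0" using polys.resolutionD(5)[OF res] unfolding G_def by blast
      then obtain y where "y \<in> G 0" "c = ?aug y" by blast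
      then show "c \<in> matrix_augmentation (b 0) e ` F 0"
        using aug_eq[OF V_in] UV V_in by (intro image_eqI[of _ _ "V 0 y"]) simp_all
    qed
    show "(matrix_augmentation (b 0) e x = 0) = (x \<in> d 0 ` F 1)" if x: "x \<in> F 0" for x
      using polys.resolutionD(6)[OF res U_in[OF x, unfolded G_def]] image_iff[OF x] aug_eq[OF x]
      by (simp add: G_def)
    show "(d n x = 0) = (x \<in> d (Suc n) ` F (Suc (Suc n)))" if x: "x \<in> F (Suc n)" for n x
    proof -
      have U0: "U n 0 = 0" and V0: "V n 0 = 0" by (auto simp: U_def V_def)
      have "d n x = 0 \<longleftrightarrow> koszul_d m (U (Suc n) x) = 0"
        using Ud[OF x] d_eq[OF x] U0 V0 by metis
      also have "\<dots> \<longleftrightarrow> U (Suc n) x \<in> koszul_d m ` G (Suc (Suc n))"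
        using polys.resolutionD(7)[OF res U_in[OF x, unfolded G_def]] by (simp add: G_def)
      finally show ?thesis using image_iff[OF x] by simp
    qed
  qed (simp_all add: linear_over_matrix_augmentation)
  moreover have "A n i j \<in> polys_on m" if "i < b n" "j < b (Suc n)" for n i j
  proof -
    have "basis_vec (en (Suc n) j) \<in> G (Suc n)"
      unfolding G_def by (rule polys.free_on_basis[OF en_in[OF that(2)]])
    then have "koszul_d m (basis_vec (en (Suc n) j)) \<in> G n" by (rule kd)
    then show ?thesis by (simp add: A_def G_def free_on_def)
  qed
  ultimately show ?thesis
    unfolding free_resolution_iff d_def by blast
qed

section \<open>Total bigraded Betti numbers\<close>

context
  fixes m :: nat and K :: "nat set set"
  assumes K: "simplicial_complex_on m K"
begin

interpretation face: coefficient_ring "polys_on m" mconst "nonface_polys m K"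
  by (rule coefficient_ring_polys) (rule subface[OF K])

text \<open>Whatever resolution \<open>SOME\<close> returns, it is a resolution of the residue
  field, so the comparison in both directions lets the Koszul complex replace it.\<close>

lemma dim_over_Tor_eq:
  "dim_over (mconst :: 'f::field \<Rightarrow> 'f mpoly)
      (Tor (poly_ring_on m) (stanley_reisner_module m K) residue_field_module n) =
    rel_dim mconst (koszul_cycles m K n :: (nat set \<Rightarrow> 'f mpoly) set) (koszul_boundaries m K n)"
proof -
  let ?N = "residue_field_module :: ('f mpoly, 'f) module"
  let ?R = "poly_ring_on m :: 'f mpoly ring"
  define s where "s = (SOME (b, A, e). free_resolution ?R ?N b A e)"
  have "\<exists>s. case s of (b, A, e) \<Rightarrow> free_resolution ?R ?N b A e"
    using free_resolution_exists[of m] by auto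
  then have "case s of (b, A, e) \<Rightarrow> free_resolution ?R ?N b A e"
    unfolding s_def by (rule someI_ex)
  then obtain b A e where s: "s = (b, A, e)" and fr: "free_resolution ?R ?N b A e"
    by (cases s) auto
  let ?d = "\<lambda>n. matrix_apply (b (Suc n)) (b n) (A n)"
  have entries: "\<And>n i j. i < b n \<Longrightarrow> j < b (Suc n) \<Longrightarrow> A n i j \<in> polys_on m"
    and res: "face.resolution (\<lambda>r y. lookup r 0 * y) (\<lambda>n. {..<b n}) ?d (matrix_augmentation (b 0) e)"
    using fr unfolding free_resolution_iff by blast+
  have "Tor ?R (stanley_reisner_module m K) ?N n = tensor_homology (stanley_reisner_module m K) b A n"
    unfolding Tor_def Let_def s_def[symmetric] s by simp
  then have "dim_over mconst (Tor ?R (stanley_reisner_module m K) ?N n) =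
      rel_dim mconst (face.cycles_mod (\<lambda>n. {..<b n}) ?d n) (face.boundaries_mod (\<lambda>n. {..<b n}) ?d n)"
    using dim_over_tensor_homology[OF K, of b A n] entries face.resolution_dd[OF res] by simp
  also have "\<dots> = rel_dim mconst (koszul_cycles m K n :: (nat set \<Rightarrow> 'f mpoly) set) (koszul_boundaries m K n)"
    by (intro antisym face.rel_dim_resolution_le[OF res koszul_resolution]
        face.rel_dim_resolution_le[OF koszul_resolution res])
  finally show ?thesis .
qed

lemma total_bigraded_betti_eq:
  "total_bigraded_betti TYPE('f::field) m K =
    (SUP N. \<Sum>n<N. rel_dim mconst (koszul_cycles m K n :: (nat set \<Rightarrow> 'f mpoly) set) (koszul_boundaries m K n))"
  unfolding total_bigraded_betti_def dim_over_Tor_eq ..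

lemma total_bigraded_betti_le:
  assumes w: "\<And>U. U \<subseteq> {1..m} \<Longrightarrow> U \<noteq> {} \<Longrightarrow> w U \<in> U"
  shows "total_bigraded_betti TYPE('f::field) m K \<le>
    enat ((\<Sum>U\<in>Pow {1..m} - {{}}. card (critical_faces K U (w U))) + 1)"
  unfolding total_bigraded_betti_eq
proof (rule SUP_least)
  fix N
  let ?c = "\<lambda>n. card (critical_cells m K w n) + (if n = 0 then 1 else 0)"
  have "(\<Sum>n<N. rel_dim mconst (koszul_cycles m K n :: (nat set \<Rightarrow> 'f mpoly) set) (koszul_boundaries m K n)) \<le>
      (\<Sum>n<N. enat (?c n))"
    by (intro sum_mono rel_dim_koszul_le[OF K] w)
  also have "\<dots> = enat (\<Sum>n<N. ?c n)" by (induction N) (simp_all add: zero_enat_def)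
  \<comment> \<open>Enlarging the range beyond m makes it contain every degree in which critical
    cells exist.\<close>
  also have "(\<Sum>n<N. ?c n) \<le> (\<Sum>n<N + m + 1. ?c n)" by (rule sum_mono2) auto
  also have "\<dots> = (\<Sum>U\<in>Pow {1..m} - {{}}. card (critical_faces K U (w U))) + 1"
    unfolding sum.distrib by (subst sum_card_critical_cells) auto
  finally show "(\<Sum>n<N. rel_dim mconst (koszul_cycles m K n :: (nat set \<Rightarrow> 'f mpoly) set) (koszul_boundaries m K n)) \<le>
      enat ((\<Sum>U\<in>Pow {1..m} - {{}}. card (critical_faces K U (w U))) + 1)"
    by simp
qed

text \<open>For a skeleton the choice of w does not influence the count: every d-subset of U - {w U}
  is critical, which gives (card U - 1) choose d, and grouping by card U yields
  \<open>g_bound\<close>. The general upper bound and the lower bound for skeleta then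
  coincide.\<close>

lemma total_bigraded_betti_skeleton:
  assumes skeleton: "\<And>\<sigma>. \<sigma> \<in> K \<longleftrightarrow> \<sigma> \<subseteq> {1..m} \<and> card \<sigma> \<le> d"
  shows "total_bigraded_betti TYPE('f::field) m K = enat (g_bound m d + 1)"
proof -
  define w where "w U = Min U" for U :: "nat set"
  have w: "w U \<in> U" if "U \<subseteq> {1..m}" "U \<noteq> {}" for U
    using that finite_subset[of U "{1..m}"] by (simp add: w_def)
  let ?c = "\<lambda>n. card (critical_cells m K w n) + (if n = 0 then 1 else 0)"
  have crit: "critical_faces K U (w U) = {\<sigma>. \<sigma> \<subseteq> U - {w U} \<and> card \<sigma> = d}" if U: "U \<subseteq> {1..m}" "U \<noteq> {}" for U
  proof (intro equalityI subsetI)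
    fix \<sigma> assume \<sigma>: "\<sigma> \<in> critical_faces K U (w U)"
    then show "\<sigma> \<in> {\<sigma>. \<sigma> \<subseteq> U - {w U} \<and> card \<sigma> = d}"
      using critical_face_skeleton[OF K _ \<sigma> U(1) w[OF U]] skeleton by (simp add: critical_faces_def)
  next
    fix \<sigma> assume \<sigma>: "\<sigma> \<in> {\<sigma>. \<sigma> \<subseteq> U - {w U} \<and> card \<sigma> = d}"
    then have "finite \<sigma>" "w U \<notin> \<sigma>" "\<sigma> \<subseteq> {1..m}" using U finite_subset[of \<sigma> "{1..m}"] by auto
    then show "\<sigma> \<in> critical_faces K U (w U)"
      using \<sigma> skeleton[of \<sigma>] skeleton[of "insert (w U) \<sigma>"] by (simp add: critical_faces_def)
  qed
  have "(\<Sum>U\<in>Pow {1..m} - {{}}. card (critical_faces K U (w U))) =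
      (\<Sum>U\<in>Pow {1..m} - {{}}. (card U - 1) choose d)"
  proof (rule sum.cong)
    fix U assume "U \<in> Pow {1..m} - {{}}"
    then have U: "U \<subseteq> {1..m}" "U \<noteq> {}" "finite U" using finite_subset by auto
    then show "card (critical_faces K U (w U)) = (card U - 1) choose d"
      using n_subsets[of "U - {w U}" d] crit[OF U(1,2)] w[OF U(1,2)] by simp
  qed simp
  also have "\<dots> = (\<Sum>U\<in>Pow {1..m}. if card U = 0 then 0 else (card U - 1) choose d)"
  proof (rule sum.mono_neutral_cong_left)
    fix U assume "U \<in> Pow {1..m} - {{}}"
    then have "card U \<noteq> 0" using finite_subset[of U "{1..m}"] by (simp add: card_eq_0_iff)
    then show "(card U - 1) choose d = (if card U = 0 then 0 else (card U - 1) choose d)" by simp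
  qed auto
  also have "\<dots> = (\<Sum>k\<le>m. (m choose k) * (if k = 0 then 0 else (k - 1) choose d))"
    using sum_Pow_card[of "{1..m}" "\<lambda>k. if k = 0 then 0 else (k - 1) choose d"] by simp
  also have "\<dots> = g_bound m d"
    unfolding g_bound_atMost by (rule sum.mono_neutral_cong_right) auto
  finally have sum: "(\<Sum>U\<in>Pow {1..m} - {{}}. card (critical_faces K U (w U))) = g_bound m d" .
  have "enat (g_bound m d + 1) = enat (\<Sum>n<m + 1. ?c n)"
    unfolding sum[symmetric] sum.distrib by (subst sum_card_critical_cells) auto
  also have "\<dots> = (\<Sum>n<m + 1. enat (?c n))"
  proof -
    have "enat (\<Sum>n<N. ?c n) = (\<Sum>n<N. enat (?c n))" for N
      by (induction N) (simp_all add: zero_enat_def flip: plus_enat_simps(1))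
    then show ?thesis .
  qed
  also have "\<dots> \<le> (\<Sum>n<m + 1. rel_dim mconst (koszul_cycles m K n :: (nat set \<Rightarrow> 'f mpoly) set) (koszul_boundaries m K n))"
    by (intro sum_mono rel_dim_koszul_ge[OF K, where d = d] skeleton w)
  also have "\<dots> \<le> total_bigraded_betti TYPE('f) m K"
    unfolding total_bigraded_betti_eq by (rule SUP_upper) simp
  finally show ?thesis
    using total_bigraded_betti_le[OF w] unfolding sum by (intro antisym)
qed

end

theorem theorem1p7:
  fixes m :: nat and K :: "nat set set"
  assumes "m \<ge> 1"
    and "simplicial_complex_on m K"
  shows "total_bigraded_betti TYPE('f::field) m K \<le> enat (g_bound m ((m - 1) div 3) + 1) \<and>
    (total_bigraded_betti TYPE('f::field) m K = enat (g_bound m ((m - 1) div 3) + 1)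
           \<longleftrightarrow> K = simplex_skeleton m (int ((m - 1) div 3) - 1))"
proof -
  note K = assms(2)
  define w where "w U = arg_min_on (\<lambda>u. card (critical_faces K U u)) U" for U
  have w: "w U \<in> U" if "U \<subseteq> {1..m}" "U \<noteq> {}" for U
    unfolding w_def using that finite_subset[of U "{1..m}"] by (intro arg_min_if_finite(1)) auto
  have min: "card (critical_faces K U (w U)) \<le> card (critical_faces K U u)" if "U \<subseteq> {1..m}" "u \<in> U" for U u
    unfolding w_def using that finite_subset[of U "{1..m}"] by (intro arg_min_least) auto
  define c where "c = (\<Sum>U\<in>Pow {1..m} - {{}}. card (critical_faces K U (w U)))"
  have le: "total_bigraded_betti TYPE('f) m K \<le> enat (c + 1)"
    unfolding c_def by (rule total_bigraded_betti_le[OF K w])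
  have c: "c \<le> g_bound m ((m - 1) div 3)"
    unfolding c_def by (rule sum_critical_faces_le(1)[OF K assms(1) min])
  show ?thesis
  proof (intro conjI iffI)
    show "total_bigraded_betti TYPE('f) m K \<le> enat (g_bound m ((m - 1) div 3) + 1)"
      using le c by (meson add_le_mono1 enat_ord_simps(1) order_trans)
    assume "total_bigraded_betti TYPE('f) m K = enat (g_bound m ((m - 1) div 3) + 1)"
    then have "c = g_bound m ((m - 1) div 3)" using le c by simp
    then show "K = simplex_skeleton m (int ((m - 1) div 3) - 1)"
      unfolding c_def by (rule sum_critical_faces_le(2)[OF K assms(1), rotated]) (rule min)
  next
    assume eq: "K = simplex_skeleton m (int ((m - 1) div 3) - 1)"
    \<comment> \<open>Dimension e - 1 means at most e elements, so d = (m - 1) div 3. For m <= 3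
      this is 0 and the skeleton is \<open>{{}}\<close>; then the assumption on K is contradictory,
      as is the equality of the two numbers.\<close>
    have "\<sigma> \<in> K \<longleftrightarrow> \<sigma> \<subseteq> {1..m} \<and> card \<sigma> \<le> (m - 1) div 3" for \<sigma>
      unfolding eq simplex_skeleton_def by auto
    then show "total_bigraded_betti TYPE('f) m K = enat (g_bound m ((m - 1) div 3) + 1)"
      by (rule total_bigraded_betti_skeleton[OF K])
  qed
qed

end
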